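(* For any causal DAG $G$, $\mathcal{GPT}(G)\subseteq\mathcal{MI}(G)\subseteq\mathcal{VVS}(G)$.
   Context: **Causal DAGs.** A causal DAG $G(V,W,\mathcal E)$ is a finite directed acyclic graph with vertex set $V\sqcup W$ and edge set $\mathcal E$. Each $v\in V$ carries an observed variable $X_v$ with a fixed finite alphabet $\mathcal X_v$; vertices in $W$ are latent (they may have parents). $\mathrm{pa}$ denotes parents; $X_S=(X_v)_{v\in S}$. A (probability) kernel $q(x_A|x_B)$ is a non-negative function with $\sum_{x_A}q(x_A|x_B)=1$ for every $x_B$. **GPTs.** A GPT (generalized probabilistic theory) $\mathcal G$ consists of system types, closed under an associative, symmetric composition $(A,B)\mapsto AB$ with trivial system $I$, subject to: (1) each state of a system $A$ is determined by the kernel of outcome probabilities of a complete set of fiducial measurements, so states are vectors in a real vector space $V_A$ (with $V_I=\mathbb R$ and normalized state $1$). (2) The state set $\mathcal S_A\subset V_A$ is the convex hull of a convex set $\Omega_A$ of normalized states and the zero vector; a linear functional $u_A$ equals $1$ on $\Omega_A$. (3) Transformations from $A$ to $B$ are linear maps; they can be applied to part of a composite system (giving maps $V_{AC}\to V_{BC}$ for every $C$) and compose sequentially and in parallel according to the usual rules of a symmetric monoidal category; all linear maps taking states to states (also when applied to part of a composite) are allowed. States are transformations $I\to A$, effects are transformations $A\to I$. (4) If $\omega_A\in\mathcal S_A$, $\omega_B\in\mathcal S_B$ then $\omega_A\otimes\omega_B\in\mathcal S_{AB}$. (5) No-signalling: for $\omega\in\Omega_{AB}$ and any measurement on $A$ (effects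 $\{e_x\}$ with $\sum_x e_x=u_A$), $\sum_x(e_x\otimes \mathrm{id}_B)(\omega)$ is a normalized state of $B$ that does not depend on the measurement (equivalently, the deterministic effect $u_A$ of each system is unique). A test from $A$ to $B$ with finite outcome set $\mathcal X$ is a family $\{T_x\}_{x\in\mathcal X}$ of transformations with $u_B\circ\sum_xT_x=u_A$. **The sets $\mathcal G(G)$ and $\mathcal{GPT}(G)$.** Assign to every edge leaving a latent vertex a system type; edges leaving observed vertices carry the trivial system. To each vertex $v$ and each value of its observed parents $x_{\mathrm{pa}(v)\cap V}$ assign a test $\{T(x_v|x_{\mathrm{pa}(v)})\}$ whose input is the composite of the systems on edges into $v$ and whose output is the composite of the systems on edges out of $v$. If $v\in V$ the outcome set is $\mathcal X_v$ (and the output is trivial); if $v\in W$ there is a single trivial outcome. Wiring all tests according to $G$ gives for each $x_V$ a scalar $p(x_V)=\prod_{v\in V\cup W}T(x_v|x_{\mathrm{pa}(v)})$ (circuit composition). $\mathcal G(G)$ is the set of all distributions $p(X_V)$ so obtained, and $\mathcal{GPT}(G)=\bigcup_{\mathcal G}\mathcal G(G)$ over all GPTs. **Ordinary Markov model.** $\mathcal I(G)$ is the set of distributions $p(X_V)$ such that for all disjoint $A,B,C\subseteq V$ with $A,B$ $d$-separated by $C$ in $G$ (standard $d$-separation, paths may pass through latent vertices), $X_A\perp X_B\mid X_C$. If $S$ is a set of parentless observed vertices of a DAG with observed set $V\sqcup S$, a kernel $q(X_V|X_S)$ is said to be in $\mathcal I$ of that DAG if the joint distribution in which the variables $X_s$,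 $s\in S$, are independent and uniform and $X_V$ given $X_S$ is distributed as $q$ is in it. **Visible vertex splitting.** Let $V_{\rm split}\subseteq V$ be the observed vertices having both an incoming and an outgoing edge. $\mathsf{VVSplit}(G)$ has observed vertices $V\cup V^\#$ with $V^\#=\{v^\#:v\in V_{\rm split}\}$ new parentless vertices ($X_{v^\#}$ has the alphabet of $X_v$), latent vertices $W$, and edges obtained from $\mathcal E$ by replacing each edge $v\to y$, $v\in V_{\rm split}$, by $v^\#\to y$. The projection of a kernel $q(X_V|X_{V^\#})$ is $\mathsf{Proj}(q)(x_V)=q(x_V\mid X_{v^\#}=x_v\ \forall v\in V_{\rm split})$. $\mathcal{VVS}(G)=\{\mathsf{Proj}(q): q(X_V|X_{V^\#})\in\mathcal I(\mathsf{VVSplit}(G))\}$. **Maximal interruption.** Let $V_{\rm rip}\subseteq V$ be the observed vertices with at least two outgoing edges. $\mathsf{MaxInt}(G)$ has observed vertices $V\cup U$, latent vertices $W$, where for each $v\in V_{\rm split}\cup V_{\rm rip}$ and each edge $e:v\to y$ a new parentless vertex $u_e\in U$ (with the alphabet of $X_v$) is added and $e$ is replaced by $u_e\to y$. $\mathsf{Proj}(q)(x_V)=q(x_V\mid X_{u_e}=x_{\mathrm{origin}(e)}\ \forall u_e\in U)$ for a kernel $q(X_V|X_U)$. $\mathcal{MI}(G)=\{\mathsf{Proj}(q): q(X_V|X_U)\in\mathcal I(\mathsf{MaxInt}(G))\}$. *)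

theory Defs
  imports "HOL-Analysis.Analysis"
begin

section \<open>Causal DAGs, d-separation and the ordinary Markov model\<close>

record ('a, 'x) dag =
  obs :: "'a set"
  lat :: "'a set"
  edges :: "('a \<times> 'a) set"
  alph :: "'a \<Rightarrow> 'x set"

definition causal_dag :: "('a, 'x) dag \<Rightarrow> bool" where
  "causal_dag G \<longleftrightarrow>
     finite (obs G) \<and> finite (lat G) \<and> obs G \<inter> lat G = {} \<and>
     edges G \<subseteq> (obs G \<union> lat G) \<times> (obs G \<union> lat G) \<and> acyclic (edges G) \<and>
     (\<forall>v\<in>obs G. finite (alph G v) \<and> alph G v \<noteq> {})"

definition parents :: "('a, 'x) dag \<Rightarrow> 'a \<Rightarrow> 'a set" where
  "parents G v = {u. (u, v) \<in> edges G}"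

definition children :: "('a, 'x) dag \<Rightarrow> 'a \<Rightarrow> 'a set" where
  "children G v = {y. (v, y) \<in> edges G}"

text \<open>Values of the variables in \<open>S\<close>, as extensional functions.\<close>

definition vals :: "('a, 'x) dag \<Rightarrow> 'a set \<Rightarrow> ('a \<Rightarrow> 'x) set" where
  "vals G S = PiE S (alph G)"

text \<open>A path is given by its vertices: in an acyclic graph two adjacent vertices are joined by
  exactly one edge.\<close>

definition undirected_path :: "('a \<times> 'a) set \<Rightarrow> 'a list \<Rightarrow> bool" where
  "undirected_path E p \<longleftrightarrow> p \<noteq> [] \<and> distinct p \<and>
     (\<forall>i. Suc i < length p \<longrightarrow> (p ! i, p ! Suc i) \<in> E \<or> (p ! Suc i, p ! i) \<in> E)"

definition collider_at :: "('a \<times> 'a) set \<Rightarrow> 'a list \<Rightarrow> nat \<Rightarrow> bool" where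
  "collider_at E p i \<longleftrightarrow> (p ! (i - 1), p ! i) \<in> E \<and> (p ! Suc i, p ! i) \<in> E"

definition blocked :: "('a \<times> 'a) set \<Rightarrow> 'a set \<Rightarrow> 'a list \<Rightarrow> bool" where
  "blocked E C p \<longleftrightarrow> (\<exists>i. 0 < i \<and> Suc i < length p \<and>
     (if collider_at E p i then \<forall>d. (p ! i, d) \<in> E\<^sup>* \<longrightarrow> d \<notin> C else p ! i \<in> C))"

definition d_separated :: "('a \<times> 'a) set \<Rightarrow> 'a set \<Rightarrow> 'a set \<Rightarrow> 'a set \<Rightarrow> bool" where
  "d_separated E A B C \<longleftrightarrow>
     (\<forall>p. undirected_path E p \<and> hd p \<in> A \<and> last p \<in> B \<longrightarrow> blocked E C p)"

text \<open>Distributions of the observed variables are represented by their probability functions,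
  extended by zero outside the set of joint values.\<close>

definition distributions :: "('a, 'x) dag \<Rightarrow> (('a \<Rightarrow> 'x) \<Rightarrow> real) set" where
  "distributions G = {p. (\<forall>x. 0 \<le> p x) \<and> (\<forall>x. x \<notin> vals G (obs G) \<longrightarrow> p x = 0) \<and>
     (\<Sum>x\<in>vals G (obs G). p x) = 1}"

definition marginal ::
  "('a, 'x) dag \<Rightarrow> (('a \<Rightarrow> 'x) \<Rightarrow> real) \<Rightarrow> 'a set \<Rightarrow> ('a \<Rightarrow> 'x) \<Rightarrow> real" where
  "marginal G p S x = (\<Sum>y | y \<in> vals G (obs G) \<and> (\<forall>v\<in>S. y v = x v). p y)"

text \<open>\<open>conditional G p S C x\<close> is the probability of \<open>X\<^sub>S = x\<^sub>S\<close> given \<open>X\<^sub>C = x\<^sub>C\<close>.\<close>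

definition conditional ::
  "('a, 'x) dag \<Rightarrow> (('a \<Rightarrow> 'x) \<Rightarrow> real) \<Rightarrow> 'a set \<Rightarrow> 'a set \<Rightarrow> ('a \<Rightarrow> 'x) \<Rightarrow> real" where
  "conditional G p S C x = marginal G p (S \<union> C) x / marginal G p C x"

definition cond_indep ::
  "('a, 'x) dag \<Rightarrow> (('a \<Rightarrow> 'x) \<Rightarrow> real) \<Rightarrow> 'a set \<Rightarrow> 'a set \<Rightarrow> 'a set \<Rightarrow> bool" where
  "cond_indep G p A B C \<longleftrightarrow> (\<forall>x\<in>vals G (obs G). marginal G p C x > 0 \<longrightarrow>
     conditional G p (A \<union> B) C x = conditional G p A C x * conditional G p B C x)"

definition markov_model :: "('a, 'x) dag \<Rightarrow> (('a \<Rightarrow> 'x) \<Rightarrow> real) set" where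
  "markov_model G = {p \<in> distributions G. \<forall>A B C.
     A \<subseteq> obs G \<and> B \<subseteq> obs G \<and> C \<subseteq> obs G \<and> A \<inter> B = {} \<and> A \<inter> C = {} \<and> B \<inter> C = {} \<and>
     d_separated (edges G) A B C \<longrightarrow> cond_indep G p A B C}"

text \<open>A kernel \<open>q(x\<^sub>A | x\<^sub>B)\<close> is the function \<open>q x\<^sub>A x\<^sub>B\<close>.\<close>

definition kernel ::
  "('a, 'x) dag \<Rightarrow> 'a set \<Rightarrow> 'a set \<Rightarrow> (('a \<Rightarrow> 'x) \<Rightarrow> ('a \<Rightarrow> 'x) \<Rightarrow> real) \<Rightarrow> bool" where
  "kernel G A B q \<longleftrightarrow> (\<forall>y\<in>vals G B. (\<forall>x\<in>vals G A. 0 \<le> q x y) \<and> (\<Sum>x\<in>vals G A. q x y) = 1)"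

text \<open>The joint distribution in which the variables in \<open>S\<close> are independent and uniform, and the
  other observed variables are distributed according to \<open>q\<close> given those in \<open>S\<close>.\<close>

definition uniform_joint ::
  "('a, 'x) dag \<Rightarrow> 'a set \<Rightarrow> (('a \<Rightarrow> 'x) \<Rightarrow> ('a \<Rightarrow> 'x) \<Rightarrow> real) \<Rightarrow> ('a \<Rightarrow> 'x) \<Rightarrow> real" where
  "uniform_joint G S q z = (if z \<in> vals G (obs G)
     then q (restrict z (obs G - S)) (restrict z S) * (\<Prod>s\<in>S. 1 / real (card (alph G s)))
     else 0)"

definition markov_kernels ::
  "('a, 'x) dag \<Rightarrow> 'a set \<Rightarrow> (('a \<Rightarrow> 'x) \<Rightarrow> ('a \<Rightarrow> 'x) \<Rightarrow> real) set" where
  "markov_kernels G S = {q. kernel G (obs G - S) S q \<and> uniform_joint G S q \<in> markov_model G}"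


section \<open>Visible vertex splitting and maximal interruption\<close>

definition split_verts :: "('a, 'x) dag \<Rightarrow> 'a set" where
  "split_verts G = {v \<in> obs G. parents G v \<noteq> {} \<and> children G v \<noteq> {}}"

definition rip_verts :: "('a, 'x) dag \<Rightarrow> 'a set" where
  "rip_verts G = {v \<in> obs G. 2 \<le> card (children G v)}"

text \<open>\<open>Inl v\<close> is the original vertex \<open>v\<close> and \<open>Inr v\<close> is the new vertex \<open>v\<^sup>#\<close>.\<close>

definition VVSplit :: "('a, 'x) dag \<Rightarrow> ('a + 'a, 'x) dag" where
  "VVSplit G = \<lparr>
     obs = Inl ` obs G \<union> Inr ` split_verts G,
     lat = Inl ` lat G,
     edges = {(Inl v, Inl y) |v y. (v, y) \<in> edges G \<and> v \<notin> split_verts G} \<union>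
             {(Inr v, Inl y) |v y. (v, y) \<in> edges G \<and> v \<in> split_verts G},
     alph = case_sum (alph G) (alph G)\<rparr>"

definition split_proj ::
  "('a, 'x) dag \<Rightarrow> (('a + 'a \<Rightarrow> 'x) \<Rightarrow> ('a + 'a \<Rightarrow> 'x) \<Rightarrow> real) \<Rightarrow> ('a \<Rightarrow> 'x) \<Rightarrow> real" where
  "split_proj G q x = (if x \<in> vals G (obs G)
     then q (\<lambda>a\<in>Inl ` obs G. x (projl a)) (\<lambda>a\<in>Inr ` split_verts G. x (projr a))
     else 0)"

definition VVS :: "('a, 'x) dag \<Rightarrow> (('a \<Rightarrow> 'x) \<Rightarrow> real) set" where
  "VVS G = {split_proj G q |q. q \<in> markov_kernels (VVSplit G) (Inr ` split_verts G)}"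

definition cut_edges :: "('a, 'x) dag \<Rightarrow> ('a \<times> 'a) set" where
  "cut_edges G = {(v, y) \<in> edges G. v \<in> split_verts G \<union> rip_verts G}"

text \<open>\<open>Inl v\<close> is the original vertex \<open>v\<close> and \<open>Inr e\<close> is the new vertex \<open>u\<^sub>e\<close>.\<close>

definition MaxInt :: "('a, 'x) dag \<Rightarrow> ('a + 'a \<times> 'a, 'x) dag" where
  "MaxInt G = \<lparr>
     obs = Inl ` obs G \<union> Inr ` cut_edges G,
     lat = Inl ` lat G,
     edges = {(Inl v, Inl y) |v y. (v, y) \<in> edges G - cut_edges G} \<union>
             {(Inr (v, y), Inl y) |v y. (v, y) \<in> cut_edges G},
     alph = case_sum (alph G) (\<lambda>e. alph G (fst e))\<rparr>"

definition int_proj ::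
  "('a, 'x) dag \<Rightarrow> (('a + 'a \<times> 'a \<Rightarrow> 'x) \<Rightarrow> ('a + 'a \<times> 'a \<Rightarrow> 'x) \<Rightarrow> real) \<Rightarrow> ('a \<Rightarrow> 'x) \<Rightarrow> real"
  where
  "int_proj G q x = (if x \<in> vals G (obs G)
     then q (\<lambda>a\<in>Inl ` obs G. x (projl a)) (\<lambda>a\<in>Inr ` cut_edges G. x (fst (projr a)))
     else 0)"

definition MI :: "('a, 'x) dag \<Rightarrow> (('a \<Rightarrow> 'x) \<Rightarrow> real) set" where
  "MI G = {int_proj G q |q. q \<in> markov_kernels (MaxInt G) (Inr ` cut_edges G)}"


section \<open>Generalized probabilistic theories\<close>

text \<open>
  System types are the elements of \<open>'s\<close>, transformations are elements of \<open>'m\<close>, and all the state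
  spaces are subspaces of one real vector space \<open>'w\<close>.  \<open>g \<cdot> f\<close> is \<open>g\<close> after \<open>f\<close>.  A transformation
  is kept apart from its linear map \<open>act\<close>, because the maps it induces on composite systems
  need not be determined by that map unless the theory is locally tomographic.\<close>

record ('s, 'm, 'w) gpt_struct =
  unit_sys :: 's ("\<I>\<index>")
  sys_comp :: "'s \<Rightarrow> 's \<Rightarrow> 's" (infixr "\<odot>\<index>" 75)
  hom :: "'s \<Rightarrow> 's \<Rightarrow> 'm set" ("Hom\<index>")
  ident :: "'s \<Rightarrow> 'm" ("\<iota>\<index>")
  seq :: "'m \<Rightarrow> 'm \<Rightarrow> 'm" (infixr "\<cdot>\<index>" 65)
  par :: "'m \<Rightarrow> 'm \<Rightarrow> 'm" (infixr "\<otimes>\<index>" 70)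
  swap :: "'s \<Rightarrow> 's \<Rightarrow> 'm" ("\<sigma>\<index>")
  act :: "'m \<Rightarrow> 'w \<Rightarrow> 'w" ("Act\<index>")
  normalized :: "'s \<Rightarrow> 'w set" ("\<Omega>\<index>")
  unit_functional :: "'s \<Rightarrow> 'w \<Rightarrow> real" ("\<uu>\<index>")
  one_state :: 'w ("\<one>\<index>")

text \<open>Composition of systems is strictly associative and unital; it is symmetric up to the
  swap transformations.\<close>

locale strict_symmetric_monoidal =
  fixes \<G> :: "('s, 'm, 'w) gpt_struct" (structure)
  assumes sys_assoc: "(A \<odot> B) \<odot> C = A \<odot> (B \<odot> C)"
    and sys_unit_left: "\<I> \<odot> A = A"
    and sys_unit_right: "A \<odot> \<I> = A"
    and ident_hom: "\<iota> A \<in> Hom A A"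
    and seq_hom: "f \<in> Hom A B \<Longrightarrow> g \<in> Hom B C \<Longrightarrow> g \<cdot> f \<in> Hom A C"
    and seq_assoc: "f \<in> Hom A B \<Longrightarrow> g \<in> Hom B C \<Longrightarrow> h \<in> Hom C D \<Longrightarrow> (h \<cdot> g) \<cdot> f = h \<cdot> (g \<cdot> f)"
    and ident_left: "f \<in> Hom A B \<Longrightarrow> \<iota> B \<cdot> f = f"
    and ident_right: "f \<in> Hom A B \<Longrightarrow> f \<cdot> \<iota> A = f"
    and par_hom: "f \<in> Hom A B \<Longrightarrow> g \<in> Hom C D \<Longrightarrow> f \<otimes> g \<in> Hom (A \<odot> C) (B \<odot> D)"
    and par_ident: "\<iota> A \<otimes> \<iota> B = \<iota> (A \<odot> B)"
    and interchange:
      "f \<in> Hom A B \<Longrightarrow> g \<in> Hom B C \<Longrightarrow> f' \<in> Hom A' B' \<Longrightarrow> g' \<in> Hom B' C' \<Longrightarrow>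
       (g \<cdot> f) \<otimes> (g' \<cdot> f') = (g \<otimes> g') \<cdot> (f \<otimes> f')"
    and par_assoc:
      "f \<in> Hom A B \<Longrightarrow> g \<in> Hom C D \<Longrightarrow> h \<in> Hom E F \<Longrightarrow> (f \<otimes> g) \<otimes> h = f \<otimes> (g \<otimes> h)"
    and par_unit_left: "f \<in> Hom A B \<Longrightarrow> \<iota> \<I> \<otimes> f = f"
    and par_unit_right: "f \<in> Hom A B \<Longrightarrow> f \<otimes> \<iota> \<I> = f"
    and swap_hom: "\<sigma> A B \<in> Hom (A \<odot> B) (B \<odot> A)"
    and swap_natural:
      "f \<in> Hom A B \<Longrightarrow> g \<in> Hom C D \<Longrightarrow> \<sigma> B D \<cdot> (f \<otimes> g) = (g \<otimes> f) \<cdot> \<sigma> A C"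
    and swap_swap: "\<sigma> B A \<cdot> \<sigma> A B = \<iota> (A \<odot> B)"
    and swap_hexagon: "\<sigma> A (B \<odot> C) = (\<iota> B \<otimes> \<sigma> A C) \<cdot> (\<sigma> A B \<otimes> \<iota> C)"

definition state_space :: "('s, 'm, 'w::real_vector) gpt_struct \<Rightarrow> 's \<Rightarrow> 'w set" ("\<V>\<index>") where
  "state_space \<G> A = span (normalized \<G> A)"

definition states :: "('s, 'm, 'w::real_vector) gpt_struct \<Rightarrow> 's \<Rightarrow> 'w set" ("\<S>\<index>") where
  "states \<G> A = convex hull (insert 0 (normalized \<G> A))"

text \<open>The effects and the scalars take values in the span of \<open>\<one>\<close>, which is identified with the real
  numbers by means of the unit functional of the trivial system.\<close>

definition scalar :: "('s, 'm, 'w::real_vector) gpt_struct \<Rightarrow> 'w \<Rightarrow> real" where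
  "scalar \<G> w = unit_functional \<G> (unit_sys \<G>) w"

definition test ::
  "('s, 'm, 'w::real_vector) gpt_struct \<Rightarrow> 's \<Rightarrow> 's \<Rightarrow> 'i set \<Rightarrow> ('i \<Rightarrow> 'm) \<Rightarrow> bool" where
  "test \<G> A B X T \<longleftrightarrow> finite X \<and> (\<forall>x\<in>X. T x \<in> hom \<G> A B) \<and>
     (\<forall>w\<in>state_space \<G> A.
        unit_functional \<G> B (\<Sum>x\<in>X. act \<G> (T x) w) = unit_functional \<G> A w)"

text \<open>A measurement is a test with trivial output; labelling its outcomes by natural numbers is no
  restriction.\<close>

definition measurement ::
  "('s, 'm, 'w::real_vector) gpt_struct \<Rightarrow> 's \<Rightarrow> nat set \<Rightarrow> (nat \<Rightarrow> 'm) \<Rightarrow> bool" where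
  "measurement \<G> A X e \<longleftrightarrow> test \<G> A (unit_sys \<G>) X e"

text \<open>A linear map \<open>F \<I>\<close> from \<open>\<V> A\<close> to \<open>\<V> B\<close> takes states to states, also when applied to part of a
  composite: \<open>F C\<close> is its application to the first part of \<open>A \<odot> C\<close>, and it commutes
  with whatever is done to \<open>C\<close>.\<close>

definition completely_state_preserving ::
  "('s, 'm, 'w::real_vector) gpt_struct \<Rightarrow> 's \<Rightarrow> 's \<Rightarrow> ('s \<Rightarrow> 'w \<Rightarrow> 'w) \<Rightarrow> bool" where
  "completely_state_preserving \<G> A B F \<longleftrightarrow>
     (\<forall>C. linear (F C) \<and>
          F C ` states \<G> (sys_comp \<G> A C) \<subseteq> states \<G> (sys_comp \<G> B C)) \<and>
     (\<forall>C D. \<forall>t\<in>hom \<G> C D. \<forall>w\<in>state_space \<G> (sys_comp \<G> A C).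
          F D (act \<G> (par \<G> (ident \<G> A) t) w) = act \<G> (par \<G> (ident \<G> B) t) (F C w))"

text \<open>
  In \<open>act_linear\<close>, linearity on all of \<open>'w\<close> is no restriction, since a linear map on a subspace
  always extends; only the values on \<open>\<V> A\<close> matter.  Since \<open>f \<otimes> \<iota> C\<close> is again a
  transformation, \<open>act_states\<close> also covers composites.\<close>

locale gpt = strict_symmetric_monoidal \<G>
  for \<G> :: "('s, 'm, 'w::real_vector) gpt_struct" (structure) +
  assumes normalized_convex: "convex (\<Omega> A)"
    and normalized_unit: "\<Omega> \<I> = {\<one>}"
    and unit_functional_linear: "linear (\<uu> A)"
    and unit_functional_normalized: "\<omega> \<in> \<Omega> A \<Longrightarrow> \<uu> A \<omega> = 1"
    and fiducial: "\<exists>M. (\<forall>(X, e)\<in>M. measurement \<G> A X e) \<and>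
      (\<forall>\<omega>\<in>\<S> A. \<forall>\<omega>'\<in>\<S> A.
         (\<forall>(X, e)\<in>M. \<forall>x\<in>X. scalar \<G> (Act (e x) \<omega>) = scalar \<G> (Act (e x) \<omega>')) \<longrightarrow> \<omega> = \<omega>')"
    and act_linear: "f \<in> Hom A B \<Longrightarrow> linear (Act f)"
    and act_states: "f \<in> Hom A B \<Longrightarrow> Act f ` \<S> A \<subseteq> \<S> B"
    and act_ident: "w \<in> \<V> A \<Longrightarrow> Act (\<iota> A) w = w"
    and act_seq: "f \<in> Hom A B \<Longrightarrow> g \<in> Hom B C \<Longrightarrow> w \<in> \<V> A \<Longrightarrow> Act (g \<cdot> f) w = Act g (Act f w)"
    and act_faithful: "f \<in> Hom A B \<Longrightarrow> g \<in> Hom A B \<Longrightarrow>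
      (\<And>C w. w \<in> \<V> (A \<odot> C) \<Longrightarrow> Act (f \<otimes> \<iota> C) w = Act (g \<otimes> \<iota> C) w) \<Longrightarrow> f = g"
    and all_maps_allowed: "completely_state_preserving \<G> A B F \<Longrightarrow>
      \<exists>f\<in>Hom A B. \<forall>w\<in>\<V> A. Act f w = F \<I> w"
    and states_are_transformations: "(\<lambda>f. Act f \<one>) ` Hom \<I> A = \<S> A"
    and unit_effect: "\<exists>e\<in>Hom A \<I>. \<forall>w\<in>\<V> A. Act e w = \<uu> A w *\<^sub>R \<one>"
    and product_state: "a \<in> Hom \<I> A \<Longrightarrow> b \<in> Hom \<I> B \<Longrightarrow> Act (a \<otimes> b) \<one> \<in> \<S> (A \<odot> B)"
    and no_signalling_normalized: "measurement \<G> A X e \<Longrightarrow> \<omega> \<in> \<Omega> (A \<odot> B) \<Longrightarrow>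
      (\<Sum>x\<in>X. Act (e x \<otimes> \<iota> B) \<omega>) \<in> \<Omega> B"
    and no_signalling: "measurement \<G> A X e \<Longrightarrow> measurement \<G> A Y e' \<Longrightarrow> \<omega> \<in> \<Omega> (A \<odot> B) \<Longrightarrow>
      (\<Sum>x\<in>X. Act (e x \<otimes> \<iota> B) \<omega>) = (\<Sum>y\<in>Y. Act (e' y \<otimes> \<iota> B) \<omega>)"


section \<open>Circuits\<close>

text \<open>
  A circuit is evaluated vertex by vertex along a topological ordering \<open>vs\<close> of the graph, keeping
  the list of wires (edges) that are open so far.  The ordering also fixes the order
  of the factors of a composite; by the axioms of a symmetric monoidal category the set of values
  obtained does not depend on it.\<close>

definition topological_ordering :: "('a, 'x) dag \<Rightarrow> 'a list \<Rightarrow> bool" where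
  "topological_ordering G vs \<longleftrightarrow> distinct vs \<and> set vs = obs G \<union> lat G \<and>
     (\<forall>i j. i < length vs \<and> j < length vs \<and> (vs ! i, vs ! j) \<in> edges G \<longrightarrow> i < j)"

definition in_wires :: "('a, 'x) dag \<Rightarrow> 'a list \<Rightarrow> 'a \<Rightarrow> ('a \<times> 'a) list" where
  "in_wires G vs v = map (\<lambda>u. (u, v)) (filter (\<lambda>u. (u, v) \<in> edges G) vs)"

definition out_wires :: "('a, 'x) dag \<Rightarrow> 'a list \<Rightarrow> 'a \<Rightarrow> ('a \<times> 'a) list" where
  "out_wires G vs v = map (\<lambda>y. (v, y)) (filter (\<lambda>y. (v, y) \<in> edges G) vs)"

definition wires_sys ::
  "('s, 'm, 'w) gpt_struct \<Rightarrow> ('e \<Rightarrow> 's) \<Rightarrow> 'e list \<Rightarrow> 's" where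
  "wires_sys \<G> sys ws = foldr (sys_comp \<G>) (map sys ws) (unit_sys \<G>)"

text \<open>\<open>pull \<G> sys e ws\<close> takes the wires \<open>ws\<close> to \<open>e # remove1 e ws\<close>, and \<open>gather \<G> sys es ws\<close> takes
  them to \<open>es @ filter (\<lambda>w. w \<notin> set es) ws\<close>.\<close>

primrec pull ::
  "('s, 'm, 'w) gpt_struct \<Rightarrow> ('e \<Rightarrow> 's) \<Rightarrow> 'e \<Rightarrow> 'e list \<Rightarrow> 'm" where
  "pull \<G> sys e [] = ident \<G> (unit_sys \<G>)"
| "pull \<G> sys e (w # ws) =
     (if w = e then ident \<G> (wires_sys \<G> sys (w # ws))
      else seq \<G>
        (par \<G> (swap \<G> (sys w) (sys e)) (ident \<G> (wires_sys \<G> sys (remove1 e ws))))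
        (par \<G> (ident \<G> (sys w)) (pull \<G> sys e ws)))"

primrec gather ::
  "('s, 'm, 'w) gpt_struct \<Rightarrow> ('e \<Rightarrow> 's) \<Rightarrow> 'e list \<Rightarrow> 'e list \<Rightarrow> 'm" where
  "gather \<G> sys [] ws = ident \<G> (wires_sys \<G> sys ws)"
| "gather \<G> sys (e # es) ws =
     seq \<G> (par \<G> (ident \<G> (sys e)) (gather \<G> sys es (remove1 e ws))) (pull \<G> sys e ws)"

text \<open>\<open>run \<G> sys ins outs T vs ws m\<close> continues the circuit \<open>m\<close>, whose open wires are \<open>ws\<close>, by the
  boxes \<open>T v\<close> for \<open>v\<close> in \<open>vs\<close>.\<close>

primrec run ::
  "('s, 'm, 'w) gpt_struct \<Rightarrow> ('e \<Rightarrow> 's) \<Rightarrow> ('a \<Rightarrow> 'e list) \<Rightarrow> ('a \<Rightarrow> 'e list) \<Rightarrow> ('a \<Rightarrow> 'm) \<Rightarrow>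
   'a list \<Rightarrow> 'e list \<Rightarrow> 'm \<Rightarrow> 'm" where
  "run \<G> sys ins outs T [] ws m = m"
| "run \<G> sys ins outs T (v # vs) ws m =
     (let rest = filter (\<lambda>w. w \<notin> set (ins v)) ws in
      run \<G> sys ins outs T vs (outs v @ rest)
        (seq \<G> (par \<G> (T v) (ident \<G> (wires_sys \<G> sys rest)))
          (seq \<G> (gather \<G> sys (ins v) ws) m)))"

definition circuit ::
  "('s, 'm, 'w) gpt_struct \<Rightarrow> ('a, 'x) dag \<Rightarrow> 'a list \<Rightarrow> ('a \<times> 'a \<Rightarrow> 's) \<Rightarrow> ('a \<Rightarrow> 'm) \<Rightarrow> 'm" where
  "circuit \<G> G vs sys T =
     run \<G> sys (in_wires G vs) (out_wires G vs) T vs [] (ident \<G> (unit_sys \<G>))"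

text \<open>The box at \<open>v\<close>: \<open>T v c\<close> is the test of the observed vertex \<open>v\<close> for the values \<open>c\<close> of its
  observed parents, and \<open>L v c\<close> is the only element of the test of the latent vertex \<open>v\<close>.\<close>

definition vertex_box ::
  "('a, 'x) dag \<Rightarrow> ('a \<Rightarrow> ('a \<Rightarrow> 'x) \<Rightarrow> 'x \<Rightarrow> 'm) \<Rightarrow> ('a \<Rightarrow> ('a \<Rightarrow> 'x) \<Rightarrow> 'm) \<Rightarrow>
   ('a \<Rightarrow> 'x) \<Rightarrow> 'a \<Rightarrow> 'm" where
  "vertex_box G T L x v =
     (let c = restrict x (parents G v \<inter> obs G) in if v \<in> obs G then T v c (x v) else L v c)"

definition realizable ::
  "('s, 'm, 'w::real_vector) gpt_struct \<Rightarrow> ('a, 'x) dag \<Rightarrow> (('a \<Rightarrow> 'x) \<Rightarrow> real) set" where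
  "realizable \<G> G = {p. \<exists>vs sys T L.
     topological_ordering G vs \<and>
     (\<forall>(v, y)\<in>edges G. v \<in> obs G \<longrightarrow> sys (v, y) = unit_sys \<G>) \<and>
     (\<forall>v\<in>obs G. \<forall>c\<in>vals G (parents G v \<inter> obs G).
        test \<G> (wires_sys \<G> sys (in_wires G vs v)) (wires_sys \<G> sys (out_wires G vs v))
          (alph G v) (T v c)) \<and>
     (\<forall>v\<in>lat G. \<forall>c\<in>vals G (parents G v \<inter> obs G).
        test \<G> (wires_sys \<G> sys (in_wires G vs v)) (wires_sys \<G> sys (out_wires G vs v))
          {()} (\<lambda>_. L v c)) \<and>
     p = (\<lambda>x. if x \<in> vals G (obs G)
              then scalar \<G> (act \<G> (circuit \<G> G vs sys (vertex_box G T L x)) (one_state \<G>)) else 0)}"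

text \<open>The union over all theories whose systems, transformations and state vectors are taken from
  given types.\<close>

definition GPT_dists ::
  "('s, 'm, 'w::real_vector) gpt_struct itself \<Rightarrow> ('a, 'x) dag \<Rightarrow> (('a \<Rightarrow> 'x) \<Rightarrow> real) set" where
  "GPT_dists _ G = (\<Union>\<G>\<in>{\<G> :: ('s, 'm, 'w) gpt_struct. gpt \<G>}. realizable \<G> G)"

end

theory Submission
  imports Defs
begin

text \<open>
  In \<open>MaxInt G\<close> and \<open>VVSplit G\<close> every observed vertex is a root or a leaf.  For such graphs
  \<open>A\<close> and \<open>B\<close> are d-separated by \<open>C\<close> only if the ancestors of \<open>A \<union> B \<union> C\<close>, without the roots \<open>Z\<close>
  in \<open>C\<close>, fall into two parts \<open>N1 \<supseteq> A\<close> and \<open>N2 \<supseteq> B\<close> joined by no edge; so it suffices that the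
  marginal on \<open>N1 \<union> N2 \<union> Z\<close> is a function of \<open>N1 \<union> Z\<close> times a function of \<open>N2 \<union> Z\<close>.

  For a circuit, let each box read the value of a cut parent edge from the new vertex.  Since the
  deterministic effect is unique, summing over the outcomes of the vertices outside an ancestral set
  turns their boxes into discarding maps, and what remains is the parallel composite of two circuits
  with no common wire, up to a permutation of the wires.

  For \<open>MI G \<subseteq> VVS G\<close>, let all copies \<open>u\<^sub>e\<close> of a vertex take the same value.  Sets with disjoint
  ancestries in \<open>MaxInt G\<close> are independent, and a vertex of \<open>VVSplit G\<close> with several children is no
  common ancestor in \<open>MaxInt G\<close>.\<close>

section \<open>Coherence of wire permutations\<close>

text \<open>A circuit is evaluated with its open wires in a definite order, and a transformation is
  more than its linear map on one system. Separating a circuit into two parts is therefore an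
  equation between transformations that has to be carried through every permutation of wires; hence
  the coherence facts on \<open>gather\<close>. For the same reason uniqueness of the deterministic
  effect is needed as an equality in \<open>Hom\<close>; \<open>act_faithful\<close> gives it from
  no-signalling with an arbitrary spectator system.

  Only edges leaving observed vertices are cut, and these carry the trivial system. A vertex in
  \<open>Z\<close> can thus be read by boxes of both parts without joining them by a wire: it enters
  each factor as a classical parameter.

  In the second inclusion the obstacle is an observed root with several children. It is an outcome
  in \<open>VVSplit G\<close>, while its copies are inputs in \<open>MaxInt G\<close>, so equating
  them conditions a kernel on its own outcome. Normalization survives because this outcome is
  isolated in \<open>MaxInt G\<close>, hence independent of all inputs. The Markov property is used
  there only with an empty conditioning set.\<close>

context strict_symmetric_monoidal
begin

lemma whisker_left:
  "f \<in> Hom A B \<Longrightarrow> g \<in> Hom B C \<Longrightarrow> (\<iota> D \<otimes> g) \<cdot> (\<iota> D \<otimes> f) = \<iota> D \<otimes> (g \<cdot> f)"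
  using interchange[of "\<iota> D" D D "\<iota> D" D f A B g C] ident_hom[of D] ident_left[of "\<iota> D" D D] by simp

lemma whisker_right:
  "f \<in> Hom A B \<Longrightarrow> g \<in> Hom B C \<Longrightarrow> (g \<otimes> \<iota> D) \<cdot> (f \<otimes> \<iota> D) = (g \<cdot> f) \<otimes> \<iota> D"
  using interchange[of f A B g C "\<iota> D" D D "\<iota> D" D] ident_hom[of D] ident_left[of "\<iota> D" D D] by simp

lemma slide_left:
  "f \<in> Hom A B \<Longrightarrow> g \<in> Hom C D \<Longrightarrow> (f \<otimes> \<iota> D) \<cdot> (\<iota> A \<otimes> g) = f \<otimes> g"
  using interchange[of "\<iota> A" A A f B g C D "\<iota> D" D] ident_hom ident_left[of g C D] ident_right[of f A B]
  by simp

lemma slide_right: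
  "f \<in> Hom A B \<Longrightarrow> g \<in> Hom C D \<Longrightarrow> (\<iota> B \<otimes> g) \<cdot> (f \<otimes> \<iota> C) = f \<otimes> g"
  using interchange[of f A B "\<iota> B" B "\<iota> C" C C g D] ident_hom ident_left[of f A B] ident_right[of g C D]
  by simp

text \<open>The hexagon with both other systems trivial makes \<open>\<sigma> A \<I>\<close>
  idempotent, and \<open>swap_swap\<close> gives it a left inverse, so it is the identity.\<close>

lemma swap_unit_right: "\<sigma> A \<I> = \<iota> A"
proof -
  have h: "\<sigma> A \<I> \<in> Hom A A" "\<sigma> \<I> A \<in> Hom A A"
    using swap_hom[of A "\<I>"] swap_hom[of "\<I>" A] by (simp_all add: sys_unit_left sys_unit_right)
  have i: "\<sigma> \<I> A \<cdot> \<sigma> A \<I> = \<iota> A" using swap_swap[of "\<I>" A] by (simp add: sys_unit_right)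
  have e: "\<sigma> A \<I> = \<sigma> A \<I> \<cdot> \<sigma> A \<I>"
    using swap_hexagon[of A "\<I>" "\<I>"] par_unit_left[OF h(1)] par_unit_right[OF h(1)]
    by (simp add: sys_unit_right)
  have "\<iota> A = \<sigma> \<I> A \<cdot> (\<sigma> A \<I> \<cdot> \<sigma> A \<I>)" using i e by simp
  also have "\<dots> = \<sigma> A \<I>" using seq_assoc[OF h(1) h(1) h(2)] i ident_left[OF h(1)] by simp
  finally show ?thesis by simp
qed

lemma swap_unit_left: "\<sigma> \<I> A = \<iota> A"
  using swap_swap[of "\<I>" A] swap_hom[of "\<I>" A]
  by (simp add: swap_unit_right sys_unit_left sys_unit_right) (metis ident_right)

text \<open>This hexagon is the inverse of the given one: the right-hand side is a left inverse of
  \<open>\<sigma> C (A \<odot> B)\<close>, whose two-sided inverse is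
  \<open>\<sigma> (A \<odot> B) C\<close>.\<close>

lemma swap_hexagon2: "\<sigma> (A \<odot> B) C = (\<sigma> A C \<otimes> \<iota> B) \<cdot> (\<iota> A \<otimes> \<sigma> B C)"
proof -
  let ?p = "\<sigma> A C \<otimes> \<iota> B" and ?q = "\<iota> A \<otimes> \<sigma> B C"
  let ?p' = "\<sigma> C A \<otimes> \<iota> B" and ?q' = "\<iota> A \<otimes> \<sigma> C B"
  have p: "?p \<in> Hom (A \<odot> C \<odot> B) (C \<odot> A \<odot> B)" "?p' \<in> Hom (C \<odot> A \<odot> B) (A \<odot> C \<odot> B)"
    using par_hom[OF swap_hom[of A C] ident_hom[of B]] par_hom[OF swap_hom[of C A] ident_hom[of B]]
    by (simp_all add: sys_assoc)
  have q: "?q \<in> Hom (A \<odot> B \<odot> C) (A \<odot> C \<odot> B)" "?q' \<in> Hom (A \<odot> C \<odot> B) (A \<odot> B \<odot> C)"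
    using par_hom[OF ident_hom[of A] swap_hom[of B C]] par_hom[OF ident_hom[of A] swap_hom[of C B]]
    by (simp_all add: sys_assoc)
  have s: "\<sigma> (A \<odot> B) C \<in> Hom (A \<odot> B \<odot> C) (C \<odot> A \<odot> B)" "\<sigma> C (A \<odot> B) \<in> Hom (C \<odot> A \<odot> B) (A \<odot> B \<odot> C)"
    using swap_hom[of "A \<odot> B" C] swap_hom[of C "A \<odot> B"] by (simp_all add: sys_assoc)
  have pp: "?p \<cdot> ?p' = \<iota> (C \<odot> A \<odot> B)"
    using whisker_right[OF swap_hom[of C A] swap_hom[of A C]] by (simp add: swap_swap par_ident sys_assoc)
  have qq: "?q \<cdot> ?q' = \<iota> (A \<odot> C \<odot> B)"
    using whisker_left[OF swap_hom[of C B] swap_hom[of B C]] by (simp add: swap_swap par_ident sys_assoc)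
  have "(?p \<cdot> ?q) \<cdot> \<sigma> C (A \<odot> B) = (?p \<cdot> ?q) \<cdot> (?q' \<cdot> ?p')"
    by (simp add: swap_hexagon)
  also have "\<dots> = ?p \<cdot> (?q \<cdot> (?q' \<cdot> ?p'))"
    using seq_assoc[OF seq_hom[OF p(2) q(2)] q(1) p(1)] by simp
  also have "?q \<cdot> (?q' \<cdot> ?p') = ?p'"
    using seq_assoc[OF p(2) q(2) q(1)] qq ident_left[OF p(2)] by simp
  finally have e: "(?p \<cdot> ?q) \<cdot> \<sigma> C (A \<odot> B) = \<iota> (C \<odot> A \<odot> B)" using pp by simp
  have "?p \<cdot> ?q = (?p \<cdot> ?q) \<cdot> (\<sigma> C (A \<odot> B) \<cdot> \<sigma> (A \<odot> B) C)"
    using ident_right[OF seq_hom[OF q(1) p(1)]] by (simp add: swap_swap sys_assoc)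
  also have "\<dots> = ((?p \<cdot> ?q) \<cdot> \<sigma> C (A \<odot> B)) \<cdot> \<sigma> (A \<odot> B) C"
    using seq_assoc[OF s(1) s(2) seq_hom[OF q(1) p(1)]] by simp
  also have "\<dots> = \<sigma> (A \<odot> B) C" using e ident_left[OF s(1)] by simp
  finally show ?thesis by simp
qed

section \<open>Extracting wires from a list of open wires\<close>

lemma wires_sys_Nil [simp]: "wires_sys \<G> sys [] = \<I>"
  by (simp add: wires_sys_def)

lemma wires_sys_Cons [simp]: "wires_sys \<G> sys (w # ws) = sys w \<odot> wires_sys \<G> sys ws"
  by (simp add: wires_sys_def)

lemma wires_sys_append: "wires_sys \<G> sys (a @ b) = wires_sys \<G> sys a \<odot> wires_sys \<G> sys b"
  by (induction a) (simp_all add: sys_assoc sys_unit_left)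

text \<open>Moving \<open>e\<close> to the front past \<open>a\<close> one wire at a time is, by the
  second hexagon, a single swap with the composite of \<open>a\<close>. The closed form replaces the
  recursion wherever the position of \<open>e\<close> matters.\<close>

lemma pull_eq:
  assumes "e \<notin> set a"
  shows "pull \<G> sys e (a @ e # b) = \<sigma> (wires_sys \<G> sys a) (sys e) \<otimes> \<iota> (wires_sys \<G> sys b)"
  using assms
proof (induction a)
  case Nil
  show ?case by (simp add: swap_unit_left par_ident)
next
  case (Cons w a)
  let ?W = "wires_sys \<G> sys" let ?\<sigma> = "\<sigma> (?W a) (sys e)"
  have "pull \<G> sys e ((w # a) @ e # b) =
     (\<sigma> (sys w) (sys e) \<otimes> \<iota> (?W a \<odot> ?W b)) \<cdot> (\<iota> (sys w) \<otimes> ?\<sigma> \<otimes> \<iota> (?W b))"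
    using Cons by (auto simp: wires_sys_append remove1_append)
  also have "\<sigma> (sys w) (sys e) \<otimes> \<iota> (?W a \<odot> ?W b) = (\<sigma> (sys w) (sys e) \<otimes> \<iota> (?W a)) \<otimes> \<iota> (?W b)"
    using par_assoc[OF swap_hom ident_hom ident_hom] by (simp add: par_ident)
  also have "\<iota> (sys w) \<otimes> ?\<sigma> \<otimes> \<iota> (?W b) = (\<iota> (sys w) \<otimes> ?\<sigma>) \<otimes> \<iota> (?W b)"
    using par_assoc[OF ident_hom swap_hom ident_hom] by simp
  also have "((\<sigma> (sys w) (sys e) \<otimes> \<iota> (?W a)) \<otimes> \<iota> (?W b)) \<cdot> ((\<iota> (sys w) \<otimes> ?\<sigma>) \<otimes> \<iota> (?W b)) =
     ((\<sigma> (sys w) (sys e) \<otimes> \<iota> (?W a)) \<cdot> (\<iota> (sys w) \<otimes> ?\<sigma>)) \<otimes> \<iota> (?W b)"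
    by (rule whisker_right[OF par_hom[OF ident_hom swap_hom]])
      (use par_hom[OF swap_hom[of "sys w" "sys e"] ident_hom[of "?W a"]] in \<open>simp add: sys_assoc\<close>)
  finally show ?case by (simp add: swap_hexagon2)
qed

lemma pull_hom:
  assumes "e \<in> set ws"
  shows "pull \<G> sys e ws \<in> Hom (wires_sys \<G> sys ws) (sys e \<odot> wires_sys \<G> sys (remove1 e ws))"
proof -
  obtain a b where ws: "ws = a @ e # b" and e: "e \<notin> set a" using split_list_first[OF assms] by blast
  show ?thesis unfolding ws pull_eq[OF e]
    using par_hom[OF swap_hom[of "wires_sys \<G> sys a" "sys e"] ident_hom[of "wires_sys \<G> sys b"]] e
    by (simp add: wires_sys_append sys_assoc remove1_append)
qed

lemma gather_hom:
  assumes "distinct es" "distinct ws" "set es \<subseteq> set ws"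
  shows "gather \<G> sys es ws \<in>
    Hom (wires_sys \<G> sys ws) (wires_sys \<G> sys (es @ filter (\<lambda>w. w \<notin> set es) ws))"
  using assms
proof (induction es arbitrary: ws)
  case Nil
  then show ?case by (simp add: ident_hom)
next
  case (Cons e es)
  have "gather \<G> sys es (remove1 e ws) \<in> Hom (wires_sys \<G> sys (remove1 e ws))
      (wires_sys \<G> sys (es @ filter (\<lambda>w. w \<notin> set es) (remove1 e ws)))"
    using Cons by (intro Cons.IH) auto
  moreover have "filter (\<lambda>w. w \<notin> set es) (remove1 e ws) = filter (\<lambda>w. w \<notin> set (e # es)) ws"
    using Cons.prems by (simp add: distinct_remove1_removeAll removeAll_filter_not_eq)
      (rule filter_cong, auto)
  ultimately show ?case
    using seq_hom[OF pull_hom[of e ws] par_hom[OF ident_hom]] Cons.prems by simp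
qed

text \<open>The wires \<open>c\<close> behind both extracted ones are spectators and can be split
  off. On the others the equation is naturality of the swap of \<open>z\<close> past everything
  before it, with respect to the map that moves \<open>y\<close> to the front.\<close>

lemma pull_exchange_ordered:
  assumes "distinct (a @ y # b @ z # c)"
  defines "xs \<equiv> a @ y # b @ z # c"
  shows "(\<sigma> (sys y) (sys z) \<otimes> \<iota> (wires_sys \<G> sys (a @ b @ c))) \<cdot>
      ((\<iota> (sys y) \<otimes> pull \<G> sys z (remove1 y xs)) \<cdot> pull \<G> sys y xs) =
    (\<iota> (sys z) \<otimes> pull \<G> sys y (remove1 z xs)) \<cdot> pull \<G> sys z xs"
proof -
  let ?W = "wires_sys \<G> sys" let ?A = "?W a" and ?B = "?W b" and ?C = "?W c" and ?Y = "sys y" and ?Z = "sys z"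
  have r: "remove1 y xs = (a @ b) @ z # c" "remove1 z xs = a @ y # b @ c" "xs = (a @ y # b) @ z # c"
    using assms by (auto simp: remove1_append)
  have p1: "pull \<G> sys z (remove1 y xs) = \<sigma> (?A \<odot> ?B) ?Z \<otimes> \<iota> ?C"
    unfolding r(1) using pull_eq[of z "a @ b" sys c] assms(1) by (simp add: wires_sys_append)
  have p2: "pull \<G> sys y xs = \<sigma> ?A ?Y \<otimes> \<iota> (?B \<odot> ?Z \<odot> ?C)"
    unfolding xs_def using pull_eq[of y a sys "b @ z # c"] assms(1) by (simp add: wires_sys_append)
  have p3: "pull \<G> sys y (remove1 z xs) = \<sigma> ?A ?Y \<otimes> \<iota> (?B \<odot> ?C)"
    unfolding r(2) using pull_eq[of y a sys "b @ c"] assms(1) by (simp add: wires_sys_append)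
  have p4: "pull \<G> sys z xs = \<sigma> (?A \<odot> ?Y \<odot> ?B) ?Z \<otimes> \<iota> ?C"
    unfolding r(3) using pull_eq[of z "a @ y # b" sys c] assms(1) by (auto simp: wires_sys_append)
  have hAY: "\<sigma> ?A ?Y \<otimes> \<iota> ?B \<in> Hom (?A \<odot> ?Y \<odot> ?B) (?Y \<odot> ?A \<odot> ?B)"
    using par_hom[OF swap_hom[of ?A ?Y] ident_hom[of ?B]] by (simp add: sys_assoc)
  have hAYZ: "(\<sigma> ?A ?Y \<otimes> \<iota> ?B) \<otimes> \<iota> ?Z \<in> Hom (?A \<odot> ?Y \<odot> ?B \<odot> ?Z) (?Y \<odot> ?A \<odot> ?B \<odot> ?Z)"
    using par_hom[OF hAY ident_hom[of ?Z]] by (simp add: sys_assoc)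
  have hZ: "\<iota> ?Y \<otimes> \<sigma> (?A \<odot> ?B) ?Z \<in> Hom (?Y \<odot> ?A \<odot> ?B \<odot> ?Z) (?Y \<odot> ?Z \<odot> ?A \<odot> ?B)"
    using par_hom[OF ident_hom[of ?Y] swap_hom[of "?A \<odot> ?B" ?Z]] by (simp add: sys_assoc)
  have hYZ: "\<sigma> ?Y ?Z \<otimes> \<iota> (?A \<odot> ?B) \<in> Hom (?Y \<odot> ?Z \<odot> ?A \<odot> ?B) (?Z \<odot> ?Y \<odot> ?A \<odot> ?B)"
    using par_hom[OF swap_hom[of ?Y ?Z] ident_hom[of "?A \<odot> ?B"]] by (simp add: sys_assoc)
  have hs: "\<sigma> (?A \<odot> ?Y \<odot> ?B) ?Z \<in> Hom (?A \<odot> ?Y \<odot> ?B \<odot> ?Z) (?Z \<odot> ?A \<odot> ?Y \<odot> ?B)"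
    using swap_hom[of "?A \<odot> ?Y \<odot> ?B" ?Z] by (simp add: sys_assoc)
  have hzs: "\<iota> ?Z \<otimes> (\<sigma> ?A ?Y \<otimes> \<iota> ?B) \<in> Hom (?Z \<odot> ?A \<odot> ?Y \<odot> ?B) (?Z \<odot> ?Y \<odot> ?A \<odot> ?B)"
    using par_hom[OF ident_hom[of ?Z] hAY] by (simp add: sys_assoc)
  have "(\<sigma> ?Y ?Z \<otimes> \<iota> (?A \<odot> ?B)) \<cdot> ((\<iota> ?Y \<otimes> \<sigma> (?A \<odot> ?B) ?Z) \<cdot> ((\<sigma> ?A ?Y \<otimes> \<iota> ?B) \<otimes> \<iota> ?Z))
     = \<sigma> (?Y \<odot> ?A \<odot> ?B) ?Z \<cdot> ((\<sigma> ?A ?Y \<otimes> \<iota> ?B) \<otimes> \<iota> ?Z)"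
    using seq_assoc[OF hAYZ hZ hYZ] swap_hexagon2[of ?Y "?A \<odot> ?B" ?Z] by simp
  also have "\<dots> = (\<iota> ?Z \<otimes> (\<sigma> ?A ?Y \<otimes> \<iota> ?B)) \<cdot> \<sigma> (?A \<odot> ?Y \<odot> ?B) ?Z"
    using swap_natural[OF hAY ident_hom[of ?Z]] by simp
  finally have core: "(\<sigma> ?Y ?Z \<otimes> \<iota> (?A \<odot> ?B)) \<cdot> ((\<iota> ?Y \<otimes> \<sigma> (?A \<odot> ?B) ?Z) \<cdot> ((\<sigma> ?A ?Y \<otimes> \<iota> ?B) \<otimes> \<iota> ?Z))
     = (\<iota> ?Z \<otimes> (\<sigma> ?A ?Y \<otimes> \<iota> ?B)) \<cdot> \<sigma> (?A \<odot> ?Y \<odot> ?B) ?Z" .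
  have e1: "\<sigma> ?Y ?Z \<otimes> \<iota> (?W (a @ b @ c)) = (\<sigma> ?Y ?Z \<otimes> \<iota> (?A \<odot> ?B)) \<otimes> \<iota> ?C"
    using par_assoc[OF swap_hom ident_hom ident_hom] by (simp add: par_ident wires_sys_append sys_assoc)
  have e2: "\<iota> ?Y \<otimes> (\<sigma> (?A \<odot> ?B) ?Z \<otimes> \<iota> ?C) = (\<iota> ?Y \<otimes> \<sigma> (?A \<odot> ?B) ?Z) \<otimes> \<iota> ?C"
    using par_assoc[OF ident_hom swap_hom ident_hom] by simp
  have e3: "\<sigma> ?A ?Y \<otimes> \<iota> (?B \<odot> ?Z \<odot> ?C) = ((\<sigma> ?A ?Y \<otimes> \<iota> ?B) \<otimes> \<iota> ?Z) \<otimes> \<iota> ?C"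
    using par_assoc[OF hAY ident_hom[of ?Z] ident_hom[of ?C]] par_assoc[OF swap_hom[of ?A ?Y] ident_hom[of ?B] ident_hom[of "?Z \<odot> ?C"]]
    by (simp add: par_ident)
  have e4: "\<iota> ?Z \<otimes> (\<sigma> ?A ?Y \<otimes> \<iota> (?B \<odot> ?C)) = (\<iota> ?Z \<otimes> (\<sigma> ?A ?Y \<otimes> \<iota> ?B)) \<otimes> \<iota> ?C"
    using par_assoc[OF ident_hom[of ?Z] hAY ident_hom[of ?C]] par_assoc[OF swap_hom[of ?A ?Y] ident_hom[of ?B] ident_hom[of ?C]]
    by (simp add: par_ident)
  show ?thesis unfolding p1 p2 p3 p4 e1 e2 e3 e4
    by (simp add: whisker_right[OF hAYZ hZ] whisker_right[OF seq_hom[OF hAYZ hZ] hYZ] whisker_right[OF hs hzs] core)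
qed

lemma pull_exchange:
  assumes "distinct xs" "y \<in> set xs" "z \<in> set xs" "y \<noteq> z"
  shows "(\<sigma> (sys y) (sys z) \<otimes> \<iota> (wires_sys \<G> sys (remove1 z (remove1 y xs)))) \<cdot>
      ((\<iota> (sys y) \<otimes> pull \<G> sys z (remove1 y xs)) \<cdot> pull \<G> sys y xs) =
    (\<iota> (sys z) \<otimes> pull \<G> sys y (remove1 z xs)) \<cdot> pull \<G> sys z xs"
proof -
  obtain a b where ab: "xs = a @ y # b" using split_list[OF assms(2)] by blast
  consider "z \<in> set b" | "z \<in> set a" using assms ab by auto
  then show ?thesis
  proof cases
    case 1
    then obtain b1 c where b: "b = b1 @ z # c" using split_list[OF 1] by blast
    have "remove1 z (remove1 y xs) = a @ b1 @ c" using assms by (auto simp: ab b remove1_append)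
    then show ?thesis using pull_exchange_ordered[of a y b1 z c] assms(1) by (simp add: ab b)
  next
    \<comment> \<open>With \<open>z\<close> in front of \<open>y\<close> the ordered version applies
      with exchanged roles; composing with the inverse swap turns it around.\<close>
    case 2
    then obtain a1 c where a: "a = a1 @ z # c" using split_list[OF 2] by blast
    have r: "remove1 z (remove1 y xs) = a1 @ c @ b" using assms by (auto simp: ab a remove1_append)
    have r': "remove1 y (remove1 z xs) = remove1 z (remove1 y xs)" by (rule remove1_commute)
    let ?R = "wires_sys \<G> sys (a1 @ c @ b)"
    let ?g = "(\<iota> (sys z) \<otimes> pull \<G> sys y (remove1 z xs)) \<cdot> pull \<G> sys z xs"
    have ex: "(\<sigma> (sys z) (sys y) \<otimes> \<iota> ?R) \<cdot> ?g = (\<iota> (sys y) \<otimes> pull \<G> sys z (remove1 y xs)) \<cdot> pull \<G> sys y xs"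
      using pull_exchange_ordered[of a1 z c y b] assms(1) by (simp add: ab a)
    have g: "?g \<in> Hom (wires_sys \<G> sys xs) (sys z \<odot> sys y \<odot> ?R)"
      using seq_hom[OF pull_hom[of z xs sys], of "\<iota> (sys z) \<otimes> pull \<G> sys y (remove1 z xs)" "sys z \<odot> sys y \<odot> ?R"]
        par_hom[OF ident_hom[of "sys z"] pull_hom[of y "remove1 z xs" sys]] assms r r' by simp
    have h: "\<sigma> (sys z) (sys y) \<otimes> \<iota> ?R \<in> Hom (sys z \<odot> sys y \<odot> ?R) (sys y \<odot> sys z \<odot> ?R)"
      "\<sigma> (sys y) (sys z) \<otimes> \<iota> ?R \<in> Hom (sys y \<odot> sys z \<odot> ?R) (sys z \<odot> sys y \<odot> ?R)"
      using par_hom[OF swap_hom[of "sys z" "sys y"] ident_hom[of ?R]]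
        par_hom[OF swap_hom[of "sys y" "sys z"] ident_hom[of ?R]] by (simp_all add: sys_assoc)
    have "(\<sigma> (sys y) (sys z) \<otimes> \<iota> ?R) \<cdot> ((\<sigma> (sys z) (sys y) \<otimes> \<iota> ?R) \<cdot> ?g) = ?g"
      using seq_assoc[OF g h] whisker_right[OF swap_hom[of "sys z" "sys y"] swap_hom[of "sys y" "sys z"], of ?R]
        ident_left[OF g]
      by (simp add: swap_swap par_ident sys_assoc)
    then show ?thesis unfolding r ex .
  qed
qed

section \<open>Gathering as an action of permutations\<close>

lemma gather_self: "gather \<G> sys ws ws = \<iota> (wires_sys \<G> sys ws)"
  by (induction ws) (simp_all add: par_ident ident_left[OF ident_hom])

text \<open>The wires that \<open>gather\<close> does not name keep their order, so naming them
  afterwards in that order adds only identities. This turns every \<open>gather\<close> into a full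
  permutation, to which \<open>perm_perm\<close> applies.\<close>

lemma gather_append_rest:
  assumes "distinct es" "distinct ws" "set es \<subseteq> set ws"
  shows "gather \<G> sys (es @ filter (\<lambda>w. w \<notin> set es) ws) ws = gather \<G> sys es ws"
  using assms
proof (induction es arbitrary: ws)
  case Nil
  then show ?case by (simp add: gather_self)
next
  case (Cons e es)
  have "filter (\<lambda>w. w \<notin> set es) (remove1 e ws) = filter (\<lambda>w. w \<notin> set (e # es)) ws"
    using Cons.prems by (simp add: distinct_remove1_removeAll removeAll_filter_not_eq)
      (rule filter_cong, auto)
  moreover have "gather \<G> sys (es @ filter (\<lambda>w. w \<notin> set es) (remove1 e ws)) (remove1 e ws) =
      gather \<G> sys es (remove1 e ws)"
    using Cons.prems by (intro Cons.IH) auto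
  ultimately show ?case by simp
qed

lemma perm_hom:
  assumes "distinct ys" "distinct xs" "set ys = set xs"
  shows "gather \<G> sys ys xs \<in> Hom (wires_sys \<G> sys xs) (wires_sys \<G> sys ys)"
proof -
  have "filter (\<lambda>w. w \<notin> set ys) xs = []" using assms(3) by (simp add: filter_empty_conv)
  then show ?thesis using gather_hom[of ys xs sys] assms by simp
qed

text \<open>This is the inductive step of \<open>perm_perm\<close>. If \<open>z\<close> is not the
  head \<open>y\<close> of \<open>ys\<close>, it has to be extracted past \<open>y\<close>, and
  \<open>pull_exchange\<close> puts the extraction of \<open>z\<close> before that of
  \<open>y\<close>.\<close>

lemma pull_perm:
  assumes "distinct ys" "distinct xs" "set ys = set xs" "z \<in> set xs"
  shows "pull \<G> sys z ys \<cdot> gather \<G> sys ys xs =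
    (\<iota> (sys z) \<otimes> gather \<G> sys (remove1 z ys) (remove1 z xs)) \<cdot> pull \<G> sys z xs"
  using assms
proof (induction ys arbitrary: xs)
  case Nil
  then show ?case by simp
next
  case (Cons y ys)
  let ?W = "wires_sys \<G> sys" let ?g = "gather \<G> sys ys (remove1 y xs)"
  have g: "?g \<in> Hom (?W (remove1 y xs)) (?W ys)" using Cons.prems by (intro perm_hom) auto
  have py: "pull \<G> sys y xs \<in> Hom (?W xs) (sys y \<odot> ?W (remove1 y xs))"
    using pull_hom[of y xs sys] Cons.prems by auto
  show ?case
  proof (cases "y = z")
    case True
    then show ?thesis using ident_left[OF seq_hom[OF py par_hom[OF ident_hom g]]] by simp
  next
    case False
    let ?X = "remove1 z (remove1 y xs)" let ?Y = "remove1 z ys" let ?g' = "gather \<G> sys ?Y ?X"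
    have z: "z \<in> set ys" "z \<in> set (remove1 y xs)" "y \<in> set (remove1 z xs)" "y \<in> set xs"
      using Cons.prems False by auto
    have IH: "pull \<G> sys z ys \<cdot> ?g = (\<iota> (sys z) \<otimes> ?g') \<cdot> pull \<G> sys z (remove1 y xs)"
      using Cons.prems z by (intro Cons.IH) auto
    have g': "?g' \<in> Hom (?W ?X) (?W ?Y)" using Cons.prems by (intro perm_hom) auto
    have pz: "pull \<G> sys z (remove1 y xs) \<in> Hom (?W (remove1 y xs)) (sys z \<odot> ?W ?X)"
      using pull_hom[of z "remove1 y xs" sys] z by auto
    have pzs: "pull \<G> sys z ys \<in> Hom (?W ys) (sys z \<odot> ?W ?Y)"
      using pull_hom[of z ys sys] z by auto
    have s: "\<sigma> (sys y) (sys z) \<otimes> \<iota> (?W ?Y) \<in> Hom (sys y \<odot> sys z \<odot> ?W ?Y) (sys z \<odot> sys y \<odot> ?W ?Y)"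
      "\<sigma> (sys y) (sys z) \<otimes> \<iota> (?W ?X) \<in> Hom (sys y \<odot> sys z \<odot> ?W ?X) (sys z \<odot> sys y \<odot> ?W ?X)"
      using par_hom[OF swap_hom[of "sys y" "sys z"] ident_hom[of "?W ?Y"]]
       par_hom[OF swap_hom[of "sys y" "sys z"] ident_hom[of "?W ?X"]] by (simp_all add: sys_assoc)
    have zg': "\<iota> (sys z) \<otimes> ?g' \<in> Hom (sys z \<odot> ?W ?X) (sys z \<odot> ?W ?Y)"
      by (rule par_hom[OF ident_hom g'])
    have yzg': "\<iota> (sys y) \<otimes> (\<iota> (sys z) \<otimes> ?g') \<in> Hom (sys y \<odot> sys z \<odot> ?W ?X) (sys y \<odot> sys z \<odot> ?W ?Y)"
      by (rule par_hom[OF ident_hom zg'])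
    have yg': "\<iota> (sys y) \<otimes> ?g' \<in> Hom (sys y \<odot> ?W ?X) (sys y \<odot> ?W ?Y)"
      by (rule par_hom[OF ident_hom g'])
    have zyg': "\<iota> (sys z) \<otimes> (\<iota> (sys y) \<otimes> ?g') \<in> Hom (sys z \<odot> sys y \<odot> ?W ?X) (sys z \<odot> sys y \<odot> ?W ?Y)"
      by (rule par_hom[OF ident_hom yg'])
    have ypz: "\<iota> (sys y) \<otimes> pull \<G> sys z (remove1 y xs) \<in> Hom (sys y \<odot> ?W (remove1 y xs)) (sys y \<odot> sys z \<odot> ?W ?X)"
      by (rule par_hom[OF ident_hom pz])
    \<comment> \<open>The swap of \<open>y\<close> and \<open>z\<close> and the permutation of the
      remaining wires act on different factors, so they commute.\<close>
    have comm: "(\<sigma> (sys y) (sys z) \<otimes> \<iota> (?W ?Y)) \<cdot> (\<iota> (sys y) \<otimes> (\<iota> (sys z) \<otimes> ?g')) =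
        (\<iota> (sys z) \<otimes> (\<iota> (sys y) \<otimes> ?g')) \<cdot> (\<sigma> (sys y) (sys z) \<otimes> \<iota> (?W ?X))"
      using slide_left[OF swap_hom[of "sys y" "sys z"] g'] slide_right[OF swap_hom[of "sys y" "sys z"] g']
        par_assoc[OF ident_hom[of "sys y"] ident_hom[of "sys z"] g'] par_assoc[OF ident_hom[of "sys z"] ident_hom[of "sys y"] g']
      by (simp add: par_ident)
    have "pull \<G> sys z (y # ys) \<cdot> gather \<G> sys (y # ys) xs =
      ((\<sigma> (sys y) (sys z) \<otimes> \<iota> (?W ?Y)) \<cdot> (\<iota> (sys y) \<otimes> pull \<G> sys z ys)) \<cdot> ((\<iota> (sys y) \<otimes> ?g) \<cdot> pull \<G> sys y xs)"
      using False by simp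
    also have "\<dots> = (\<sigma> (sys y) (sys z) \<otimes> \<iota> (?W ?Y)) \<cdot> (((\<iota> (sys y) \<otimes> pull \<G> sys z ys) \<cdot> (\<iota> (sys y) \<otimes> ?g)) \<cdot> pull \<G> sys y xs)"
      using seq_assoc[OF seq_hom[OF py par_hom[OF ident_hom g]] par_hom[OF ident_hom pzs] s(1)]
        seq_assoc[OF py par_hom[OF ident_hom g] par_hom[OF ident_hom pzs]] by simp
    also have "(\<iota> (sys y) \<otimes> pull \<G> sys z ys) \<cdot> (\<iota> (sys y) \<otimes> ?g) =
       (\<iota> (sys y) \<otimes> (\<iota> (sys z) \<otimes> ?g')) \<cdot> (\<iota> (sys y) \<otimes> pull \<G> sys z (remove1 y xs))"
      by (simp add: whisker_left[OF g pzs] IH whisker_left[OF pz zg'])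
    also have "(\<sigma> (sys y) (sys z) \<otimes> \<iota> (?W ?Y)) \<cdot> (((\<iota> (sys y) \<otimes> (\<iota> (sys z) \<otimes> ?g')) \<cdot> (\<iota> (sys y) \<otimes> pull \<G> sys z (remove1 y xs))) \<cdot> pull \<G> sys y xs)
      = ((\<sigma> (sys y) (sys z) \<otimes> \<iota> (?W ?Y)) \<cdot> (\<iota> (sys y) \<otimes> (\<iota> (sys z) \<otimes> ?g'))) \<cdot> ((\<iota> (sys y) \<otimes> pull \<G> sys z (remove1 y xs)) \<cdot> pull \<G> sys y xs)"
      using seq_assoc[OF py ypz yzg'] seq_assoc[OF seq_hom[OF py ypz] yzg' s(1)] by simp
    also have "\<dots> = (\<iota> (sys z) \<otimes> (\<iota> (sys y) \<otimes> ?g')) \<cdot> ((\<sigma> (sys y) (sys z) \<otimes> \<iota> (?W ?X)) \<cdot> ((\<iota> (sys y) \<otimes> pull \<G> sys z (remove1 y xs)) \<cdot> pull \<G> sys y xs))"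
      using comm seq_assoc[OF seq_hom[OF py ypz] s(2) zyg'] by simp
    also have "\<dots> = (\<iota> (sys z) \<otimes> (\<iota> (sys y) \<otimes> ?g')) \<cdot> ((\<iota> (sys z) \<otimes> pull \<G> sys y (remove1 z xs)) \<cdot> pull \<G> sys z xs)"
      using pull_exchange[of xs y z sys] Cons.prems z False by simp
    also have "\<dots> = (\<iota> (sys z) \<otimes> ((\<iota> (sys y) \<otimes> ?g') \<cdot> pull \<G> sys y (remove1 z xs))) \<cdot> pull \<G> sys z xs"
    proof -
      have p: "pull \<G> sys y (remove1 z xs) \<in> Hom (?W (remove1 z xs)) (sys y \<odot> ?W ?X)"
        using pull_hom[OF z(3), of sys] by (simp add: remove1_commute)
      have q: "pull \<G> sys z xs \<in> Hom (?W xs) (sys z \<odot> ?W (remove1 z xs))"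
        using pull_hom[of z xs sys] Cons.prems by simp
      show ?thesis using seq_assoc[OF q par_hom[OF ident_hom p] zyg'] whisker_left[OF p yg'] by simp
    qed
    finally show ?thesis using False by (simp add: remove1_commute)
  qed
qed

text \<open>Functoriality of \<open>gather\<close> on the orderings of a fixed set of wires: two
  composites of permutations agree as soon as they have the same first and last list. The coherence
  steps of \<open>run_factor\<close> rest on this.\<close>

lemma perm_perm:
  assumes "distinct zs" "distinct ys" "distinct xs" "set zs = set ys" "set ys = set xs"
  shows "gather \<G> sys zs ys \<cdot> gather \<G> sys ys xs = gather \<G> sys zs xs"
  using assms
proof (induction zs arbitrary: ys xs)
  case Nil
  then show ?case by (simp add: ident_left[OF ident_hom])
next
  case (Cons z zs)
  let ?W = "wires_sys \<G> sys" let ?g = "gather \<G> sys zs (remove1 z ys)" and ?h = "gather \<G> sys (remove1 z ys) (remove1 z xs)"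
  have z: "z \<in> set ys" "z \<in> set xs" using Cons.prems by auto
  have g: "?g \<in> Hom (?W (remove1 z ys)) (?W zs)" and h: "?h \<in> Hom (?W (remove1 z xs)) (?W (remove1 z ys))"
    using Cons.prems by (auto intro!: perm_hom)
  have x: "gather \<G> sys ys xs \<in> Hom (?W xs) (?W ys)" using Cons.prems by (auto intro!: perm_hom)
  have p: "pull \<G> sys z ys \<in> Hom (?W ys) (sys z \<odot> ?W (remove1 z ys))"
    "pull \<G> sys z xs \<in> Hom (?W xs) (sys z \<odot> ?W (remove1 z xs))"
    using pull_hom[of z ys sys] pull_hom[of z xs sys] z by auto
  have IH: "?g \<cdot> ?h = gather \<G> sys zs (remove1 z xs)" using Cons.prems by (intro Cons.IH) auto
  have "gather \<G> sys (z # zs) ys \<cdot> gather \<G> sys ys xs = (\<iota> (sys z) \<otimes> ?g) \<cdot> (pull \<G> sys z ys \<cdot> gather \<G> sys ys xs)"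
    using seq_assoc[OF x p(1) par_hom[OF ident_hom g]] by simp
  also have "\<dots> = (\<iota> (sys z) \<otimes> ?g) \<cdot> ((\<iota> (sys z) \<otimes> ?h) \<cdot> pull \<G> sys z xs)"
    using pull_perm[of ys xs z sys] Cons.prems z by simp
  also have "\<dots> = (\<iota> (sys z) \<otimes> (?g \<cdot> ?h)) \<cdot> pull \<G> sys z xs"
    using seq_assoc[OF p(2) par_hom[OF ident_hom h] par_hom[OF ident_hom g]] whisker_left[OF h g] by simp
  finally show ?case by (simp add: IH)
qed

lemma perm_append:
  assumes "distinct (as' @ bs')" "distinct (as @ bs)" "set as' = set as" "set bs' = set bs"
  shows "gather \<G> sys (as' @ bs') (as @ bs) = gather \<G> sys as' as \<otimes> gather \<G> sys bs' bs"
  using assms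
proof (induction as' arbitrary: as)
  case Nil
  then show ?case using par_unit_left[OF perm_hom[of bs' bs sys]] by simp
next
  case (Cons e as')
  let ?W = "wires_sys \<G> sys"
  have e: "e \<in> set as" using Cons.prems by auto
  obtain a b where as: "as = a @ e # b" using split_list[OF e] by blast
  have ea: "e \<notin> set a" using Cons.prems as by auto
  have "pull \<G> sys e (as @ bs) = \<sigma> (?W a) (sys e) \<otimes> \<iota> (?W (b @ bs))"
    using pull_eq[OF ea, of sys "b @ bs"] as by simp
  also have "\<dots> = pull \<G> sys e as \<otimes> \<iota> (?W bs)"
    unfolding as pull_eq[OF ea] using par_assoc[OF swap_hom ident_hom ident_hom]
    by (simp add: wires_sys_append par_ident)
  finally have p: "pull \<G> sys e (as @ bs) = pull \<G> sys e as \<otimes> \<iota> (?W bs)" .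
  have r: "remove1 e (as @ bs) = remove1 e as @ bs" using e by (simp add: remove1_append)
  have IH: "gather \<G> sys (as' @ bs') (remove1 e as @ bs) = gather \<G> sys as' (remove1 e as) \<otimes> gather \<G> sys bs' bs"
    using Cons.prems by (intro Cons.IH) auto
  have g: "gather \<G> sys as' (remove1 e as) \<in> Hom (?W (remove1 e as)) (?W as')" "gather \<G> sys bs' bs \<in> Hom (?W bs) (?W bs')"
    using Cons.prems by (auto intro!: perm_hom)
  have ph: "pull \<G> sys e as \<in> Hom (?W as) (sys e \<odot> ?W (remove1 e as))" using pull_hom[OF e, of sys] by simp
  have "gather \<G> sys ((e # as') @ bs') (as @ bs) =
     ((\<iota> (sys e) \<otimes> gather \<G> sys as' (remove1 e as)) \<otimes> gather \<G> sys bs' bs) \<cdot> (pull \<G> sys e as \<otimes> \<iota> (?W bs))"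
    using par_assoc[OF ident_hom g] by (simp add: r IH p)
  also have "\<dots> = ((\<iota> (sys e) \<otimes> gather \<G> sys as' (remove1 e as)) \<cdot> pull \<G> sys e as) \<otimes> (gather \<G> sys bs' bs \<cdot> \<iota> (?W bs))"
    using interchange[OF ph par_hom[OF ident_hom g(1)] ident_hom g(2)] by simp
  finally show ?case by (simp add: ident_right[OF g(2)])
qed

lemma perm_swap:
  assumes "distinct (a @ b)"
  shows "gather \<G> sys (b @ a) (a @ b) = \<sigma> (wires_sys \<G> sys a) (wires_sys \<G> sys b)"
  using assms
proof (induction b)
  case Nil
  then show ?case by (simp add: gather_self swap_unit_right)
next
  case (Cons e b)
  have "remove1 e (a @ e # b) = a @ b" using Cons.prems by (simp add: remove1_append)
  then show ?case using Cons by (simp add: pull_eq swap_hexagon)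
qed

section \<open>Naturality of wire permutations\<close>

primrec tensor_list :: "('e \<Rightarrow> 'm) \<Rightarrow> 'e list \<Rightarrow> 'm" where
  "tensor_list d [] = \<iota> \<I>"
| "tensor_list d (w # ws) = d w \<otimes> tensor_list d ws"

lemma tensor_list_hom:
  "(\<And>w. w \<in> set ws \<Longrightarrow> d w \<in> Hom (sys w) (sys' w)) \<Longrightarrow>
   tensor_list d ws \<in> Hom (wires_sys \<G> sys ws) (wires_sys \<G> sys' ws)"
  by (induction ws) (simp_all add: ident_hom par_hom)

lemma tensor_list_append:
  assumes "\<And>w. w \<in> set (a @ b) \<Longrightarrow> d w \<in> Hom (sys w) (sys' w)"
  shows "tensor_list d (a @ b) = tensor_list d a \<otimes> tensor_list d b"
  using assms
proof (induction a)
  case Nil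
  then show ?case using par_unit_left[OF tensor_list_hom[of b d sys sys']] by simp
next
  case (Cons w a)
  then show ?case
    using par_assoc[OF Cons.prems[of w] tensor_list_hom[of a d sys sys'] tensor_list_hom[of b d sys sys']] by simp
qed

lemma pull_natural:
  assumes "\<And>w. w \<in> set ws \<Longrightarrow> d w \<in> Hom (sys w) (sys' w)" "e \<in> set ws"
  shows "tensor_list d (e # remove1 e ws) \<cdot> pull \<G> sys e ws = pull \<G> sys' e ws \<cdot> tensor_list d ws"
proof -
  obtain a b where ws: "ws = a @ e # b" and e: "e \<notin> set a" using split_list_first[OF assms(2)] by blast
  let ?W = "wires_sys \<G> sys" and ?W' = "wires_sys \<G> sys'"
  let ?a = "tensor_list d a" and ?b = "tensor_list d b"
  have h: "?a \<in> Hom (?W a) (?W' a)" "?b \<in> Hom (?W b) (?W' b)" "d e \<in> Hom (sys e) (sys' e)"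
    using assms ws by (auto intro!: tensor_list_hom)
  have r: "remove1 e ws = a @ b" using e by (simp add: ws remove1_append)
  have ab: "tensor_list d (a @ b) = ?a \<otimes> ?b" using assms ws by (intro tensor_list_append) auto
  have aeb: "tensor_list d ws = ?a \<otimes> (d e \<otimes> ?b)"
    using tensor_list_append[of a "e # b" d sys sys'] assms ws by auto
  have "tensor_list d (e # remove1 e ws) \<cdot> pull \<G> sys e ws = ((d e \<otimes> ?a) \<otimes> ?b) \<cdot> (\<sigma> (?W a) (sys e) \<otimes> \<iota> (?W b))"
    using par_assoc[OF h(3,1,2)] by (simp add: r ab) (simp add: ws pull_eq[OF e])
  also have "\<dots> = ((d e \<otimes> ?a) \<cdot> \<sigma> (?W a) (sys e)) \<otimes> ?b"
    using interchange[OF swap_hom par_hom[OF h(3,1)] ident_hom h(2)] ident_right[OF h(2)] by simp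
  also have "\<dots> = (\<sigma> (?W' a) (sys' e) \<cdot> (?a \<otimes> d e)) \<otimes> ?b" using swap_natural[OF h(1,3)] by simp
  also have "\<dots> = (\<sigma> (?W' a) (sys' e) \<otimes> \<iota> (?W' b)) \<cdot> ((?a \<otimes> d e) \<otimes> ?b)"
    using interchange[OF par_hom[OF h(1,3)] swap_hom h(2) ident_hom] ident_left[OF h(2)] by simp
  also have "\<dots> = pull \<G> sys' e ws \<cdot> tensor_list d ws"
    unfolding aeb using par_assoc[OF h(1,3,2)] by (simp add: ws pull_eq[OF e])
  finally show ?thesis .
qed

text \<open>The wire maps \<open>d\<close> may change the system types. Taken to be identities and
  discarding maps, they let the discarding of selected wires pass through every permutation, with
  \<open>sys'\<close> assigning \<open>\<I>\<close> to the discarded ones.\<close>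

lemma gather_natural:
  assumes "distinct es" "distinct ws" "set es \<subseteq> set ws"
    and "\<And>w. w \<in> set ws \<Longrightarrow> d w \<in> Hom (sys w) (sys' w)"
  shows "tensor_list d (es @ filter (\<lambda>w. w \<notin> set es) ws) \<cdot> gather \<G> sys es ws =
    gather \<G> sys' es ws \<cdot> tensor_list d ws"
  using assms
proof (induction es arbitrary: ws)
  case Nil
  then show ?case
    using ident_left[OF tensor_list_hom[of ws d sys sys']] ident_right[OF tensor_list_hom[of ws d sys sys']] by simp
next
  case (Cons e es)
  let ?W = "wires_sys \<G> sys" and ?W' = "wires_sys \<G> sys'"
  let ?r = "remove1 e ws" let ?t = "tensor_list d (es @ filter (\<lambda>w. w \<notin> set es) ?r)"
  let ?g = "gather \<G> sys es ?r" and ?g' = "gather \<G> sys' es ?r"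
  let ?T = "es @ filter (\<lambda>w. w \<notin> set es) ?r"
  have f: "filter (\<lambda>w. w \<notin> set es) (remove1 e ws) = filter (\<lambda>w. w \<notin> set (e # es)) ws"
    using Cons.prems by (simp add: distinct_remove1_removeAll removeAll_filter_not_eq)
      (rule filter_cong, auto)
  have de: "d e \<in> Hom (sys e) (sys' e)" using Cons.prems by auto
  have sub: "set ?r \<subseteq> set ws" by (rule set_remove1_subset)
  have dr: "\<And>w. w \<in> set ?r \<Longrightarrow> d w \<in> Hom (sys w) (sys' w)" using Cons.prems(4) sub by blast
  have tr: "tensor_list d ?r \<in> Hom (?W ?r) (?W' ?r)" using dr by (rule tensor_list_hom)
  have t: "?t \<in> Hom (?W ?T) (?W' ?T)" using Cons.prems sub by (intro tensor_list_hom) auto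
  have g: "?g \<in> Hom (?W ?r) (?W ?T)" "?g' \<in> Hom (?W' ?r) (?W' ?T)"
    using Cons.prems by (intro gather_hom; auto)+
  have IH: "?t \<cdot> ?g = ?g' \<cdot> tensor_list d ?r" using Cons.prems dr by (intro Cons.IH) auto
  have e: "e \<in> set ws" using Cons.prems by auto
  have p: "pull \<G> sys e ws \<in> Hom (?W ws) (sys e \<odot> ?W ?r)" "pull \<G> sys' e ws \<in> Hom (?W' ws) (sys' e \<odot> ?W' ?r)"
    using pull_hom[OF e, of sys] pull_hom[OF e, of sys'] by simp_all
  have "(d e \<otimes> ?t) \<cdot> ((\<iota> (sys e) \<otimes> ?g) \<cdot> pull \<G> sys e ws) = ((d e \<otimes> ?t) \<cdot> (\<iota> (sys e) \<otimes> ?g)) \<cdot> pull \<G> sys e ws"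
    using seq_assoc[OF p(1) par_hom[OF ident_hom g(1)] par_hom[OF de t]] by simp
  also have "(d e \<otimes> ?t) \<cdot> (\<iota> (sys e) \<otimes> ?g) = d e \<otimes> (?t \<cdot> ?g)"
    using interchange[OF ident_hom de g(1) t] ident_right[OF de] by simp
  also have "\<dots> = (\<iota> (sys' e) \<otimes> ?g') \<cdot> (d e \<otimes> tensor_list d ?r)"
    unfolding IH using interchange[OF de ident_hom tr g(2)] ident_left[OF de] by simp
  also have "((\<iota> (sys' e) \<otimes> ?g') \<cdot> (d e \<otimes> tensor_list d ?r)) \<cdot> pull \<G> sys e ws =
     (\<iota> (sys' e) \<otimes> ?g') \<cdot> (tensor_list d (e # ?r) \<cdot> pull \<G> sys e ws)"
    using seq_assoc[OF p(1) par_hom[OF de tr] par_hom[OF ident_hom g(2)]] by simp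
  also have "\<dots> = (\<iota> (sys' e) \<otimes> ?g') \<cdot> (pull \<G> sys' e ws \<cdot> tensor_list d ws)"
    using pull_natural[of ws d sys sys' e] Cons.prems(4) e by simp
  also have "\<dots> = gather \<G> sys' (e # es) ws \<cdot> tensor_list d ws"
    using seq_assoc[OF tensor_list_hom[of ws d sys sys', OF Cons.prems(4)] p(2) par_hom[OF ident_hom g(2)]] by simp
  finally show ?case using f by simp
qed

lemma wires_sys_trivial: "(\<And>w. w \<in> set ws \<Longrightarrow> sys w = \<I>) \<Longrightarrow> wires_sys \<G> sys ws = \<I>"
  by (induction ws) (simp_all add: sys_unit_left)

lemma gather_trivial:
  assumes "distinct es" "distinct ws" "set es \<subseteq> set ws" "\<And>w. w \<in> set ws \<Longrightarrow> sys w = \<I>"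
  shows "gather \<G> sys es ws = \<iota> \<I>"
  using assms
proof (induction es arbitrary: ws)
  case Nil
  then show ?case by (simp add: wires_sys_trivial)
next
  case (Cons e es)
  obtain a b where ws: "ws = a @ e # b" and e: "e \<notin> set a"
    using split_list_first[of e ws] Cons.prems by auto
  have "pull \<G> sys e ws = \<iota> \<I>"
    unfolding ws pull_eq[OF e] using Cons.prems ws
    by (simp add: wires_sys_trivial swap_unit_left par_ident sys_unit_left)
  moreover have "gather \<G> sys es (remove1 e ws) = \<iota> \<I>"
    using Cons.prems set_remove1_subset[of e ws] by (intro Cons.IH) auto
  ultimately show ?case using Cons.prems by (simp add: par_ident sys_unit_left ident_left[OF ident_hom])
qed

end

section \<open>Running circuits\<close>

text \<open>The typing condition under which \<open>run\<close> composes boxes into a circuit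
  without dangling wires; inductions on \<open>run\<close> carry it along.\<close>

primrec run_ok :: "('a \<Rightarrow> 'e list) \<Rightarrow> ('a \<Rightarrow> 'e list) \<Rightarrow> 'a list \<Rightarrow> 'e list \<Rightarrow> bool" where
  "run_ok ins outs [] ws \<longleftrightarrow> ws = []"
| "run_ok ins outs (v # vs) ws \<longleftrightarrow>
     distinct ws \<and> distinct (ins v) \<and> set (ins v) \<subseteq> set ws \<and>
     distinct (outs v @ filter (\<lambda>w. w \<notin> set (ins v)) ws) \<and>
     run_ok ins outs vs (outs v @ filter (\<lambda>w. w \<notin> set (ins v)) ws)"

context strict_symmetric_monoidal
begin

text \<open>All remaining boxes compose to one effect \<open>E\<close> that does not depend on the
  map \<open>m\<close> built so far. This permits a sum over the outcomes of one box to be pushed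
  through the rest of the circuit by linearity.\<close>

lemma run_eq_seq:
  assumes "run_ok ins outs vs ws"
    and "\<And>v. v \<in> set vs \<Longrightarrow> T v \<in> Hom (wires_sys \<G> sys (ins v)) (wires_sys \<G> sys (outs v))"
  shows "\<exists>E\<in>Hom (wires_sys \<G> sys ws) \<I>. \<forall>A. \<forall>m\<in>Hom A (wires_sys \<G> sys ws).
    run \<G> sys ins outs T vs ws m = E \<cdot> m"
  using assms
proof (induction vs arbitrary: ws)
  case Nil
  then show ?case by (auto intro!: bexI[of _ "\<iota> \<I>"] simp: ident_left ident_hom)
next
  case (Cons v vs)
  let ?W = "wires_sys \<G> sys" let ?r = "filter (\<lambda>w. w \<notin> set (ins v)) ws"
  let ?s = "T v \<otimes> \<iota> (?W ?r)" and ?g = "gather \<G> sys (ins v) ws"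
  obtain E where E: "E \<in> Hom (?W (outs v @ ?r)) \<I>"
    "\<And>A m. m \<in> Hom A (?W (outs v @ ?r)) \<Longrightarrow> run \<G> sys ins outs T vs (outs v @ ?r) m = E \<cdot> m"
    using Cons.IH[of "outs v @ ?r"] Cons.prems by auto
  have g: "?g \<in> Hom (?W ws) (?W (ins v) \<odot> ?W ?r)"
    using gather_hom[of "ins v" ws sys] Cons.prems(1) by (simp add: wires_sys_append)
  have s: "?s \<in> Hom (?W (ins v) \<odot> ?W ?r) (?W (outs v @ ?r))"
    using par_hom[OF Cons.prems(2)[of v] ident_hom[of "?W ?r"]] by (simp add: wires_sys_append)
  have "run \<G> sys ins outs T (v # vs) ws m = (E \<cdot> (?s \<cdot> ?g)) \<cdot> m" if m: "m \<in> Hom A (?W ws)" for A m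
  proof -
    have "run \<G> sys ins outs T (v # vs) ws m = E \<cdot> (?s \<cdot> (?g \<cdot> m))"
      using E(2)[OF seq_hom[OF seq_hom[OF m g] s]] by (simp add: Let_def)
    also have "?s \<cdot> (?g \<cdot> m) = (?s \<cdot> ?g) \<cdot> m" using seq_assoc[OF m g s] by simp
    also have "E \<cdot> ((?s \<cdot> ?g) \<cdot> m) = (E \<cdot> (?s \<cdot> ?g)) \<cdot> m"
      using seq_assoc[OF m seq_hom[OF g s] E(1)] by simp
    finally show ?thesis .
  qed
  then show ?case using seq_hom[OF seq_hom[OF g s] E(1)] by blast
qed

lemma run_hom:
  assumes "run_ok ins outs vs ws"
    and "\<And>v. v \<in> set vs \<Longrightarrow> T v \<in> Hom (wires_sys \<G> sys (ins v)) (wires_sys \<G> sys (outs v))"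
    and "m \<in> Hom A (wires_sys \<G> sys ws)"
  shows "run \<G> sys ins outs T vs ws m \<in> Hom A \<I>"
  using run_eq_seq[OF assms(1,2)] assms(3) seq_hom by fastforce

lemma run_cong:
  "(\<And>v. v \<in> set vs \<Longrightarrow> T v = T' v) \<Longrightarrow> run \<G> sys ins outs T vs ws m = run \<G> sys ins outs T' vs ws m"
  by (induction vs arbitrary: ws m) (simp_all add: Let_def)

section \<open>Splitting a circuit along a division of its wires into two classes\<close>

definition separate :: "('e \<Rightarrow> 's) \<Rightarrow> ('e \<Rightarrow> bool) \<Rightarrow> 'e list \<Rightarrow> 'm" where
  "separate sys F ws = gather \<G> sys (filter F ws @ filter (\<lambda>w. \<not> F w) ws) ws"

lemma separate_hom:
  assumes "distinct ws"
  shows "separate sys F ws \<in> Hom (wires_sys \<G> sys ws)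
    (wires_sys \<G> sys (filter F ws) \<odot> wires_sys \<G> sys (filter (\<lambda>w. \<not> F w) ws))"
  unfolding separate_def wires_sys_append[symmetric] using assms by (intro perm_hom) auto

text \<open>Separating the two blocks on their own leaves four groups, of which only the two middle
  ones are in the wrong order; one swap repairs this.\<close>

lemma separate_append:
  fixes F
  defines "G \<equiv> \<lambda>w. \<not> F w"
  assumes "distinct (a @ r)"
  shows "gather \<G> sys ((filter F a @ filter F r) @ (filter G a @ filter G r)) (a @ r) =
    (\<iota> (wires_sys \<G> sys (filter F a)) \<otimes>
      (\<sigma> (wires_sys \<G> sys (filter G a)) (wires_sys \<G> sys (filter F r)) \<otimes> \<iota> (wires_sys \<G> sys (filter G r))))
    \<cdot> (separate sys F a \<otimes> separate sys F r)"
proof -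
  let ?aF = "filter F a" and ?aG = "filter G a" and ?rF = "filter F r" and ?rG = "filter G r"
  have 1: "gather \<G> sys ((?aF @ ?aG) @ (?rF @ ?rG)) (a @ r) = separate sys F a \<otimes> separate sys F r"
    unfolding separate_def G_def using assms by (intro perm_append) auto
  have "gather \<G> sys (?aF @ ((?rF @ ?aG) @ ?rG)) (?aF @ ((?aG @ ?rF) @ ?rG)) =
    gather \<G> sys ?aF ?aF \<otimes> gather \<G> sys ((?rF @ ?aG) @ ?rG) ((?aG @ ?rF) @ ?rG)"
    using assms by (intro perm_append) auto
  also have "gather \<G> sys ((?rF @ ?aG) @ ?rG) ((?aG @ ?rF) @ ?rG) =
      gather \<G> sys (?rF @ ?aG) (?aG @ ?rF) \<otimes> gather \<G> sys ?rG ?rG"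
    using assms by (intro perm_append) auto
  also have "gather \<G> sys (?rF @ ?aG) (?aG @ ?rF) = \<sigma> (wires_sys \<G> sys ?aG) (wires_sys \<G> sys ?rF)"
    using assms by (intro perm_swap) auto
  finally have 2: "gather \<G> sys ((?aF @ ?rF) @ (?aG @ ?rG)) ((?aF @ ?aG) @ (?rF @ ?rG)) =
    \<iota> (wires_sys \<G> sys ?aF) \<otimes> (\<sigma> (wires_sys \<G> sys ?aG) (wires_sys \<G> sys ?rF) \<otimes> \<iota> (wires_sys \<G> sys ?rG))"
    by (simp add: gather_self)
  have 3: "gather \<G> sys ((?aF @ ?rF) @ (?aG @ ?rG)) ((?aF @ ?aG) @ (?rF @ ?rG)) \<cdot>
     gather \<G> sys ((?aF @ ?aG) @ (?rF @ ?rG)) (a @ r) = gather \<G> sys ((?aF @ ?rF) @ (?aG @ ?rG)) (a @ r)"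
    using assms by (intro perm_perm) auto
  show ?thesis using 3 unfolding 1 2 by simp
qed

text \<open>The spectator wires \<open>r\<close> are separated together with those of the box, so
  the swap of the middle groups has to slide past \<open>T2\<close>; naturality of the swap does
  this.\<close>

lemma separate_box:
  fixes F
  defines "G \<equiv> \<lambda>w. \<not> F w"
  assumes d: "distinct (i @ r)" "distinct (out @ r)"
    and T: "T \<in> Hom (wires_sys \<G> sys i) (wires_sys \<G> sys out)"
    and T1: "T1 \<in> Hom (wires_sys \<G> sys (filter F i)) (wires_sys \<G> sys (filter F out))"
    and T2: "T2 \<in> Hom (wires_sys \<G> sys (filter G i)) (wires_sys \<G> sys (filter G out))"
    and sep: "separate sys F out \<cdot> T = (T1 \<otimes> T2) \<cdot> separate sys F i"
  shows "separate sys F (out @ r) \<cdot> (T \<otimes> \<iota> (wires_sys \<G> sys r)) =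
    ((T1 \<otimes> \<iota> (wires_sys \<G> sys (filter F r))) \<otimes> (T2 \<otimes> \<iota> (wires_sys \<G> sys (filter G r)))) \<cdot>
    gather \<G> sys ((filter F i @ filter F r) @ (filter G i @ filter G r)) (i @ r)"
proof -
  let ?W = "wires_sys \<G> sys"
  let ?iF = "?W (filter F i)" and ?iG = "?W (filter G i)" and ?rF = "?W (filter F r)" and ?rG = "?W (filter G r)"
    and ?oF = "?W (filter F out)" and ?oG = "?W (filter G out)"
  have si: "separate sys F i \<in> Hom (?W i) (?iF \<odot> ?iG)" and sr: "separate sys F r \<in> Hom (?W r) (?rF \<odot> ?rG)"
    and so: "separate sys F out \<in> Hom (?W out) (?oF \<odot> ?oG)"
    using d unfolding G_def by (auto intro: separate_hom)
  have T12: "T1 \<otimes> T2 \<in> Hom (?iF \<odot> ?iG) (?oF \<odot> ?oG)" using par_hom[OF T1 T2] .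
  have x: "\<iota> ?oF \<otimes> (\<sigma> ?oG ?rF \<otimes> \<iota> ?rG) \<in> Hom ((?oF \<odot> ?oG) \<odot> (?rF \<odot> ?rG)) (?oF \<odot> ?rF \<odot> ?oG \<odot> ?rG)"
    "\<iota> ?iF \<otimes> (\<sigma> ?iG ?rF \<otimes> \<iota> ?rG) \<in> Hom ((?iF \<odot> ?iG) \<odot> (?rF \<odot> ?rG)) (?iF \<odot> ?rF \<odot> ?iG \<odot> ?rG)"
    using par_hom[OF ident_hom[of ?oF] par_hom[OF swap_hom[of ?oG ?rF] ident_hom[of ?rG]]]
      par_hom[OF ident_hom[of ?iF] par_hom[OF swap_hom[of ?iG ?rF] ident_hom[of ?rG]]]
    by (simp_all add: sys_assoc)
  have T2r: "T2 \<otimes> \<iota> ?rF \<in> Hom (?iG \<odot> ?rF) (?oG \<odot> ?rF)" "\<iota> ?rF \<otimes> T2 \<in> Hom (?rF \<odot> ?iG) (?rF \<odot> ?oG)"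
    using par_hom[OF T2 ident_hom] par_hom[OF ident_hom T2] by auto
  have e1: "(T1 \<otimes> T2) \<otimes> \<iota> (?rF \<odot> ?rG) = T1 \<otimes> ((T2 \<otimes> \<iota> ?rF) \<otimes> \<iota> ?rG)"
    using par_assoc[OF T1 T2 ident_hom[of "?rF \<odot> ?rG"]] par_assoc[OF T2 ident_hom[of ?rF] ident_hom[of ?rG]]
    by (simp add: par_ident)
  have e2: "T1 \<otimes> ((\<iota> ?rF \<otimes> T2) \<otimes> \<iota> ?rG) = (T1 \<otimes> \<iota> ?rF) \<otimes> (T2 \<otimes> \<iota> ?rG)"
    using par_assoc[OF T1 ident_hom[of ?rF] par_hom[OF T2 ident_hom[of ?rG]]]
      par_assoc[OF ident_hom[of ?rF] T2 ident_hom[of ?rG]] by simp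
  have nat: "\<sigma> ?oG ?rF \<cdot> (T2 \<otimes> \<iota> ?rF) = (\<iota> ?rF \<otimes> T2) \<cdot> \<sigma> ?iG ?rF"
    using swap_natural[OF T2 ident_hom[of ?rF]] .
  have h: "(\<sigma> ?oG ?rF \<otimes> \<iota> ?rG) \<cdot> ((T2 \<otimes> \<iota> ?rF) \<otimes> \<iota> ?rG) = ((\<iota> ?rF \<otimes> T2) \<otimes> \<iota> ?rG) \<cdot> (\<sigma> ?iG ?rF \<otimes> \<iota> ?rG)"
    unfolding whisker_right[OF T2r(1) swap_hom] whisker_right[OF swap_hom T2r(2)] nat ..
  have "(\<iota> ?oF \<otimes> (\<sigma> ?oG ?rF \<otimes> \<iota> ?rG)) \<cdot> ((T1 \<otimes> T2) \<otimes> \<iota> (?rF \<odot> ?rG)) =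
    T1 \<otimes> ((\<sigma> ?oG ?rF \<otimes> \<iota> ?rG) \<cdot> ((T2 \<otimes> \<iota> ?rF) \<otimes> \<iota> ?rG))"
    unfolding e1 using interchange[OF T1 ident_hom par_hom[OF T2r(1) ident_hom[of ?rG]] par_hom[OF swap_hom ident_hom]]
      ident_left[OF T1] by simp
  also have "\<dots> = ((T1 \<otimes> \<iota> ?rF) \<otimes> (T2 \<otimes> \<iota> ?rG)) \<cdot> (\<iota> ?iF \<otimes> (\<sigma> ?iG ?rF \<otimes> \<iota> ?rG))"
    unfolding h e2[symmetric]
    using interchange[OF ident_hom T1 par_hom[OF swap_hom ident_hom] par_hom[OF T2r(2) ident_hom[of ?rG]]]
      ident_right[OF T1] by simp
  finally have core: "(\<iota> ?oF \<otimes> (\<sigma> ?oG ?rF \<otimes> \<iota> ?rG)) \<cdot> ((T1 \<otimes> T2) \<otimes> \<iota> (?rF \<odot> ?rG)) =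
    ((T1 \<otimes> \<iota> ?rF) \<otimes> (T2 \<otimes> \<iota> ?rG)) \<cdot> (\<iota> ?iF \<otimes> (\<sigma> ?iG ?rF \<otimes> \<iota> ?rG))" .
  have T12r: "(T1 \<otimes> T2) \<otimes> \<iota> (?rF \<odot> ?rG) \<in> Hom ((?iF \<odot> ?iG) \<odot> (?rF \<odot> ?rG)) ((?oF \<odot> ?oG) \<odot> (?rF \<odot> ?rG))"
    by (rule par_hom[OF T12 ident_hom])
  have TT: "(T1 \<otimes> \<iota> ?rF) \<otimes> (T2 \<otimes> \<iota> ?rG) \<in> Hom (?iF \<odot> ?rF \<odot> ?iG \<odot> ?rG) (?oF \<odot> ?rF \<odot> ?oG \<odot> ?rG)"
    using par_hom[OF par_hom[OF T1 ident_hom[of ?rF]] par_hom[OF T2 ident_hom[of ?rG]]] by (simp add: sys_assoc)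
  have so_r: "separate sys F (out @ r) = (\<iota> ?oF \<otimes> (\<sigma> ?oG ?rF \<otimes> \<iota> ?rG)) \<cdot> (separate sys F out \<otimes> separate sys F r)"
    using separate_append[OF d(2), of sys F] by (simp add: separate_def G_def)
  have si_r: "gather \<G> sys ((filter F i @ filter F r) @ (filter G i @ filter G r)) (i @ r) =
     (\<iota> ?iF \<otimes> (\<sigma> ?iG ?rF \<otimes> \<iota> ?rG)) \<cdot> (separate sys F i \<otimes> separate sys F r)"
    using separate_append[OF d(1), of sys F] by (simp add: G_def)
  have a: "(separate sys F out \<otimes> separate sys F r) \<cdot> (T \<otimes> \<iota> (?W r)) =
     ((T1 \<otimes> T2) \<otimes> \<iota> (?rF \<odot> ?rG)) \<cdot> (separate sys F i \<otimes> separate sys F r)"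
    using interchange[OF T so ident_hom sr] interchange[OF si T12 sr ident_hom] sep ident_left[OF sr] ident_right[OF sr]
    by simp
  show ?thesis unfolding so_r si_r
    using seq_assoc[OF par_hom[OF T ident_hom] par_hom[OF so sr] x(1)] a core
      seq_assoc[OF par_hom[OF si sr] T12r x(1)] seq_assoc[OF par_hom[OF si sr] x(2) TT]
    by simp
qed

text \<open>The invariant is that separating the open wires turns the map built so far into a
  product \<open>m1 \<otimes> m2\<close>. A step preserves it because the box itself splits along
  \<open>F\<close>. At the end no wire is open, and the separation is the identity.\<close>

lemma run_factor:
  fixes F
  defines "G \<equiv> \<lambda>w. \<not> F w"
  assumes "run_ok ins outs vs ws"
    and "\<And>v. v \<in> set vs \<Longrightarrow> T v \<in> Hom (wires_sys \<G> sys (ins v)) (wires_sys \<G> sys (outs v))"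
    and "\<And>v. v \<in> set vs \<Longrightarrow>
      T1 v \<in> Hom (wires_sys \<G> sys (filter F (ins v))) (wires_sys \<G> sys (filter F (outs v)))"
    and "\<And>v. v \<in> set vs \<Longrightarrow>
      T2 v \<in> Hom (wires_sys \<G> sys (filter G (ins v))) (wires_sys \<G> sys (filter G (outs v)))"
    and "\<And>v. v \<in> set vs \<Longrightarrow>
      separate sys F (outs v) \<cdot> T v = (T1 v \<otimes> T2 v) \<cdot> separate sys F (ins v)"
    and "m \<in> Hom \<I> (wires_sys \<G> sys ws)"
    and "m1 \<in> Hom \<I> (wires_sys \<G> sys (filter F ws))" "m2 \<in> Hom \<I> (wires_sys \<G> sys (filter G ws))"
    and "separate sys F ws \<cdot> m = m1 \<otimes> m2"
  shows "run \<G> sys ins outs T vs ws m =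
    run \<G> sys (\<lambda>v. filter F (ins v)) (\<lambda>v. filter F (outs v)) T1 vs (filter F ws) m1 \<otimes>
    run \<G> sys (\<lambda>v. filter G (ins v)) (\<lambda>v. filter G (outs v)) T2 vs (filter G ws) m2"
  using assms(2-)
proof (induction vs arbitrary: ws m m1 m2)
  case Nil
  then show ?case by (auto simp: separate_def ident_left)
next
  case (Cons v vs)
  let ?W = "wires_sys \<G> sys" let ?r = "filter (\<lambda>w. w \<notin> set (ins v)) ws"
  let ?i = "ins v" and ?o = "outs v"
  let ?g = "gather \<G> sys ?i ws" and ?g1 = "gather \<G> sys (filter F ?i) (filter F ws)"
    and ?g2 = "gather \<G> sys (filter G ?i) (filter G ws)"
  let ?m = "(T v \<otimes> \<iota> (?W ?r)) \<cdot> (?g \<cdot> m)"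
  let ?m1 = "(T1 v \<otimes> \<iota> (?W (filter F ?r))) \<cdot> (?g1 \<cdot> m1)"
  let ?m2 = "(T2 v \<otimes> \<iota> (?W (filter G ?r))) \<cdot> (?g2 \<cdot> m2)"
  note ok = Cons.prems(1)[unfolded run_ok.simps]
  have rF: "filter (\<lambda>w. w \<notin> set (filter F ?i)) (filter F ws) = filter F ?r"
    and rG: "filter (\<lambda>w. w \<notin> set (filter G ?i)) (filter G ws) = filter G ?r"
    by (auto intro!: filter_cong)
  have subF: "set (filter F ?i) \<subseteq> set (filter F ws)" and subG: "set (filter G ?i) \<subseteq> set (filter G ws)"
    using ok by auto
  have T: "T v \<in> Hom (?W ?i) (?W ?o)" "T1 v \<in> Hom (?W (filter F ?i)) (?W (filter F ?o))"
    "T2 v \<in> Hom (?W (filter G ?i)) (?W (filter G ?o))" using Cons.prems(2-4)[of v] by auto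
  have g: "?g \<in> Hom (?W ws) (?W ?i \<odot> ?W ?r)"
    using gather_hom[of ?i ws sys] ok by (simp add: wires_sys_append)
  have g1: "?g1 \<in> Hom (?W (filter F ws)) (?W (filter F ?i) \<odot> ?W (filter F ?r))"
    using gather_hom[of "filter F ?i" "filter F ws" sys] ok unfolding rF by (auto simp: wires_sys_append)
  have g2: "?g2 \<in> Hom (?W (filter G ws)) (?W (filter G ?i) \<odot> ?W (filter G ?r))"
    using gather_hom[of "filter G ?i" "filter G ws" sys] ok unfolding rG by (auto simp: wires_sys_append)
  note m = Cons.prems(6) and m1 = Cons.prems(7) and m2 = Cons.prems(8)
  have t: "T v \<otimes> \<iota> (?W ?r) \<in> Hom (?W ?i \<odot> ?W ?r) (?W (?o @ ?r))"
    "T1 v \<otimes> \<iota> (?W (filter F ?r)) \<in> Hom (?W (filter F ?i) \<odot> ?W (filter F ?r)) (?W (filter F (?o @ ?r)))"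
    "T2 v \<otimes> \<iota> (?W (filter G ?r)) \<in> Hom (?W (filter G ?i) \<odot> ?W (filter G ?r)) (?W (filter G (?o @ ?r)))"
    using par_hom[OF T(1) ident_hom] par_hom[OF T(2) ident_hom] par_hom[OF T(3) ident_hom]
    by (auto simp: wires_sys_append)
  have sep: "separate sys F ws \<in> Hom (?W ws) (?W (filter F ws) \<odot> ?W (filter G ws))"
    unfolding G_def using separate_hom ok by blast
  have dir: "distinct (?i @ ?r)" using ok by auto
  let ?P = "(filter F ?i @ filter F ?r) @ (filter G ?i @ filter G ?r)"
  let ?p = "gather \<G> sys ?P (?i @ ?r)"
  \<comment> \<open>Both sides are full permutations from \<open>ws\<close> to the same list once
    the untouched wires are named explicitly.\<close>
  have gg: "(?g1 \<otimes> ?g2) \<cdot> separate sys F ws = ?p \<cdot> ?g"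
  proof -
    have "?g1 = gather \<G> sys (filter F ?i @ filter F ?r) (filter F ws)"
      using gather_append_rest[OF _ _ subF] ok unfolding rF by (metis distinct_filter)
    moreover have "?g2 = gather \<G> sys (filter G ?i @ filter G ?r) (filter G ws)"
      using gather_append_rest[OF _ _ subG] ok unfolding rG by (metis distinct_filter)
    moreover have "gather \<G> sys ?P (filter F ws @ filter G ws) =
      gather \<G> sys (filter F ?i @ filter F ?r) (filter F ws) \<otimes> gather \<G> sys (filter G ?i @ filter G ?r) (filter G ws)"
      using ok by (intro perm_append) (auto simp: G_def)
    ultimately have "(?g1 \<otimes> ?g2) \<cdot> separate sys F ws = gather \<G> sys ?P (filter F ws @ filter G ws) \<cdot> gather \<G> sys (filter F ws @ filter G ws) ws"
      by (simp add: separate_def G_def)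
    also have "\<dots> = gather \<G> sys ?P ws" using ok by (intro perm_perm) (auto simp: G_def)
    also have "\<dots> = ?p \<cdot> gather \<G> sys (?i @ ?r) ws" using ok by (intro perm_perm[symmetric]) (auto simp: G_def)
    also have "gather \<G> sys (?i @ ?r) ws = ?g" using ok by (intro gather_append_rest) auto
    finally show ?thesis .
  qed
  have p: "?p \<in> Hom (?W ?i \<odot> ?W ?r) (?W (filter F ?i) \<odot> ?W (filter F ?r) \<odot> ?W (filter G ?i) \<odot> ?W (filter G ?r))"
  proof -
    have "?p \<in> Hom (?W (?i @ ?r)) (?W ?P)" using ok by (intro perm_hom) (auto simp: G_def)
    then show ?thesis by (simp only: wires_sys_append sys_assoc)
  qed
  have so: "separate sys F (?o @ ?r) \<in> Hom (?W (?o @ ?r)) (?W (filter F (?o @ ?r)) \<odot> ?W (filter G (?o @ ?r)))"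
    unfolding G_def using separate_hom ok by blast
  have tt: "(T1 v \<otimes> \<iota> (?W (filter F ?r))) \<otimes> (T2 v \<otimes> \<iota> (?W (filter G ?r))) \<in>
    Hom (?W (filter F ?i) \<odot> ?W (filter F ?r) \<odot> ?W (filter G ?i) \<odot> ?W (filter G ?r)) (?W (filter F (?o @ ?r)) \<odot> ?W (filter G (?o @ ?r)))"
    using par_hom[OF t(2,3)] by (simp add: sys_assoc)
  have gt: "?g1 \<otimes> ?g2 \<in> Hom (?W (filter F ws) \<odot> ?W (filter G ws)) (?W (filter F ?i) \<odot> ?W (filter F ?r) \<odot> ?W (filter G ?i) \<odot> ?W (filter G ?r))"
    using par_hom[OF g1 g2] by (simp add: sys_assoc)
  have box: "separate sys F (?o @ ?r) \<cdot> (T v \<otimes> \<iota> (?W ?r)) =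
    ((T1 v \<otimes> \<iota> (?W (filter F ?r))) \<otimes> (T2 v \<otimes> \<iota> (?W (filter G ?r)))) \<cdot> ?p"
    unfolding G_def using ok dir T Cons.prems(5)[of v] by (intro separate_box) (auto simp: G_def)
  have "separate sys F (?o @ ?r) \<cdot> ?m = (separate sys F (?o @ ?r) \<cdot> (T v \<otimes> \<iota> (?W ?r))) \<cdot> (?g \<cdot> m)"
    using seq_assoc[OF seq_hom[OF m g] t(1) so] by simp
  also have "\<dots> = ((T1 v \<otimes> \<iota> (?W (filter F ?r))) \<otimes> (T2 v \<otimes> \<iota> (?W (filter G ?r)))) \<cdot> ((?p \<cdot> ?g) \<cdot> m)"
    unfolding box using seq_assoc[OF seq_hom[OF m g] p tt] seq_assoc[OF m g p] by simp
  also have "(?p \<cdot> ?g) \<cdot> m = (?g1 \<otimes> ?g2) \<cdot> (m1 \<otimes> m2)"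
    unfolding gg[symmetric] using seq_assoc[OF m sep gt] Cons.prems(9) by simp
  also have "\<dots> = (?g1 \<cdot> m1) \<otimes> (?g2 \<cdot> m2)"
    using interchange[OF m1 g1 m2 g2] by simp
  also have "((T1 v \<otimes> \<iota> (?W (filter F ?r))) \<otimes> (T2 v \<otimes> \<iota> (?W (filter G ?r)))) \<cdot> ((?g1 \<cdot> m1) \<otimes> (?g2 \<cdot> m2)) = ?m1 \<otimes> ?m2"
    using interchange[OF seq_hom[OF m1 g1] t(2) seq_hom[OF m2 g2] t(3)] by simp
  finally have sepm: "separate sys F (?o @ ?r) \<cdot> ?m = ?m1 \<otimes> ?m2" .
  have "run \<G> sys ins outs T vs (?o @ ?r) ?m =
    run \<G> sys (\<lambda>v. filter F (ins v)) (\<lambda>v. filter F (outs v)) T1 vs (filter F (?o @ ?r)) ?m1 \<otimes>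
    run \<G> sys (\<lambda>v. filter G (ins v)) (\<lambda>v. filter G (outs v)) T2 vs (filter G (?o @ ?r)) ?m2"
    using ok Cons.prems(2-5) sepm seq_hom[OF seq_hom[OF m g] t(1)] seq_hom[OF seq_hom[OF m1 g1] t(2)] seq_hom[OF seq_hom[OF m2 g2] t(3)]
    by (intro Cons.IH) auto
  then show ?case unfolding run.simps Let_def rF rG filter_append .
qed

lemma separate_trivial:
  "distinct ws \<Longrightarrow> (\<And>w. w \<in> set ws \<Longrightarrow> sys w = \<I>) \<Longrightarrow> separate sys F ws = \<iota> \<I>"
  unfolding separate_def by (rule gather_trivial) auto

lemma separate_all: "(\<And>w. w \<in> set ws \<Longrightarrow> F w) \<Longrightarrow> separate sys F ws = \<iota> (wires_sys \<G> sys ws)"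
  unfolding separate_def by (simp add: gather_self cong: filter_cong)

lemma separate_none: "(\<And>w. w \<in> set ws \<Longrightarrow> \<not> F w) \<Longrightarrow> separate sys F ws = \<iota> (wires_sys \<G> sys ws)"
  unfolding separate_def by (simp add: gather_self cong: filter_cong)

end

section \<open>Discarding and summing over outcomes\<close>

lemma sum_PiE_insert:
  assumes "k \<notin> D"
  shows "(\<Sum>f\<in>PiE (insert k D) al. g f) = (\<Sum>x\<in>al k. \<Sum>f\<in>PiE D al. g (f(k := x)))"
proof -
  have "(\<Sum>f\<in>PiE (insert k D) al. g f) = (\<Sum>(x, f)\<in>al k \<times> PiE D al. g (f(k := x)))"
    unfolding PiE_insert_eq
    by (subst sum.reindex[OF inj_combinator[OF assms]]) (auto simp: case_prod_unfold)
  then show ?thesis by (simp add: sum.cartesian_product)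
qed

lemma override_on_insert_upd:
  "k \<notin> D \<Longrightarrow> override_on z (f(k := x)) (insert k D) = override_on (z(k := x)) f D"
  by (auto simp: override_on_def fun_eq_iff)

lemma (in strict_symmetric_monoidal) tensor_list_cong:
  "(\<And>w. w \<in> set ws \<Longrightarrow> d w = d' w) \<Longrightarrow> tensor_list d ws = tensor_list d' ws"
  by (induction ws) simp_all

lemma (in strict_symmetric_monoidal) wires_sys_cong:
  "(\<And>w. w \<in> set ws \<Longrightarrow> sys w = sys' w) \<Longrightarrow> wires_sys \<G> sys ws = wires_sys \<G> sys' ws"
  by (induction ws) simp_all

context gpt
begin

section \<open>State spaces and the unique deterministic effect\<close>

lemma unit_sys_normalized: "\<one> \<in> \<Omega> \<I>"
  using normalized_unit by simp

lemma unit_one: "\<uu> \<I> \<one> = 1"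
  using unit_functional_normalized[OF unit_sys_normalized] .

lemma normalized_states: "\<Omega> A \<subseteq> \<S> A"
  unfolding states_def by (meson hull_subset insert_subset subset_trans subset_insertI)

lemma states_state_space: "\<S> A \<subseteq> \<V> A"
  unfolding states_def state_space_def
  by (rule hull_minimal) (auto simp: span_zero span_base subspace_imp_convex)

lemma one_state_space: "\<one> \<in> \<V> \<I>"
  using unit_sys_normalized unfolding state_space_def by (rule span_base)

lemma act_state_space:
  assumes "f \<in> Hom A B" "w \<in> \<V> A" shows "Act f w \<in> \<V> B"
proof -
  have "Act f ` \<Omega> A \<subseteq> \<V> B"
    using act_states[OF assms(1)] normalized_states[of A] states_state_space[of B] by blast
  then have "span (Act f ` \<Omega> A) \<subseteq> \<V> B"
    unfolding state_space_def by (rule span_minimal) (rule subspace_span)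
  then show ?thesis
    using assms(2) linear_span_image[OF act_linear[OF assms(1)]] unfolding state_space_def by blast
qed

lemma linear_eq_on_state_space:
  assumes "linear f" "linear g" "\<And>w. w \<in> \<Omega> A \<Longrightarrow> f w = g w" "w \<in> \<V> A"
  shows "f w = g w"
  using linear_eq_on_span[of f g "\<Omega> A" w] assms unfolding state_space_def by blast

text \<open>An arbitrary choice of unit effect; \<open>discard_unique\<close> shows afterwards that
  there is only one.\<close>

definition discard :: "'s \<Rightarrow> 'm" where
  "discard A = (SOME e. e \<in> Hom A \<I> \<and> (\<forall>w\<in>\<V> A. Act e w = \<uu> A w *\<^sub>R \<one>))"

lemma discard: "discard A \<in> Hom A \<I>" "w \<in> \<V> A \<Longrightarrow> Act (discard A) w = \<uu> A w *\<^sub>R \<one>"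
proof -
  have "discard A \<in> Hom A \<I> \<and> (\<forall>w\<in>\<V> A. Act (discard A) w = \<uu> A w *\<^sub>R \<one>)"
    unfolding discard_def by (rule someI_ex) (use unit_effect[of A] in blast)
  then show "discard A \<in> Hom A \<I>" "w \<in> \<V> A \<Longrightarrow> Act (discard A) w = \<uu> A w *\<^sub>R \<one>" by auto
qed

lemma unit_linear: "linear (\<lambda>w. \<uu> \<I> (Act e w))" if "e \<in> Hom A \<I>"
  using linear_compose[OF act_linear[OF that] unit_functional_linear] by (simp add: o_def)

lemma measurement_single:
  assumes "e \<in> Hom A \<I>" "\<And>w. w \<in> \<Omega> A \<Longrightarrow> \<uu> \<I> (Act e w) = 1"
  shows "measurement \<G> A {0} (\<lambda>_. e)"
proof -
  have "\<uu> \<I> (Act e w) = \<uu> A w" if "w \<in> \<V> A" for w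
    by (rule linear_eq_on_state_space[OF unit_linear[OF assms(1)] unit_functional_linear _ that])
      (simp add: assms(2) unit_functional_normalized)
  then show ?thesis using assms(1) by (simp add: measurement_def test_def)
qed

lemma discard_normalized: "w \<in> \<Omega> A \<Longrightarrow> Act (discard A) w = \<one>"
  using discard(2)[of w A] unit_functional_normalized[of w A] span_base[of w "\<Omega> A"]
  by (simp add: state_space_def)

lemma measurement_discard: "measurement \<G> A {0} (\<lambda>_. discard A)"
  by (rule measurement_single[OF discard(1)]) (simp add: discard_normalized unit_one)

lemma act_par_linear: "f \<in> Hom A B \<Longrightarrow> linear (Act (f \<otimes> \<iota> C))"
  using act_linear[OF par_hom[OF _ ident_hom]] by blast

text \<open>No-signalling compares measurements on normalized states only. Both sides are linear and
  the normalized states span, so the comparison extends to the whole state space.\<close>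

lemma measurement_sum:
  assumes "measurement \<G> A X e" "w \<in> \<V> (A \<odot> C)"
  shows "(\<Sum>x\<in>X. Act (e x \<otimes> \<iota> C) w) = Act (discard A \<otimes> \<iota> C) w"
proof (rule linear_eq_on_state_space[OF _ _ _ assms(2)])
  show "linear (\<lambda>w. \<Sum>x\<in>X. Act (e x \<otimes> \<iota> C) w)"
    using assms(1) by (intro linear_compose_sum ballI act_par_linear[of _ A \<I>]) (auto simp: measurement_def test_def)
  show "linear (Act (discard A \<otimes> \<iota> C))" by (rule act_par_linear[OF discard(1)])
  show "(\<Sum>x\<in>X. Act (e x \<otimes> \<iota> C) w) = Act (discard A \<otimes> \<iota> C) w" if "w \<in> \<Omega> (A \<odot> C)" for w
    using no_signalling[OF assms(1) measurement_discard that] by simp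
qed

text \<open>A deterministic effect is a measurement with one outcome, hence acts like
  \<open>discard\<close> on the first part of every composite; \<open>act_faithful\<close> makes
  this an equality of transformations.\<close>

lemma discard_unique:
  assumes "e \<in> Hom A \<I>" "\<And>w. w \<in> \<Omega> A \<Longrightarrow> \<uu> \<I> (Act e w) = 1"
  shows "e = discard A"
  using measurement_sum[OF measurement_single[OF assms]]
  by (intro act_faithful[OF assms(1) discard(1)]) simp

lemma discard_unit: "discard \<I> = \<iota> \<I>"
  by (rule discard_unique[symmetric, OF ident_hom])
    (simp add: act_ident one_state_space unit_one normalized_unit)

text \<open>Discarding \<open>A\<close> leaves a normalized state of \<open>B\<close>, so the
  product of the two effects is deterministic and uniqueness applies.\<close>

lemma discard_par: "discard (A \<odot> B) = discard A \<otimes> discard B"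
proof (rule discard_unique[symmetric])
  show "discard A \<otimes> discard B \<in> Hom (A \<odot> B) \<I>"
    using par_hom[OF discard(1) discard(1)] by (simp add: sys_unit_left)
  fix w assume w: "w \<in> \<Omega> (A \<odot> B)"
  have n: "Act (discard A \<otimes> \<iota> B) w \<in> \<Omega> B"
    using no_signalling_normalized[OF measurement_discard w] by simp
  have "discard A \<otimes> discard B = (\<iota> \<I> \<otimes> discard B) \<cdot> (discard A \<otimes> \<iota> B)"
    using slide_right[OF discard(1)[of A] discard(1)[of B]] by simp
  also have "\<dots> = discard B \<cdot> (discard A \<otimes> \<iota> B)" by (simp add: par_unit_left[OF discard(1)])
  finally have "Act (discard A \<otimes> discard B) w = Act (discard B) (Act (discard A \<otimes> \<iota> B) w)"
    using act_seq[of "discard A \<otimes> \<iota> B" "A \<odot> B" B "discard B" \<I> w] w par_hom[OF discard(1)[of A] ident_hom[of B]] discard(1)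
    by (simp add: sys_unit_left state_space_def span_base)
  then show "\<uu> \<I> (Act (discard A \<otimes> discard B) w) = 1" using discard_normalized[OF n] unit_one by simp
qed

lemma discard_tensor_list:
  "discard (wires_sys \<G> sys ws) = tensor_list (\<lambda>w. discard (sys w)) ws"
  by (induction ws) (simp_all add: discard_unit discard_par)

text \<open>Each outcome followed by \<open>discard B\<close> is an effect, and together these form
  a measurement on \<open>A\<close>, whose sum depends on the test no longer. This is how summing
  over its outcomes erases a box.\<close>

lemma discard_test:
  assumes "test \<G> A B X T" "w \<in> \<V> (A \<odot> C)"
  shows "(\<Sum>x\<in>X. Act ((discard B \<cdot> T x) \<otimes> \<iota> C) w) = Act (discard A \<otimes> \<iota> C) w"
proof -
  have X: "finite X" "\<And>x. x \<in> X \<Longrightarrow> T x \<in> Hom A B" using assms(1) by (auto simp: test_def)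
  \<comment> \<open>Measurements carry natural numbers as outcomes, so \<open>X\<close> is
    enumerated.\<close>
  obtain h where h: "bij_betw h {..<card X} X" using ex_bij_betw_nat_finite[OF X(1)] by (auto simp: atLeast0LessThan)
  define e where "e = (\<lambda>n. discard B \<cdot> T (h n))"
  have hX: "h n \<in> X" if "n \<in> {..<card X}" for n using h that by (auto simp: bij_betw_def)
  have "measurement \<G> A {..<card X} e"
    unfolding measurement_def test_def
  proof (intro conjI ballI)
    show "e n \<in> Hom A \<I>" if "n \<in> {..<card X}" for n
      unfolding e_def using seq_hom[OF X(2)[OF hX[OF that]] discard(1)] .
    fix v assume v: "v \<in> \<V> A"
    have "Act (e n) v = \<uu> B (Act (T (h n)) v) *\<^sub>R \<one>" if "n \<in> {..<card X}" for n
      unfolding e_def using act_seq[OF X(2)[OF hX[OF that]] discard(1) v] discard(2) act_state_space[OF X(2)[OF hX[OF that]] v]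
      by simp
    then have "(\<Sum>n<card X. Act (e n) v) = (\<Sum>n<card X. \<uu> B (Act (T (h n)) v) *\<^sub>R \<one>)" by (intro sum.cong) auto
    also have "\<dots> = (\<Sum>x\<in>X. \<uu> B (Act (T x) v) *\<^sub>R \<one>)" by (rule sum.reindex_bij_betw[OF h])
    also have "\<dots> = \<uu> B (\<Sum>x\<in>X. Act (T x) v) *\<^sub>R \<one>"
      by (simp add: linear_sum[OF unit_functional_linear] scaleR_sum_left)
    also have "\<dots> = \<uu> A v *\<^sub>R \<one>" using assms(1) v by (simp add: test_def)
    finally show "\<uu> \<I> (\<Sum>n<card X. Act (e n) v) = \<uu> A v"
      using linear_cmul[OF unit_functional_linear] unit_one by simp
  qed simp
  from measurement_sum[OF this assms(2)] sum.reindex_bij_betw[OF h, of "\<lambda>x. Act ((discard B \<cdot> T x) \<otimes> \<iota> C) w"]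
  show ?thesis by (simp add: e_def)
qed

lemma discard_channel:
  assumes "test \<G> A B {()} (\<lambda>_. T)"
  shows "discard B \<cdot> T = discard A"
proof (rule act_faithful)
  show "discard B \<cdot> T \<in> Hom A \<I>" using assms seq_hom[OF _ discard(1)] by (auto simp: test_def)
  show "Act ((discard B \<cdot> T) \<otimes> \<iota> C) w = Act (discard A \<otimes> \<iota> C) w" if "w \<in> \<V> (A \<odot> C)" for C w
    using discard_test[OF assms that] by simp
qed (rule discard(1))

text \<open>Summing over the outcomes of the vertices outside \<open>N\<close> turns their boxes into discarding
  maps: head-first, the summed coordinate of the first vertex only occurs in later boxes
  that have themselves been replaced by discarding maps.\<close>

lemma run_sum_out:
  fixes T :: "('k \<Rightarrow> 'x) \<Rightarrow> 'a \<Rightarrow> 'm" and \<kappa> :: "'a \<Rightarrow> 'k" and keep :: "'e \<Rightarrow> bool" and sys :: "'e \<Rightarrow> 's"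
    and ins outs :: "'a \<Rightarrow> 'e list" and N Obs :: "'a set"
  defines "sys' \<equiv> \<lambda>w. if keep w then sys w else \<I>"
    and "d \<equiv> \<lambda>w. if keep w then \<iota> (sys w) else discard (sys w)"
  defines "T' \<equiv> \<lambda>z v. if v \<in> N then T z v else discard (wires_sys \<G> sys' (ins v))"
  assumes ok: "run_ok ins outs vs ws"
    and vs: "distinct vs" "inj_on \<kappa> (set vs)" "sorted_wrt (\<lambda>v v'. \<kappa> v' \<notin> dep v) vs"
    and valid: "z \<in> Z" "\<And>z v x. z \<in> Z \<Longrightarrow> v \<in> set vs \<Longrightarrow> v \<in> Obs \<Longrightarrow> x \<in> al (\<kappa> v) \<Longrightarrow> z(\<kappa> v := x) \<in> Z"
    and dep: "\<And>v z z'. v \<in> set vs \<Longrightarrow> (\<And>k. k \<in> dep v \<Longrightarrow> z k = z' k) \<Longrightarrow> T z v = T z' v"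
    and depN: "\<And>v v'. v \<in> set vs \<Longrightarrow> v' \<in> set vs \<Longrightarrow> v \<in> N \<Longrightarrow> v' \<notin> N \<Longrightarrow> \<kappa> v' \<notin> dep v"
    and T: "\<And>z v. z \<in> Z \<Longrightarrow> v \<in> set vs \<Longrightarrow> T z v \<in> Hom (wires_sys \<G> sys (ins v)) (wires_sys \<G> sys (outs v))"
    and test_obs: "\<And>z v. z \<in> Z \<Longrightarrow> v \<in> set vs \<Longrightarrow> v \<in> Obs \<Longrightarrow>
      test \<G> (wires_sys \<G> sys (ins v)) (wires_sys \<G> sys (outs v)) (al (\<kappa> v)) (\<lambda>x. T (z(\<kappa> v := x)) v)"
    and test_lat: "\<And>z v. z \<in> Z \<Longrightarrow> v \<in> set vs \<Longrightarrow> v \<notin> Obs \<Longrightarrow>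
      test \<G> (wires_sys \<G> sys (ins v)) (wires_sys \<G> sys (outs v)) {()} (\<lambda>_. T z v)"
    and keep: "\<And>v w. v \<in> set vs \<Longrightarrow> v \<in> N \<Longrightarrow> w \<in> set (ins v) \<union> set (outs v) \<Longrightarrow> keep w \<or> sys w = \<I>"
    and drop: "\<And>v w. v \<in> set vs \<Longrightarrow> v \<notin> N \<Longrightarrow> w \<in> set (outs v) \<Longrightarrow> \<not> keep w"
    and m: "m \<in> Hom \<I> (wires_sys \<G> sys ws)"
  shows "(\<Sum>f\<in>PiE (\<kappa> ` (set vs \<inter> Obs - N)) al. Act (run \<G> sys ins outs (T (override_on z f (\<kappa> ` (set vs \<inter> Obs - N)))) vs ws m) \<one>)
    = Act (run \<G> sys' ins outs (T' z) vs ws (tensor_list d ws \<cdot> m)) \<one>"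
  using ok vs valid dep depN T test_obs test_lat keep drop m
proof (induction vs arbitrary: ws m z)
  case Nil
  then show ?case by (simp add: ident_left)
next
  case (Cons v vs)
  let ?W = "wires_sys \<G> sys" and ?W' = "wires_sys \<G> sys'"
  let ?r = "filter (\<lambda>w. w \<notin> set (ins v)) ws" let ?i = "ins v" and ?o = "outs v"
  let ?g = "gather \<G> sys ?i ws" and ?g' = "gather \<G> sys' ?i ws"
  let ?D = "\<kappa> ` (set vs \<inter> Obs - N)" and ?D' = "\<kappa> ` (set (v # vs) \<inter> Obs - N)"
  note ok = Cons.prems(1)[unfolded run_ok.simps]
  note depv = Cons.prems(7) and Thom = Cons.prems(9)
  have d: "d w \<in> Hom (sys w) (sys' w)" for w
    unfolding d_def sys'_def by (simp add: ident_hom discard(1))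
  have dhom: "tensor_list d xs \<in> Hom (?W xs) (?W' xs)" for xs by (rule tensor_list_hom[OF d])
  have dapp: "tensor_list d (xs @ ys) = tensor_list d xs \<otimes> tensor_list d ys" for xs ys
    by (rule tensor_list_append[OF d])
  have g: "?g \<in> Hom (?W ws) (?W ?i \<odot> ?W ?r)" and g': "?g' \<in> Hom (?W' ws) (?W' ?i \<odot> ?W' ?r)"
    using gather_hom[of ?i ws sys] gather_hom[of ?i ws sys'] ok by (simp_all add: wires_sys_append)
  have nat: "(tensor_list d ?i \<otimes> tensor_list d ?r) \<cdot> ?g = ?g' \<cdot> tensor_list d ws"
    using gather_natural[of ?i ws d sys sys'] d ok by (simp add: dapp)
  note m = Cons.prems(14)
  have gm: "?g \<cdot> m \<in> Hom \<I> (?W ?i \<odot> ?W ?r)" by (rule seq_hom[OF m g])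
  have kv: "\<kappa> v \<notin> ?D" using Cons.prems(2,3) by auto
  have T': "T' z u \<in> Hom (?W' (ins u)) (?W' (outs u))" if "z \<in> Z" "u \<in> set (v # vs)" for z u
  proof (cases "u \<in> N")
    case True
    then have "sys' w = sys w" if "w \<in> set (ins u) \<union> set (outs u)" for w
      using Cons.prems(12)[OF \<open>u \<in> set (v # vs)\<close> True that] by (auto simp: sys'_def)
    then have "?W' (ins u) = ?W (ins u)" "?W' (outs u) = ?W (outs u)" by (auto intro!: wires_sys_cong)
    then show ?thesis using Thom[OF that] True by (simp add: T'_def)
  next
    case False
    then have "?W' (outs u) = \<I>"
      using Cons.prems(13)[OF that(2) False] by (intro wires_sys_trivial) (auto simp: sys'_def)
    then show ?thesis using False discard(1) by (simp add: T'_def)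
  qed
  have ok': "run_ok ins outs vs (?o @ ?r)" using ok by simp
  \<comment> \<open>The open wires are fixed here, but \<open>z\<close> and \<open>m\<close> stay
    free, since both change with the value over which the sum runs.\<close>
  have IH: "(\<Sum>f\<in>PiE ?D al. Act (run \<G> sys ins outs (T (override_on z f ?D)) vs (?o @ ?r) m) \<one>)
    = Act (run \<G> sys' ins outs (T' z) vs (?o @ ?r) (tensor_list d (?o @ ?r) \<cdot> m)) \<one>"
    if "z \<in> Z" "m \<in> Hom \<I> (?W (?o @ ?r))" for z m
  proof -
    have dv: "distinct vs" "inj_on \<kappa> (set vs)" "sorted_wrt (\<lambda>v v'. \<kappa> v' \<notin> dep v) vs"
      using Cons.prems(2-4) by auto
    note li = list.set_intros(2)
    show ?thesis
      apply (rule Cons.IH[OF ok' dv that(1)])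
      apply (rule Cons.prems(6)[OF _ li], assumption+)
      apply (rule Cons.prems(7)[OF li], assumption, blast)
      apply (rule Cons.prems(8)[OF li li], assumption+)
      apply (rule Cons.prems(9)[OF _ li], assumption+)
      apply (rule Cons.prems(10)[OF _ li], assumption+)
      apply (rule Cons.prems(11)[OF _ li], assumption+)
      apply (rule Cons.prems(12)[OF li], assumption+)
      apply (rule Cons.prems(13)[OF li], assumption+)
      apply (rule that(2))
      done
  qed
  \<comment> \<open>No box reads the outcome of a later vertex, so overriding the later coordinates
    does not affect the present one.\<close>
  have dep_later: "T (override_on z f ?D) v = T z v" for z f
  proof (rule depv)
    fix k assume "k \<in> dep v"
    then have "k \<notin> ?D" using Cons.prems(4) by auto
    then show "override_on z f ?D k = z k" by simp
  qed simp
  have t: "T z v \<otimes> \<iota> (?W ?r) \<in> Hom (?W ?i \<odot> ?W ?r) (?W (?o @ ?r))" if "z \<in> Z" for z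
    using par_hom[OF Thom[OF that, of v] ident_hom] by (simp add: wires_sys_append)
  have push: "tensor_list d (?o @ ?r) \<cdot> ((T z v \<otimes> \<iota> (?W ?r)) \<cdot> (?g \<cdot> m)) = ((tensor_list d ?o \<cdot> T z v) \<otimes> tensor_list d ?r) \<cdot> (?g \<cdot> m)"
    if z: "z \<in> Z" for z
    using seq_assoc[OF gm t[OF z] dhom] interchange[OF Thom[OF z, of v] dhom ident_hom dhom] ident_right[OF dhom]
    by (simp add: dapp)
  show ?case
  proof (cases "v \<in> N")
    case True
    have D: "?D' = ?D" using True by auto
    have z: "z \<in> Z" by (rule Cons.prems(5))
    have dv: "tensor_list d xs = \<iota> (?W xs)" if "\<And>w. w \<in> set xs \<Longrightarrow> keep w \<or> sys w = \<I>" for xs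
      using that
    proof (induction xs)
      case (Cons x xs)
      have "d x = \<iota> (sys x)" using Cons.prems[of x] by (auto simp: d_def discard_unit)
      then show ?case using Cons by (simp add: par_ident)
    qed simp
    \<comment> \<open>Wires at a vertex of \<open>N\<close> are kept or trivial, and discarding a
      trivial system is the identity.\<close>
    have di: "tensor_list d ?i = \<iota> (?W ?i)" "tensor_list d ?o = \<iota> (?W ?o)"
      using Cons.prems(12)[OF _ True] by (auto intro!: dv)
    have W'i: "?W' ?i = ?W ?i" "?W' ?o = ?W ?o"
      using Cons.prems(12)[OF list.set_intros(1) True]
      by (force intro!: wires_sys_cong simp: sys'_def)+
    have Tz: "T z v \<in> Hom (?W ?i) (?W ?o)" using Thom[OF z] by simp
    have "((tensor_list d ?o \<cdot> T z v) \<otimes> tensor_list d ?r) \<cdot> (?g \<cdot> m) = (T' z v \<otimes> \<iota> (?W' ?r)) \<cdot> (?g' \<cdot> (tensor_list d ws \<cdot> m))"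
    proof -
      have "T z v \<otimes> tensor_list d ?r = (T z v \<otimes> \<iota> (?W' ?r)) \<cdot> (\<iota> (?W ?i) \<otimes> tensor_list d ?r)"
        using slide_left[OF Tz dhom] by simp
      moreover have "(\<iota> (?W ?i) \<otimes> tensor_list d ?r) \<cdot> (?g \<cdot> m) = ?g' \<cdot> (tensor_list d ws \<cdot> m)"
        using seq_assoc[OF m g par_hom[OF ident_hom[of "?W ?i"] dhom[of ?r]]] seq_assoc[OF m dhom g'] nat
        by (simp add: di)
      ultimately show ?thesis
        using seq_assoc[OF gm par_hom[OF ident_hom[of "?W ?i"] dhom[of ?r]] par_hom[OF Tz ident_hom[of "?W' ?r"]]]
        by (simp add: di ident_left[OF Tz] T'_def True)
    qed
    then show ?thesis
      using IH[OF z, of "(T z v \<otimes> \<iota> (?W ?r)) \<cdot> (?g \<cdot> m)"] seq_hom[OF gm t[OF z]] push[OF z]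
      unfolding D by (simp add: dep_later Let_def)
  next
    case False
    have do: "tensor_list d ?o = discard (?W ?o)"
      unfolding discard_tensor_list using Cons.prems(13)[OF list.set_intros(1) False]
      by (intro tensor_list_cong) (auto simp: d_def)
    have W'o: "?W' ?o = \<I>"
      using Cons.prems(13)[OF list.set_intros(1) False] by (intro wires_sys_trivial) (auto simp: sys'_def)
    have disc1: "discard (sys' x) \<cdot> d x = discard (sys x)" for x
      using ident_right[OF discard(1)] ident_left[OF discard(1)] by (simp add: sys'_def d_def discard_unit)
    have disc: "discard (?W' xs) \<cdot> tensor_list d xs = discard (?W xs)" for xs
    proof (induction xs)
      case Nil
      then show ?case by (simp add: discard_unit ident_left[OF ident_hom])
    next
      case (Cons x xs)
      then show ?case using interchange[OF d[of x] discard(1) dhom[of xs] discard(1)] disc1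
        by (simp add: discard_par)
    qed
    have z: "z \<in> Z" by (rule Cons.prems(5))
    \<comment> \<open>The later reduced boxes act as one effect \<open>E\<close>, so only the
      present box remains to be summed.\<close>
    obtain E where E: "E \<in> Hom (?W' (?o @ ?r)) \<I>"
      "\<And>A m. m \<in> Hom A (?W' (?o @ ?r)) \<Longrightarrow> run \<G> sys' ins outs (T' z) vs (?o @ ?r) m = E \<cdot> m"
      using run_eq_seq[OF ok', of "T' z" sys'] T'[OF z] by auto
    have W'r: "?W' (?o @ ?r) = ?W' ?r" by (simp add: wires_sys_append W'o sys_unit_left)
    define Y where "Y = (discard (?W ?i) \<otimes> \<iota> (?W ?r)) \<cdot> (?g \<cdot> m)"
    have di: "X \<otimes> \<iota> (?W ?r) \<in> Hom (?W ?i \<odot> ?W ?r) (?W ?r)" if "X \<in> Hom (?W ?i) \<I>" for X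
      using par_hom[OF that ident_hom[of "?W ?r"]] by (simp add: sys_unit_left)
    have split: "(X \<otimes> tensor_list d ?r) \<cdot> (?g \<cdot> m) = tensor_list d ?r \<cdot> ((X \<otimes> \<iota> (?W ?r)) \<cdot> (?g \<cdot> m))"
      if X: "X \<in> Hom (?W ?i) \<I>" for X
      using slide_right[OF X dhom[of ?r]] seq_assoc[OF gm di[OF X] dhom[of ?r]]
      by (simp add: par_unit_left[OF dhom])
    have Yh: "Y \<in> Hom \<I> (?W ?r)" unfolding Y_def by (rule seq_hom[OF gm di[OF discard(1)]])
    have rhs: "run \<G> sys' ins outs (T' z) (v # vs) ws (tensor_list d ws \<cdot> m) = E \<cdot> (tensor_list d ?r \<cdot> Y)"
    proof -
      let ?x = "discard (?W' ?i) \<otimes> \<iota> (?W' ?r)"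
      have x: "?x \<in> Hom (?W' ?i \<odot> ?W' ?r) (?W' ?r)"
        using par_hom[OF discard(1) ident_hom, of "?W' ?i" "?W' ?r"] by (simp add: sys_unit_left)
      have dd: "tensor_list d ?i \<otimes> tensor_list d ?r \<in> Hom (?W ?i \<odot> ?W ?r) (?W' ?i \<odot> ?W' ?r)"
        by (rule par_hom[OF dhom dhom])
      have "?g' \<cdot> (tensor_list d ws \<cdot> m) = (tensor_list d ?i \<otimes> tensor_list d ?r) \<cdot> (?g \<cdot> m)"
        using seq_assoc[OF m dhom g'] seq_assoc[OF m g dd] nat by simp
      then have "?x \<cdot> (?g' \<cdot> (tensor_list d ws \<cdot> m)) = (?x \<cdot> (tensor_list d ?i \<otimes> tensor_list d ?r)) \<cdot> (?g \<cdot> m)"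
        using seq_assoc[OF gm dd x] by simp
      also have "?x \<cdot> (tensor_list d ?i \<otimes> tensor_list d ?r) = discard (?W ?i) \<otimes> tensor_list d ?r"
        using interchange[OF dhom[of ?i] discard(1) dhom[of ?r] ident_hom] disc ident_left[OF dhom] by simp
      finally have "?x \<cdot> (?g' \<cdot> (tensor_list d ws \<cdot> m)) = tensor_list d ?r \<cdot> Y"
        using split[OF discard(1)] by (simp add: Y_def)
      then show ?thesis
        using E(2)[unfolded W'r, OF seq_hom[OF Yh dhom]] by (simp add: T'_def False Let_def)
    qed
    have lhs: "run \<G> sys' ins outs (T' z) vs (?o @ ?r) (tensor_list d (?o @ ?r) \<cdot> ((T y v \<otimes> \<iota> (?W ?r)) \<cdot> (?g \<cdot> m)))
        = E \<cdot> (tensor_list d ?r \<cdot> (((discard (?W ?o) \<cdot> T y v) \<otimes> \<iota> (?W ?r)) \<cdot> (?g \<cdot> m)))" if y: "y \<in> Z" for y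
    proof -
      have X: "discard (?W ?o) \<cdot> T y v \<in> Hom (?W ?i) \<I>" using seq_hom[OF Thom[OF y] discard(1)] by simp
      show ?thesis
        unfolding push[OF y] do split[OF X]
        by (rule E(2)[unfolded W'r, OF seq_hom[OF seq_hom[OF gm di[OF X]] dhom]])
    qed
    show ?thesis
    proof (cases "v \<in> Obs")
      case vO: False
      have D: "?D' = ?D" using vO by auto
      have "discard (?W ?o) \<cdot> T z v = discard (?W ?i)"
        using discard_channel Cons.prems(11)[OF z _ vO] by simp
      then show ?thesis
        using IH[OF z, of "(T z v \<otimes> \<iota> (?W ?r)) \<cdot> (?g \<cdot> m)"] seq_hom[OF gm t[OF z]] lhs[OF z] rhs
        unfolding D by (simp add: dep_later Let_def Y_def)
    next
      case True
      let ?z = "\<lambda>x. z(\<kappa> v := x)" and ?w = "Act (?g \<cdot> m) \<one>"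
      have D: "?D' = insert (\<kappa> v) ?D" using True False by auto
      have zx: "?z x \<in> Z" if "x \<in> al (\<kappa> v)" for x by (rule Cons.prems(6)[OF z list.set_intros(1) True that])
      have T'z: "T' (?z x) u = T' z u" if "u \<in> set vs" for x u
        unfolding T'_def using Cons.prems(8)[of u v] that False by (auto intro!: depv)
      have E2: "E \<cdot> tensor_list d ?r \<in> Hom (?W ?r) \<I>" by (rule seq_hom[OF dhom E(1)[unfolded W'r]])
      have w: "?w \<in> \<V> (?W ?i \<odot> ?W ?r)" by (rule act_state_space[OF gm one_state_space])
      have E3: "Act (E \<cdot> (tensor_list d ?r \<cdot> ((X \<otimes> \<iota> (?W ?r)) \<cdot> (?g \<cdot> m)))) \<one> =
          Act (E \<cdot> tensor_list d ?r) (Act (X \<otimes> \<iota> (?W ?r)) ?w)" if X: "X \<in> Hom (?W ?i) \<I>" for X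
        using act_seq[OF gm di[OF X] one_state_space] act_seq[OF seq_hom[OF gm di[OF X]] E2 one_state_space]
          seq_assoc[OF seq_hom[OF gm di[OF X]] dhom E(1)[unfolded W'r]] by simp
      have X: "discard (?W ?o) \<cdot> T (?z x) v \<in> Hom (?W ?i) \<I>" if "x \<in> al (\<kappa> v)" for x
        by (rule seq_hom[OF Thom[OF zx[OF that] list.set_intros(1)] discard(1)])
      have "(\<Sum>f\<in>PiE ?D' al. Act (run \<G> sys ins outs (T (override_on z f ?D')) (v # vs) ws m) \<one>) =
        (\<Sum>x\<in>al (\<kappa> v). \<Sum>f\<in>PiE ?D al. Act (run \<G> sys ins outs (T (override_on (?z x) f ?D)) vs (?o @ ?r) ((T (?z x) v \<otimes> \<iota> (?W ?r)) \<cdot> (?g \<cdot> m))) \<one>)"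
        unfolding D sum_PiE_insert[OF kv] override_on_insert_upd[OF kv]
        by (simp add: Let_def dep_later)
      also have "\<dots> = (\<Sum>x\<in>al (\<kappa> v). Act (E \<cdot> tensor_list d ?r) (Act ((discard (?W ?o) \<cdot> T (?z x) v) \<otimes> \<iota> (?W ?r)) ?w))"
      proof (rule sum.cong[OF refl])
        fix x assume x: "x \<in> al (\<kappa> v)"
        have "run \<G> sys' ins outs (T' (?z x)) vs ws' m' = run \<G> sys' ins outs (T' z) vs ws' m'" for ws' m'
          by (rule run_cong) (rule T'z)
        then show "(\<Sum>f\<in>PiE ?D al. Act (run \<G> sys ins outs (T (override_on (?z x) f ?D)) vs (?o @ ?r) ((T (?z x) v \<otimes> \<iota> (?W ?r)) \<cdot> (?g \<cdot> m))) \<one>) =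
          Act (E \<cdot> tensor_list d ?r) (Act ((discard (?W ?o) \<cdot> T (?z x) v) \<otimes> \<iota> (?W ?r)) ?w)"
          using IH[OF zx[OF x] seq_hom[OF gm t[OF zx[OF x]]]] lhs[OF zx[OF x]] E3[OF X[OF x]] by simp
      qed
      also have "\<dots> = Act (E \<cdot> tensor_list d ?r) (\<Sum>x\<in>al (\<kappa> v). Act ((discard (?W ?o) \<cdot> T (?z x) v) \<otimes> \<iota> (?W ?r)) ?w)"
        by (rule linear_sum[OF act_linear[OF E2], symmetric])
      also have "(\<Sum>x\<in>al (\<kappa> v). Act ((discard (?W ?o) \<cdot> T (?z x) v) \<otimes> \<iota> (?W ?r)) ?w) = Act (discard (?W ?i) \<otimes> \<iota> (?W ?r)) ?w"
        by (rule discard_test[OF Cons.prems(10)[OF z list.set_intros(1) True] w])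
      also have "Act (E \<cdot> tensor_list d ?r) (Act (discard (?W ?i) \<otimes> \<iota> (?W ?r)) ?w) = Act (E \<cdot> (tensor_list d ?r \<cdot> Y)) \<one>"
        using E3[OF discard(1)] by (simp add: Y_def)
      finally show ?thesis unfolding rhs .
    qed
  qed
qed

end

section \<open>Marginals, conditional independence and d-separation\<close>

definition determined_by :: "(('a \<Rightarrow> 'x) \<Rightarrow> 'b) \<Rightarrow> 'a set \<Rightarrow> bool" where
  "determined_by \<phi> S \<longleftrightarrow> (\<forall>x y. (\<forall>v\<in>S. x v = y v) \<longrightarrow> \<phi> x = \<phi> y)"

lemma determined_byD: "determined_by \<phi> S \<Longrightarrow> (\<And>v. v \<in> S \<Longrightarrow> x v = y v) \<Longrightarrow> \<phi> x = \<phi> y"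
  unfolding determined_by_def by blast

lemma determined_by_mono: "determined_by \<phi> S \<Longrightarrow> S \<subseteq> T \<Longrightarrow> determined_by \<phi> T"
  unfolding determined_by_def by (meson subsetD)

lemma sum_PiE_Un:
  assumes "finite D1" "D1 \<inter> D2 = {}"
  shows "(\<Sum>f\<in>PiE (D1 \<union> D2) al. h (override_on z f (D1 \<union> D2))) =
    (\<Sum>f\<in>PiE D1 al. \<Sum>g\<in>PiE D2 al. h (override_on (override_on z f D1) g D2))"
  using assms
proof (induction D1 arbitrary: z rule: finite_induct)
  case (insert k D1)
  then have k: "k \<notin> D1 \<union> D2" by auto
  show ?case
    unfolding Un_insert_left sum_PiE_insert[OF k] sum_PiE_insert[OF insert.hyps(2)]
      override_on_insert_upd[OF k] override_on_insert_upd[OF insert.hyps(2)]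
    using insert.IH insert.prems by simp
qed simp

lemma sum_PiE_Un_mult:
  fixes \<phi> \<gamma> :: "('a \<Rightarrow> 'x) \<Rightarrow> real"
  assumes "finite D1" "D1 \<inter> D2 = {}" "determined_by \<phi> X" "determined_by \<gamma> Y" "D1 \<inter> Y = {}" "D2 \<inter> X = {}"
  shows "(\<Sum>f\<in>PiE (D1 \<union> D2) al. \<phi> (override_on z f (D1 \<union> D2)) * \<gamma> (override_on z f (D1 \<union> D2))) =
    (\<Sum>f\<in>PiE D1 al. \<phi> (override_on z f D1)) * (\<Sum>f\<in>PiE D2 al. \<gamma> (override_on z f D2))"
proof -
  have "\<phi> (override_on (override_on z f D1) g D2) = \<phi> (override_on z f D1)" for f g
    by (rule determined_byD[OF assms(3)]) (use assms(6) in \<open>auto simp: override_on_def\<close>)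
  moreover have "\<gamma> (override_on (override_on z f D1) g D2) = \<gamma> (override_on z g D2)" for f g
    by (rule determined_byD[OF assms(4)]) (use assms(5) in \<open>auto simp: override_on_def\<close>)
  ultimately show ?thesis
    unfolding sum_PiE_Un[OF assms(1,2), where h="\<lambda>x. \<phi> x * \<gamma> x"] by (simp add: sum_product)
qed

section \<open>Marginals of factorizing distributions\<close>

locale observed_dag =
  fixes G :: "('a, 'x) dag"
  assumes finite_obs: "finite (obs G)"
    and finite_alph: "v \<in> obs G \<Longrightarrow> finite (alph G v)"
begin

lemma finite_PiE_alph: "S \<subseteq> obs G \<Longrightarrow> finite (PiE S (alph G))"
  using finite_obs finite_alph by (intro finite_PiE) (auto intro: finite_subset)

lemma finite_vals: "finite (vals G (obs G))"
  unfolding vals_def by (rule finite_PiE_alph) simp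

lemma override_vals:
  "x \<in> vals G (obs G) \<Longrightarrow> D \<subseteq> obs G \<Longrightarrow> f \<in> PiE D (alph G) \<Longrightarrow> override_on x f D \<in> vals G (obs G)"
  unfolding vals_def by (auto simp: override_on_def PiE_iff extensional_def)

lemma marginal_determined: "determined_by (marginal G p S) S"
  unfolding determined_by_def marginal_def by (auto intro!: arg_cong[where f="sum p"])

lemma marginal_obs: "x \<in> vals G (obs G) \<Longrightarrow> marginal G p (obs G) x = p x"
proof -
  assume x: "x \<in> vals G (obs G)"
  then have "{y. y \<in> vals G (obs G) \<and> (\<forall>v\<in>obs G. y v = x v)} = {x}"
    unfolding vals_def by (auto intro: PiE_ext)
  then show ?thesis by (simp add: marginal_def)
qed

lemma marginal_empty: "p \<in> distributions G \<Longrightarrow> marginal G p {} x = 1"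
  by (simp add: marginal_def distributions_def)

lemma marginal_sum:
  assumes "S \<subseteq> T" "T \<subseteq> obs G"
  shows "marginal G p S x = (\<Sum>f\<in>PiE (T - S) (alph G). marginal G p T (override_on x f (T - S)))"
proof -
  let ?Y = "\<lambda>f. {y. y \<in> vals G (obs G) \<and> (\<forall>v\<in>T. y v = override_on x f (T - S) v)}"
  have "(\<Union>f\<in>PiE (T - S) (alph G). ?Y f) = {y. y \<in> vals G (obs G) \<and> (\<forall>v\<in>S. y v = x v)}"
  proof (intro equalityI subsetI)
    fix y assume y: "y \<in> {y. y \<in> vals G (obs G) \<and> (\<forall>v\<in>S. y v = x v)}"
    then have "restrict y (T - S) \<in> PiE (T - S) (alph G)" using assms by (auto simp: vals_def)
    moreover have "y \<in> ?Y (restrict y (T - S))" using y by (auto simp: override_on_def)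
    ultimately show "y \<in> (\<Union>f\<in>PiE (T - S) (alph G). ?Y f)" by blast
  qed (use assms(1) in \<open>auto simp: override_on_def\<close>)
  moreover have "(\<Sum>y\<in>(\<Union>f\<in>PiE (T - S) (alph G). ?Y f). p y) = (\<Sum>f\<in>PiE (T - S) (alph G). \<Sum>y\<in>?Y f. p y)"
  proof (rule sum.UNION_disjoint)
    show "finite (PiE (T - S) (alph G))" using assms by (intro finite_PiE_alph) auto
    show "\<forall>f\<in>PiE (T - S) (alph G). finite (?Y f)" using finite_vals by simp
    show "\<forall>f\<in>PiE (T - S) (alph G). \<forall>g\<in>PiE (T - S) (alph G). f \<noteq> g \<longrightarrow> ?Y f \<inter> ?Y g = {}"
    proof (intro ballI impI)
      fix f g assume fg: "f \<in> PiE (T - S) (alph G)" "g \<in> PiE (T - S) (alph G)" "f \<noteq> g"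
      then obtain v where "v \<in> T - S" "f v \<noteq> g v" by (meson PiE_ext)
      then show "?Y f \<inter> ?Y g = {}" by (auto simp: override_on_def)
    qed
  qed
  ultimately show ?thesis by (simp add: marginal_def)
qed

text \<open>Since \<open>S\<close> contains \<open>Z\<close>, the only coordinates that both factors
  may read are not summed over, and the sum splits.\<close>

lemma marginal_factor:
  assumes disj: "X \<inter> Y = {}" "X \<inter> Z = {}" "Y \<inter> Z = {}" and sub: "X \<union> Y \<union> Z \<subseteq> obs G"
    and fac: "\<And>x. x \<in> vals G (obs G) \<Longrightarrow> marginal G p (X \<union> Y \<union> Z) x = \<phi> x * \<gamma> x"
    and det: "determined_by \<phi> (X \<union> Z)" "determined_by \<gamma> (Y \<union> Z)"
    and S: "Z \<subseteq> S" "S \<subseteq> X \<union> Y \<union> Z" and x: "x \<in> vals G (obs G)"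
  shows "marginal G p S x = (\<Sum>f\<in>PiE (X - S) (alph G). \<phi> (override_on x f (X - S))) *
    (\<Sum>f\<in>PiE (Y - S) (alph G). \<gamma> (override_on x f (Y - S)))"
proof -
  have D: "X \<union> Y \<union> Z - S = (X - S) \<union> (Y - S)" using S by auto
  have "marginal G p S x = (\<Sum>f\<in>PiE ((X - S) \<union> (Y - S)) (alph G).
      marginal G p (X \<union> Y \<union> Z) (override_on x f ((X - S) \<union> (Y - S))))"
    unfolding D[symmetric] by (rule marginal_sum[OF S(2) sub])
  also have "\<dots> = (\<Sum>f\<in>PiE ((X - S) \<union> (Y - S)) (alph G).
      \<phi> (override_on x f ((X - S) \<union> (Y - S))) * \<gamma> (override_on x f ((X - S) \<union> (Y - S))))"
    using sub by (intro sum.cong refl fac override_vals[OF x]) auto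
  also have "\<dots> = (\<Sum>f\<in>PiE (X - S) (alph G). \<phi> (override_on x f (X - S))) *
    (\<Sum>f\<in>PiE (Y - S) (alph G). \<gamma> (override_on x f (Y - S)))"
    using disj S sub finite_obs by (intro sum_PiE_Un_mult[OF _ _ det]) (auto intro: finite_subset)
  finally show ?thesis .
qed

text \<open>The conditioning set may contain parts of \<open>X\<close> and \<open>Y\<close> besides
  \<open>Z\<close>. Every marginal involved is a partial sum of \<open>\<phi>\<close> times one of
  \<open>\<gamma>\<close>, and after clearing denominators both sides consist of the same four
  partial sums.\<close>

lemma cond_indep_factor:
  assumes disj: "X \<inter> Y = {}" "X \<inter> Z = {}" "Y \<inter> Z = {}" and sub: "X \<union> Y \<union> Z \<subseteq> obs G"
    and fac: "\<And>x. x \<in> vals G (obs G) \<Longrightarrow> marginal G p (X \<union> Y \<union> Z) x = \<phi> x * \<gamma> x"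
    and det: "determined_by \<phi> (X \<union> Z)" "determined_by \<gamma> (Y \<union> Z)"
    and A: "A \<subseteq> X" and B: "B \<subseteq> Y" and C: "Z \<subseteq> C" "C \<subseteq> X \<union> Y \<union> Z"
  shows "cond_indep G p A B C"
  unfolding cond_indep_def
proof (intro ballI impI)
  fix x assume x: "x \<in> vals G (obs G)" and pos: "marginal G p C x > 0"
  let ?\<phi> = "\<lambda>D. \<Sum>f\<in>PiE D (alph G). \<phi> (override_on x f D)"
  let ?\<gamma> = "\<lambda>D. \<Sum>f\<in>PiE D (alph G). \<gamma> (override_on x f D)"
  note m = marginal_factor[OF disj sub fac det _ _ x]
  have eqs: "X - (A \<union> B \<union> C) = X - (A \<union> C)" "Y - (A \<union> B \<union> C) = Y - (B \<union> C)"
    "Y - (A \<union> C) = Y - C" "X - (B \<union> C) = X - C" using A B disj by auto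
  have "marginal G p (A \<union> B \<union> C) x = ?\<phi> (X - (A \<union> C)) * ?\<gamma> (Y - (B \<union> C))"
    using m[of "A \<union> B \<union> C"] A B C unfolding eqs by auto
  moreover have "marginal G p (A \<union> C) x = ?\<phi> (X - (A \<union> C)) * ?\<gamma> (Y - C)"
    using m[of "A \<union> C"] A C unfolding eqs by auto
  moreover have "marginal G p (B \<union> C) x = ?\<phi> (X - C) * ?\<gamma> (Y - (B \<union> C))"
    using m[of "B \<union> C"] B C unfolding eqs by auto
  moreover have "marginal G p C x = ?\<phi> (X - C) * ?\<gamma> (Y - C)"
    using m[of C] C by auto
  ultimately show "conditional G p (A \<union> B) C x = conditional G p A C x * conditional G p B C x"
    using pos unfolding conditional_def by (simp add: field_simps)
qed

end

section \<open>Paths, colliders and d-separation\<close>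

lemma no_collider_common_ancestor:
  assumes "\<And>i. Suc i < length p \<Longrightarrow> (p ! i, p ! Suc i) \<in> E \<or> (p ! Suc i, p ! i) \<in> E"
    and "\<And>i. 0 < i \<Longrightarrow> Suc i < length p \<Longrightarrow> \<not> collider_at E p i"
    and "k < length p"
  shows "(p ! k, p ! 0) \<in> E\<^sup>* \<or>
    (0 < k \<and> (p ! (k - 1), p ! k) \<in> E \<and> (\<exists>w. (w, p ! 0) \<in> E\<^sup>* \<and> (w, p ! k) \<in> E\<^sup>*))"
  using assms(3)
proof (induction k)
  case (Suc k)
  then have k: "k < length p" by simp
  \<comment> \<open>A path without colliders first climbs and then descends: after an edge pointing
    forward, an edge pointing backward would create a collider.\<close>
  consider "(p ! k, p ! Suc k) \<in> E" | "(p ! Suc k, p ! k) \<in> E" using assms(1)[OF Suc.prems] by blast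
  then show ?case
  proof cases
    case 1
    obtain w where "(w, p ! 0) \<in> E\<^sup>*" "(w, p ! k) \<in> E\<^sup>*" using Suc.IH[OF k] by blast
    then show ?thesis using 1 by (auto intro: rtrancl_into_rtrancl)
  next
    case 2
    have "(p ! k, p ! 0) \<in> E\<^sup>*"
      using Suc.IH[OF k] 2 assms(2)[of k] Suc.prems by (auto simp: collider_at_def)
    then show ?thesis using 2 by (auto intro: converse_rtrancl_into_rtrancl)
  qed
qed simp

lemma d_separated_empty:
  assumes "\<And>w a b. a \<in> A \<Longrightarrow> b \<in> B \<Longrightarrow> (w, a) \<in> E\<^sup>* \<Longrightarrow> (w, b) \<in> E\<^sup>* \<Longrightarrow> False"
  shows "d_separated E A B {}"
  unfolding d_separated_def
proof (intro allI impI)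
  fix p assume p: "undirected_path E p \<and> hd p \<in> A \<and> last p \<in> B"
  show "blocked E {} p"
  proof (rule ccontr)
    assume "\<not> blocked E {} p"
    then have nc: "\<And>i. 0 < i \<Longrightarrow> Suc i < length p \<Longrightarrow> \<not> collider_at E p i"
      unfolding blocked_def by (metis empty_iff)
    have ne: "p \<noteq> []" and adj: "\<And>i. Suc i < length p \<Longrightarrow> (p ! i, p ! Suc i) \<in> E \<or> (p ! Suc i, p ! i) \<in> E"
      using p unfolding undirected_path_def by auto
    have "hd p = p ! 0" "last p = p ! (length p - 1)" using ne by (simp_all add: hd_conv_nth last_conv_nth)
    then have "\<exists>w. (w, hd p) \<in> E\<^sup>* \<and> (w, last p) \<in> E\<^sup>*"
      using no_collider_common_ancestor[of p E "length p - 1", OF adj nc] ne by auto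
    then show False using assms p by blast
  qed
qed

text \<open>With nothing conditioned on, an unblocked path has no collider, so its two ends have a
  common ancestor.\<close>

lemma (in observed_dag) markov_disjoint_ancestors:
  assumes p: "p \<in> markov_model G" and S: "S1 \<subseteq> obs G" "S2 \<subseteq> obs G"
    and anc: "\<And>w a b. a \<in> S1 \<Longrightarrow> b \<in> S2 \<Longrightarrow> (w, a) \<in> (edges G)\<^sup>* \<Longrightarrow> (w, b) \<in> (edges G)\<^sup>* \<Longrightarrow> False"
    and x: "x \<in> vals G (obs G)"
  shows "marginal G p (S1 \<union> S2) x = marginal G p S1 x * marginal G p S2 x"
proof -
  have d: "p \<in> distributions G" using p by (simp add: markov_model_def)
  have "S1 \<inter> S2 = {}" using anc by blast
  moreover have "d_separated (edges G) S1 S2 {}" by (rule d_separated_empty) (rule anc)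
  ultimately have "cond_indep G p S1 S2 {}" using p S unfolding markov_model_def by auto
  then show ?thesis using x marginal_empty[OF d] by (simp add: cond_indep_def conditional_def)
qed

lemma rtrancl_simple_path:
  assumes "(a, b) \<in> R\<^sup>*"
  shows "\<exists>p. p \<noteq> [] \<and> hd p = a \<and> last p = b \<and> distinct p \<and> successively (\<lambda>x y. (x, y) \<in> R) p"
  using assms
proof (induction rule: rtrancl_induct)
  case base
  show ?case by (rule exI[of _ "[a]"]) simp
next
  case (step b c)
  then obtain p where p: "p \<noteq> []" "hd p = a" "last p = b" "distinct p" "successively (\<lambda>x y. (x, y) \<in> R) p"
    by blast
  show ?case
  proof (cases "c \<in> set p")
    \<comment> \<open>The path has returned to \<open>c\<close> and is cut back to the earlier
      visit.\<close>
    case True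
    then obtain xs ys where xs: "p = xs @ c # ys" by (meson split_list)
    show ?thesis
      by (rule exI[of _ "xs @ [c]"]) (use p xs in \<open>auto simp: successively_append_iff hd_append split: if_splits\<close>)
  next
    case False
    show ?thesis
      by (rule exI[of _ "p @ [c]"]) (use p False step in \<open>auto simp: successively_append_iff\<close>)
  qed
qed

text \<open>The number of these vertices is the termination measure for rerouting. Indexing by the
  predecessor of the collider avoids subtraction.\<close>

definition colliders_outside :: "('a \<times> 'a) set \<Rightarrow> 'a set \<Rightarrow> 'a list \<Rightarrow> 'a set" where
  "colliders_outside E S p = {v. v \<notin> S \<and> (\<exists>i. Suc (Suc i) < length p \<and> p ! Suc i = v \<and>
     (p ! i, v) \<in> E \<and> (p ! Suc (Suc i), v) \<in> E)}"

lemma colliders_outside_finite: "finite (colliders_outside E S p)"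
  by (rule finite_subset[of _ "set p"]) (auto simp: colliders_outside_def)

lemma colliders_outside_rev_subset: "colliders_outside E S p \<subseteq> colliders_outside E S (rev p)"
proof
  fix v assume "v \<in> colliders_outside E S p"
  then obtain i where i: "v \<notin> S" "Suc (Suc i) < length p" "p ! Suc i = v" "(p ! i, v) \<in> E" "(p ! Suc (Suc i), v) \<in> E"
    by (auto simp: colliders_outside_def)
  let ?j = "length p - Suc (Suc (Suc i))"
  have "rev p ! ?j = p ! Suc (Suc i)" "rev p ! Suc ?j = p ! Suc i" "rev p ! Suc (Suc ?j) = p ! i"
    using i(2) by (auto simp: rev_nth intro!: arg_cong[where f="\<lambda>n. p ! n"])
  then show "v \<in> colliders_outside E S (rev p)"
    using i by (auto simp: colliders_outside_def intro!: exI[of _ ?j])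
qed

lemma colliders_outside_rev: "colliders_outside E S (rev p) = colliders_outside E S p"
  using colliders_outside_rev_subset[of E S p] colliders_outside_rev_subset[of E S "rev p"] by auto

lemma undirected_path_successively:
  "undirected_path E p \<longleftrightarrow> p \<noteq> [] \<and> distinct p \<and> successively (\<lambda>x y. (x, y) \<in> E \<or> (y, x) \<in> E) p"
  unfolding undirected_path_def successively_conv_nth by auto

lemma undirected_path_rev: "undirected_path E p \<Longrightarrow> undirected_path E (rev p)"
  unfolding undirected_path_successively by (auto elim: successively_mono)

text \<open>A collider \<open>k\<close> that is no ancestor of \<open>C\<close> but one of \<open>s\<close> is bypassed by starting the path at
  \<open>s\<close> instead, climbing towards \<open>k\<close> up to the last vertex of the old path that is met.\<close>

lemma reroute:
  assumes ac: "acyclic E" and p: "undirected_path E p"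
    and k: "k \<in> colliders_outside E {v. \<exists>c\<in>C. (v, c) \<in> E\<^sup>*} p" and s: "(k, s) \<in> E\<^sup>*"
  shows "\<exists>p'. undirected_path E p' \<and> hd p' = s \<and> last p' = last p \<and>
    (\<forall>v\<in>set p'. v \<in> set p \<or> (v, s) \<in> E\<^sup>* \<and> v \<notin> C) \<and>
    colliders_outside E {v. \<exists>c\<in>C. (v, c) \<in> E\<^sup>*} p' \<subset> colliders_outside E {v. \<exists>c\<in>C. (v, c) \<in> E\<^sup>*} p"
proof -
  let ?An = "{v. \<exists>c\<in>C. (v, c) \<in> E\<^sup>*}"
  have kp: "k \<in> set p" "k \<notin> ?An" using k by (auto simp: colliders_outside_def)
  obtain D where D: "D \<noteq> []" "hd D = k" "last D = s" "distinct D" "successively (\<lambda>x y. (x, y) \<in> E) D"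
    using rtrancl_simple_path[OF s] by blast
  have kD: "k \<in> set D" using D by (metis hd_in_set)
  \<comment> \<open>\<open>x\<close> is the last vertex of \<open>p\<close> that lies on the descent
    \<open>D\<close> from \<open>k\<close> to \<open>s\<close>. The tail \<open>q2\<close> avoids
    \<open>D\<close>, which keeps the spliced path simple and drops \<open>k\<close> as a
    collider.\<close>
  obtain a0 x q2 where q: "p = a0 @ x # q2" "x \<in> set D" "\<And>y. y \<in> set q2 \<Longrightarrow> y \<notin> set D"
    using split_list_last_prop[of p "\<lambda>x. x \<in> set D"] kD kp by metis
  obtain D1 D2 where D12: "D = D1 @ x # D2" using split_list[OF q(2)] by blast
  let ?L = "rev (x # D2)" let ?p = "?L @ q2"
  have sD: "successively (\<lambda>x y. (x, y) \<in> E) (x # D2)"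
    using D(5) unfolding D12 successively_append_iff by auto
  then have L: "successively (\<lambda>x y. (y, x) \<in> E) ?L" by (subst successively_rev)
  have below: "(v, s) \<in> E\<^sup>* \<and> (k, v) \<in> E\<^sup>*" if vD: "v \<in> set D" for v
  proof -
    obtain u w where uw: "D = u @ v # w" using split_list[OF vD] by blast
    have succ: "successively (\<lambda>x y. (x, y) \<in> E) ys \<Longrightarrow> ys \<noteq> [] \<Longrightarrow> (hd ys, last ys) \<in> E\<^sup>*" for ys
      by (induction ys rule: induct_list012) (auto intro: converse_rtrancl_into_rtrancl)
    have "successively (\<lambda>x y. (x, y) \<in> E) (v # w)" "successively (\<lambda>x y. (x, y) \<in> E) (u @ [v])"
      using D(5) unfolding uw by (auto simp: successively_append_iff)
    from succ[OF this(1)] succ[OF this(2)] show ?thesis using D uw by (auto simp: hd_append split: if_splits)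
  qed
  have pp: "undirected_path E ?p"
    unfolding undirected_path_successively
  proof (intro conjI)
    show "distinct ?p" using D(4) p q unfolding D12 undirected_path_def by auto
    have "successively (\<lambda>x y. (x, y) \<in> E \<or> (y, x) \<in> E) (x # q2)"
      using p unfolding undirected_path_successively q(1) successively_append_iff by auto
    moreover have "successively (\<lambda>x y. (x, y) \<in> E \<or> (y, x) \<in> E) ?L"
      by (rule successively_mono[OF L]) auto
    ultimately show "successively (\<lambda>x y. (x, y) \<in> E \<or> (y, x) \<in> E) ?p"
      unfolding successively_append_iff by (cases q2) auto
  qed simp
  have "hd ?p = s" using D(3) unfolding D12 by (simp add: hd_append hd_rev split: if_splits)
  moreover have "last ?p = last p" by (simp add: q(1))
  moreover have "\<forall>v\<in>set ?p. v \<in> set p \<or> (v, s) \<in> E\<^sup>* \<and> v \<notin> C"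
    using below kp(2) unfolding q(1) D12 by auto
  moreover have "colliders_outside E ?An ?p \<subseteq> colliders_outside E ?An p - {k}"
  proof
    fix v assume "v \<in> colliders_outside E ?An ?p"
    then obtain i where i: "v \<notin> ?An" "Suc (Suc i) < length ?p" "?p ! Suc i = v" "(?p ! i, v) \<in> E" "(?p ! Suc (Suc i), v) \<in> E"
      by (auto simp: colliders_outside_def)
    \<comment> \<open>Along \<open>?L\<close> each edge points back towards \<open>s\<close>, so by
      acyclicity a collider cannot follow another vertex there. Colliders thus lie in
      \<open>q2\<close>, with the same neighbours as on \<open>p\<close>.\<close>
    have lt: "length ?L \<le> Suc i"
    proof (rule ccontr)
      assume "\<not> ?thesis"
      then have "Suc i < length ?L" by simp
      then have "(?L ! Suc i, ?L ! i) \<in> E" using L unfolding successively_conv_nth by blast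
      then have "(v, ?p ! i) \<in> E" using i(3) \<open>Suc i < length ?L\<close> by (simp only: nth_append) (simp split: if_splits)
      then show False using ac i(4) unfolding acyclic_def by (meson trancl.intros)
    qed
    have nth: "?p ! j = p ! (length a0 + (j - length D2))" if "length D2 \<le> j" for j
    proof -
      have "?p = rev D2 @ (x # q2)" by simp
      then have "?p ! j = (x # q2) ! (j - length D2)" using that by (simp only: nth_append) simp
      then show ?thesis unfolding q(1) nth_append_length_plus .
    qed
    let ?i = "length a0 + (i - length D2)"
    have "?p ! i = p ! ?i" "?p ! Suc i = p ! Suc ?i" "?p ! Suc (Suc i) = p ! Suc (Suc ?i)"
      using nth lt by (simp_all add: Suc_diff_le)
    moreover have "Suc (Suc ?i) < length p" using i(2) lt unfolding q(1) by simp
    ultimately have 1: "v \<in> colliders_outside E ?An p" using i unfolding colliders_outside_def by auto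
    have "v = q2 ! (Suc i - length ?L)" using i(3) lt by (simp add: nth_append)
    moreover have "Suc i - length ?L < length q2" using i(2) lt by simp
    ultimately have "v \<in> set q2" by simp
    then have "v \<noteq> k" using q(3) kD by blast
    with 1 show "v \<in> colliders_outside E ?An p - {k}" by simp
  qed
  ultimately show ?thesis using pp k by blast
qed

text \<open>All vertices of the path are ancestors of \<open>A \<union> B \<union> C\<close>, so a
  collider above no element of \<open>C\<close> is above one of \<open>A\<close> or of
  \<open>B\<close>. Replacing the beginning of the path, or of the reversed path, removes it without
  creating a new one; the vertices added lie outside \<open>C\<close>, hence outside
  \<open>Z\<close>.\<close>

lemma path_without_outside_colliders:
  assumes ac: "acyclic E" and p: "undirected_path E p" "hd p \<in> A" "last p \<in> B"
    and sub: "set p \<subseteq> {v. \<exists>s\<in>A \<union> B \<union> C. (v, s) \<in> E\<^sup>*} - Z" and Z: "Z \<subseteq> C"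
  shows "\<exists>p. undirected_path E p \<and> hd p \<in> A \<and> last p \<in> B \<and> set p \<inter> Z = {} \<and>
    colliders_outside E {v. \<exists>c\<in>C. (v, c) \<in> E\<^sup>*} p = {}"
  using p sub
proof (induction "card (colliders_outside E {v. \<exists>c\<in>C. (v, c) \<in> E\<^sup>*} p)" arbitrary: p rule: less_induct)
  case less
  let ?An = "{v. \<exists>c\<in>C. (v, c) \<in> E\<^sup>*}" let ?co = "colliders_outside E ?An"
  show ?case
  proof (cases "?co p = {}")
    case True
    then show ?thesis using less.prems by blast
  next
    case False
    then obtain k where k: "k \<in> ?co p" by blast
    then have "k \<in> set p" "k \<notin> ?An" by (auto simp: colliders_outside_def)
    then obtain s where s: "(k, s) \<in> E\<^sup>*" "s \<in> A \<or> s \<in> B" using less.prems(4) by blast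
    have new: "set p' \<subseteq> {v. \<exists>s\<in>A \<union> B \<union> C. (v, s) \<in> E\<^sup>*} - Z"
      if "\<forall>v\<in>set p'. v \<in> set p \<or> (v, s) \<in> E\<^sup>* \<and> v \<notin> C" for p'
      using that less.prems(4) s(2) Z by blast
    show ?thesis using s(2)
    proof
      assume sA: "s \<in> A"
      obtain p' where p': "undirected_path E p'" "hd p' = s" "last p' = last p"
        "\<forall>v\<in>set p'. v \<in> set p \<or> (v, s) \<in> E\<^sup>* \<and> v \<notin> C" "?co p' \<subset> ?co p"
        using reroute[OF ac less.prems(1) k s(1)] by blast
      show ?thesis
        using psubset_card_mono[OF colliders_outside_finite p'(5)] p'(1-3) sA less.prems(3) new[OF p'(4)]
        by (intro less.hyps[of p']) auto
    next
      assume sB: "s \<in> B"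
      obtain p' where p': "undirected_path E p'" "hd p' = s" "last p' = last (rev p)"
        "\<forall>v\<in>set p'. v \<in> set (rev p) \<or> (v, s) \<in> E\<^sup>* \<and> v \<notin> C" "?co p' \<subset> ?co (rev p)"
        using reroute[OF ac undirected_path_rev[OF less.prems(1)] _ s(1)] k unfolding colliders_outside_rev by blast
      have ne: "p \<noteq> []" "p' \<noteq> []" using less.prems(1) p'(1) by (auto simp: undirected_path_def)
      show ?thesis
        using psubset_card_mono[OF colliders_outside_finite p'(5)] p'(2,3) sB less.prems(2) ne new[of "rev p'"] p'(4)
          undirected_path_rev[OF p'(1)]
        by (intro less.hyps[of "rev p'"]) (auto simp: colliders_outside_rev hd_rev last_rev)
    qed
  qed
qed

text \<open>When every observed vertex is a root or a leaf, an observed interior vertex of a path is a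
  collider unless it is a root.  So d-separation splits the ancestors of \<open>A \<union> B \<union> C\<close> into two
  parts that share no edge once the roots in \<open>C\<close> are removed.\<close>

lemma d_separated_split:
  assumes ac: "acyclic E"
    and rl: "\<And>v. v \<in> V \<Longrightarrow> (\<forall>u. (u, v) \<notin> E) \<or> (\<forall>u. (v, u) \<notin> E)"
    and V: "A \<subseteq> V" "B \<subseteq> V" "C \<subseteq> V" and AC: "A \<inter> C = {}" "B \<inter> C = {}"
    and sep: "d_separated E A B C"
  obtains N1 N2 Z where "N1 \<inter> N2 = {}" "N1 \<inter> Z = {}" "N2 \<inter> Z = {}" "Z \<subseteq> C"
    "\<And>v u. v \<in> Z \<Longrightarrow> (u, v) \<notin> E"
    "\<And>u v. (u, v) \<in> E \<Longrightarrow> v \<in> N1 \<Longrightarrow> u \<in> N1 \<union> Z" "\<And>u v. (u, v) \<in> E \<Longrightarrow> v \<in> N2 \<Longrightarrow> u \<in> N2 \<union> Z"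
    "A \<subseteq> N1" "B \<subseteq> N2" "C \<subseteq> N1 \<union> N2 \<union> Z"
    "\<And>v. v \<in> N1 \<union> N2 \<union> Z \<Longrightarrow> \<exists>s\<in>A \<union> B \<union> C. (v, s) \<in> E\<^sup>*"
proof -
  define Z where "Z = {c \<in> C. \<forall>u. (u, c) \<notin> E}"
  define An where "An = {v. \<exists>s\<in>A \<union> B \<union> C. (v, s) \<in> E\<^sup>*}"
  define R where "R = {(u, v). u \<in> An - Z \<and> v \<in> An - Z \<and> ((u, v) \<in> E \<or> (v, u) \<in> E)}"
  define N1 where "N1 = {v \<in> An - Z. \<exists>a\<in>A. (a, v) \<in> R\<^sup>*}"
  \<comment> \<open>Components that meet neither \<open>A\<close> nor \<open>B\<close> go to the
    second side; they may contain elements of \<open>C\<close>.\<close>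
  define N2 where "N2 = An - Z - N1"
  have An: "A \<subseteq> An" "B \<subseteq> An" "C \<subseteq> An" unfolding An_def by auto
  have up: "u \<in> An" if "(u, v) \<in> E" "v \<in> An" for u v
    using that unfolding An_def by (auto intro: converse_rtrancl_into_rtrancl)
  have "False" if b: "b \<in> B" "b \<in> N1" for b
  proof -
    obtain a where a: "a \<in> A" "(a, b) \<in> R\<^sup>*" using b unfolding N1_def by blast
    obtain p where p: "p \<noteq> []" "hd p = a" "last p = b" "distinct p" "successively (\<lambda>x y. (x, y) \<in> R) p"
      using rtrancl_simple_path[OF a(2)] by blast
    have up: "undirected_path E p"
      unfolding undirected_path_successively using p by (auto elim!: successively_mono simp: R_def)
    have "set p \<subseteq> An - Z"
    proof (cases "length p = 1")
      \<comment> \<open>A path with one vertex contains no step of \<open>R\<close> from which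
        membership could be read off; here \<open>a = b\<close>, and \<open>A\<close> avoids
        \<open>C\<close>.\<close>
      case True
      then have "p = [a]" using p(2) by (cases p) auto
      then show ?thesis using a An AC unfolding Z_def by auto
    next
      case False
      show ?thesis
      proof
        fix v assume "v \<in> set p"
        then obtain i where i: "i < length p" "v = p ! i" by (auto simp: in_set_conv_nth)
        have s: "\<And>i. Suc i < length p \<Longrightarrow> (p ! i, p ! Suc i) \<in> R" using p(5) unfolding successively_conv_nth by blast
        show "v \<in> An - Z"
        proof (cases i)
          case 0
          then show ?thesis using s[of 0] False i p(1) unfolding R_def by (cases p; cases "tl p") auto
        next
          case (Suc j)
          then show ?thesis using s[of j] i unfolding R_def by auto
        qed
      qed
    qed
    then obtain p where p: "undirected_path E p" "hd p \<in> A" "last p \<in> B" "set p \<inter> Z = {}"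
      "colliders_outside E {v. \<exists>c\<in>C. (v, c) \<in> E\<^sup>*} p = {}"
      using path_without_outside_colliders[OF ac up, of A B C Z] a b p unfolding An_def Z_def by auto
    have "\<not> blocked E C p"
      unfolding blocked_def
    proof (intro notI, elim exE conjE)
      fix i assume i: "0 < i" "Suc i < length p"
        and bl: "if collider_at E p i then \<forall>d. (p ! i, d) \<in> E\<^sup>* \<longrightarrow> d \<notin> C else p ! i \<in> C"
      obtain j where j: "i = Suc j" using i(1) by (cases i) auto
      show False
      proof (cases "collider_at E p i")
        case True
        then have "p ! i \<in> colliders_outside E {v. \<exists>c\<in>C. (v, c) \<in> E\<^sup>*} p"
          using bl i(2) unfolding colliders_outside_def collider_at_def j by auto
        then show False using p(5) by simp
      next
        case False
        then have C: "p ! i \<in> C" using bl by simp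
        have "p ! i \<in> set p" using i by simp
        then have "\<not> (\<forall>u. (u, p ! i) \<notin> E)" using C p(4) unfolding Z_def by blast
        then have "\<forall>u. (p ! i, u) \<notin> E" using rl[of "p ! i"] C V by blast
        then have "collider_at E p i"
          using p(1) i unfolding undirected_path_def collider_at_def j by (metis Suc_lessD diff_Suc_1)
        then show False using False by simp
      qed
    qed
    then show False using sep p(1-3) unfolding d_separated_def by blast
  qed
  then have B: "B \<subseteq> N2" using An AC unfolding N2_def Z_def by auto
  have A: "A \<subseteq> N1" using An AC unfolding N1_def Z_def by auto
  have p1: "u \<in> N1 \<union> Z" if "(u, v) \<in> E" "v \<in> N1" for u v
  proof (rule ccontr)
    assume u: "u \<notin> N1 \<union> Z"
    have v: "v \<in> An - Z" using that(2) unfolding N1_def by blast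
    then have "u \<in> An - Z" using up that(1) u by blast
    then have "(v, u) \<in> R" using that(1) v unfolding R_def by blast
    then show False using that(2) u \<open>u \<in> An - Z\<close> unfolding N1_def by (auto intro: rtrancl_into_rtrancl)
  qed
  have p2: "u \<in> N2 \<union> Z" if "(u, v) \<in> E" "v \<in> N2" for u v
  proof (rule ccontr)
    assume u: "u \<notin> N2 \<union> Z"
    have v: "v \<in> An - Z" using that(2) unfolding N2_def by blast
    then have uN: "u \<in> N1" using up that(1) u unfolding N2_def by blast
    then have "(u, v) \<in> R" using that(1) v unfolding R_def N1_def by blast
    then have "v \<in> N1" using uN v unfolding N1_def by (auto intro: rtrancl_into_rtrancl)
    then show False using that(2) unfolding N2_def by blast
  qed
  show thesis
    by (rule that[of N1 N2 Z])
      (use A B p1 p2 An in \<open>auto simp: N1_def N2_def Z_def An_def\<close>)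
qed

section \<open>A criterion for membership in the ordinary Markov model\<close>

lemma acyclic_Inl:
  fixes E' :: "('a + 'b) rel"
  assumes "acyclic E" and "\<And>a b. (a, b) \<in> E' \<Longrightarrow> \<exists>y. b = Inl y"
    and "\<And>v y. (Inl v, Inl y) \<in> E' \<Longrightarrow> (v, y) \<in> E"
  shows "acyclic E'"
  unfolding acyclic_def
proof (intro allI notI)
  fix a assume a: "(a, a) \<in> E'\<^sup>+"
  have "\<exists>y. b = Inl y \<and> (\<forall>v. a = Inl v \<longrightarrow> (v, y) \<in> E\<^sup>+)" if "(a, b) \<in> E'\<^sup>+" for b
    using that
  proof (induction rule: trancl_induct)
    case (base b)
    obtain y where "b = Inl y" using assms(2)[OF base] by blast
    then show ?case using assms(3) base by (intro exI[of _ y]) auto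
  next
    case (step b c)
    obtain y where y: "b = Inl y" "\<forall>v. a = Inl v \<longrightarrow> (v, y) \<in> E\<^sup>+" using step.IH by blast
    obtain z where z: "c = Inl z" using assms(2)[OF step.hyps(2)] by blast
    have "(y, z) \<in> E" using assms(3) step.hyps(2) y(1) z by blast
    then show ?case using y(2) z by (intro exI[of _ z]) (auto intro: trancl_into_trancl)
  qed
  from this[OF a] obtain y where "a = Inl y" "(y, y) \<in> E\<^sup>+" by blast
  then show False using assms(1) unfolding acyclic_def by blast
qed

lemma (in observed_dag) uniform_joint_distribution:
  assumes S: "S \<subseteq> obs G" and ne: "\<And>s. s \<in> S \<Longrightarrow> alph G s \<noteq> {}" and q: "kernel G (obs G - S) S q"
  shows "uniform_joint G S q \<in> distributions G"
proof -
  let ?c = "\<Prod>s\<in>S. 1 / real (card (alph G s))"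
  have fS: "finite S" using S finite_obs by (rule finite_subset)
  have fin: "finite (alph G s)" if "s \<in> S" for s using that S finite_alph by blast
  have c0: "?c \<ge> 0" by (intro prod_nonneg) simp
  define h where "h = (\<lambda>z. q (restrict z (obs G - S)) (restrict z S) * ?c)"
  have obs: "obs G = S \<union> (obs G - S)" using S by auto
  \<comment> \<open>The base function is \<open>undefined\<close> everywhere, so that overriding it
    by an extensional function returns that function.\<close>
  have ov: "override_on (\<lambda>_. undefined) f D = f" if "f \<in> PiE D (alph G)" for f D
    using that by (auto simp: override_on_def fun_eq_iff PiE_def extensional_def)
  have "(\<Sum>z\<in>vals G (obs G). uniform_joint G S q z) = (\<Sum>z\<in>PiE (obs G) (alph G). h (override_on (\<lambda>_. undefined) z (obs G)))"
    by (intro sum.cong) (auto simp: vals_def uniform_joint_def h_def ov)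
  also have "\<dots> = (\<Sum>y\<in>PiE S (alph G). \<Sum>x\<in>PiE (obs G - S) (alph G).
      h (override_on (override_on (\<lambda>_. undefined) y S) x (obs G - S)))"
    using sum_PiE_Un[OF fS Diff_disjoint, of h "\<lambda>_. undefined" "obs G" "alph G"] unfolding obs[symmetric] .
  also have "\<dots> = (\<Sum>y\<in>PiE S (alph G). \<Sum>x\<in>PiE (obs G - S) (alph G). q x y * ?c)"
  proof (intro sum.cong refl)
    fix x y assume y: "y \<in> PiE S (alph G)" and x: "x \<in> PiE (obs G - S) (alph G)"
    let ?z = "override_on (override_on (\<lambda>_. undefined) y S) x (obs G - S)"
    have "restrict ?z (obs G - S) = x" "restrict ?z S = y"
      using x y by (auto simp: override_on_def fun_eq_iff PiE_def extensional_def)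
    then show "h ?z = q x y * ?c" by (simp add: h_def)
  qed
  also have "\<dots> = (\<Sum>y\<in>PiE S (alph G). ?c)"
    using q by (intro sum.cong) (simp_all add: kernel_def vals_def sum_distrib_right[symmetric])
  also have "\<dots> = (\<Prod>s\<in>S. real (card (alph G s))) * ?c" by (simp add: card_PiE[OF fS])
  also have "\<dots> = 1"
    unfolding prod.distrib[symmetric] using fin ne by (intro prod.neutral) (simp add: card_gt_0_iff)
  finally have "(\<Sum>z\<in>vals G (obs G). uniform_joint G S q z) = 1" .
  moreover have "0 \<le> uniform_joint G S q z" for z
  proof (cases "z \<in> vals G (obs G)")
    case True
    then have "restrict z S \<in> vals G S" "restrict z (obs G - S) \<in> vals G (obs G - S)"
      using S by (auto simp: vals_def)
    then show ?thesis using q c0 True unfolding kernel_def uniform_joint_def by simp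
  qed (simp add: uniform_joint_def)
  ultimately show ?thesis by (simp add: distributions_def uniform_joint_def)
qed

text \<open>The hypothesis \<open>fac\<close> does not mention the separated sets, only two parts
  that are closed under parents up to the roots in \<open>Z\<close>, as
  \<open>d_separated_split\<close> produces them. Both inclusions verify their models in this
  form.\<close>

lemma (in observed_dag) markov_modelI:
  assumes p: "p \<in> distributions G" and ac: "acyclic (edges G)"
    and E: "edges G \<subseteq> (obs G \<union> lat G) \<times> (obs G \<union> lat G)"
    and rl: "\<And>v. v \<in> obs G \<Longrightarrow> (\<forall>u. (u, v) \<notin> edges G) \<or> (\<forall>u. (v, u) \<notin> edges G)"
    and fac: "\<And>N1 N2 Z. N1 \<inter> N2 = {} \<Longrightarrow> N1 \<inter> Z = {} \<Longrightarrow> N2 \<inter> Z = {} \<Longrightarrow>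
      N1 \<union> N2 \<subseteq> obs G \<union> lat G \<Longrightarrow> Z \<subseteq> obs G \<Longrightarrow> (\<And>u v. v \<in> Z \<Longrightarrow> (u, v) \<notin> edges G) \<Longrightarrow>
      (\<And>u v. (u, v) \<in> edges G \<Longrightarrow> v \<in> N1 \<Longrightarrow> u \<in> N1 \<union> Z) \<Longrightarrow>
      (\<And>u v. (u, v) \<in> edges G \<Longrightarrow> v \<in> N2 \<Longrightarrow> u \<in> N2 \<union> Z) \<Longrightarrow>
      \<exists>\<phi> \<gamma>. determined_by \<phi> (obs G \<inter> (N1 \<union> Z)) \<and> determined_by \<gamma> (obs G \<inter> (N2 \<union> Z)) \<and>
        (\<forall>x\<in>vals G (obs G). marginal G p (obs G \<inter> (N1 \<union> N2 \<union> Z)) x = \<phi> x * \<gamma> x)"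
  shows "p \<in> markov_model G"
  unfolding markov_model_def
proof (intro CollectI conjI p allI impI, elim conjE)
  fix A B C
  assume sub: "A \<subseteq> obs G" "B \<subseteq> obs G" "C \<subseteq> obs G" and disj: "A \<inter> C = {}" "B \<inter> C = {}"
    and sep: "d_separated (edges G) A B C"
  show "cond_indep G p A B C"
  proof (rule d_separated_split[OF ac rl sub disj sep])
    fix N1 N2 Z
    assume N: "N1 \<inter> N2 = {}" "N1 \<inter> Z = {}" "N2 \<inter> Z = {}" "Z \<subseteq> C"
      "\<And>v u. v \<in> Z \<Longrightarrow> (u, v) \<notin> edges G"
      "\<And>u v. (u, v) \<in> edges G \<Longrightarrow> v \<in> N1 \<Longrightarrow> u \<in> N1 \<union> Z" "\<And>u v. (u, v) \<in> edges G \<Longrightarrow> v \<in> N2 \<Longrightarrow> u \<in> N2 \<union> Z"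
      "A \<subseteq> N1" "B \<subseteq> N2" "C \<subseteq> N1 \<union> N2 \<union> Z"
      "\<And>v. v \<in> N1 \<union> N2 \<union> Z \<Longrightarrow> \<exists>s\<in>A \<union> B \<union> C. (v, s) \<in> (edges G)\<^sup>*"
    have NO: "N1 \<union> N2 \<subseteq> obs G \<union> lat G"
    proof
      fix v assume "v \<in> N1 \<union> N2"
      then obtain s where "s \<in> obs G" "(v, s) \<in> (edges G)\<^sup>*" using N(11)[of v] sub by blast
      then show "v \<in> obs G \<union> lat G" using E by (auto elim: converse_rtranclE)
    qed
    have ZO: "Z \<subseteq> obs G" using N(4) sub by blast
    have "\<exists>\<phi> \<gamma>. determined_by \<phi> (obs G \<inter> (N1 \<union> Z)) \<and> determined_by \<gamma> (obs G \<inter> (N2 \<union> Z)) \<and>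
        (\<forall>x\<in>vals G (obs G). marginal G p (obs G \<inter> (N1 \<union> N2 \<union> Z)) x = \<phi> x * \<gamma> x)"
      by (rule fac[OF N(1-3) NO ZO]) (erule N(5), erule (1) N(6), erule (1) N(7))
    then obtain \<phi> \<gamma> where fg: "determined_by \<phi> (obs G \<inter> (N1 \<union> Z))" "determined_by \<gamma> (obs G \<inter> (N2 \<union> Z))"
      "\<forall>x\<in>vals G (obs G). marginal G p (obs G \<inter> (N1 \<union> N2 \<union> Z)) x = \<phi> x * \<gamma> x"
      by blast
    have eqs: "obs G \<inter> (N1 \<union> Z) = (obs G \<inter> N1) \<union> Z" "obs G \<inter> (N2 \<union> Z) = (obs G \<inter> N2) \<union> Z"
      "obs G \<inter> (N1 \<union> N2 \<union> Z) = (obs G \<inter> N1) \<union> (obs G \<inter> N2) \<union> Z" using ZO by auto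
    show "cond_indep G p A B C"
    proof (rule cond_indep_factor[of "obs G \<inter> N1" "obs G \<inter> N2" Z p \<phi> \<gamma>])
      show "determined_by \<phi> (obs G \<inter> N1 \<union> Z)" "determined_by \<gamma> (obs G \<inter> N2 \<union> Z)"
        using fg(1,2) unfolding eqs by auto
      show "marginal G p (obs G \<inter> N1 \<union> obs G \<inter> N2 \<union> Z) x = \<phi> x * \<gamma> x" if "x \<in> vals G (obs G)" for x
        using fg(3) that unfolding eqs by auto
    qed (use N sub ZO in auto)
  qed
qed

section \<open>Open wires along a topological ordering\<close>

lemma run_ok_filter:
  "run_ok ins outs vs ws \<Longrightarrow> run_ok (\<lambda>v. filter F (ins v)) (\<lambda>v. filter F (outs v)) vs (filter F ws)"
proof (induction vs arbitrary: ws)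
  case (Cons v vs)
  have r: "filter (\<lambda>w. w \<notin> set (filter F (ins v))) (filter F ws) = filter F (filter (\<lambda>w. w \<notin> set (ins v)) ws)"
    by (auto intro!: filter_cong)
  show ?case
    using Cons.prems Cons.IH[of "outs v @ filter (\<lambda>w. w \<notin> set (ins v)) ws"] unfolding run_ok.simps r by auto
qed simp

lemma in_wires_set: "topological_ordering G vs \<Longrightarrow> causal_dag G \<Longrightarrow> set (in_wires G vs v) = {(u, v) |u. (u, v) \<in> edges G}"
  unfolding in_wires_def topological_ordering_def causal_dag_def by auto

lemma out_wires_set: "topological_ordering G vs \<Longrightarrow> causal_dag G \<Longrightarrow> set (out_wires G vs v) = {(v, y) |y. (v, y) \<in> edges G}"
  unfolding out_wires_def topological_ordering_def causal_dag_def by auto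

text \<open>The invariant is that the open wires are the edges from the processed prefix to the
  vertices still to come; no edge has this property when all are processed.\<close>

lemma run_ok_topological:
  assumes top: "topological_ordering G vs" and dag: "causal_dag G"
    and "vs = pre @ suf" "distinct ws" "set ws = {(u, y) \<in> edges G. u \<in> set pre \<and> y \<notin> set pre}"
  shows "run_ok (in_wires G vs) (out_wires G vs) suf ws"
  using assms(3-)
proof (induction suf arbitrary: pre ws)
  case Nil
  then have "set ws = {}" using top dag unfolding topological_ordering_def causal_dag_def by auto
  then show ?case by simp
next
  case (Cons v suf)
  have dvs: "distinct vs" using top by (simp add: topological_ordering_def)
  have before: "u \<in> set pre" if "(u, v) \<in> edges G" for u
  proof -
    have "u \<in> set vs" using that top dag unfolding topological_ordering_def causal_dag_def by auto
    then obtain i where i: "i < length vs" "vs ! i = u" by (auto simp: in_set_conv_nth)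
    have "vs ! length pre = v" "length pre < length vs" using Cons.prems(1) by auto
    then have "i < length pre" using top that i unfolding topological_ordering_def by metis
    then show ?thesis using i Cons.prems(1) by (metis nth_append nth_mem)
  qed
  have v: "v \<notin> set pre" using dvs Cons.prems(1) by auto
  let ?r = "filter (\<lambda>w. w \<notin> set (in_wires G vs v)) ws"
  have r: "set ?r = {(u, y) \<in> edges G. u \<in> set pre \<and> y \<notin> set pre \<and> y \<noteq> v}"
    using in_wires_set[OF top dag, of v] Cons.prems(3) by auto
  have d: "distinct (in_wires G vs v)" "distinct (out_wires G vs v)"
    using dvs unfolding in_wires_def out_wires_def by (auto simp: distinct_map inj_on_def)
  have i: "set (in_wires G vs v) \<subseteq> set ws" using in_wires_set[OF top dag, of v] Cons.prems(3) before v by auto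
  have disj: "set (out_wires G vs v) \<inter> set ?r = {}" using out_wires_set[OF top dag, of v] r v by auto
  have irr: "(v, v) \<notin> edges G" using before v by blast
  have "run_ok (in_wires G vs) (out_wires G vs) suf (out_wires G vs v @ ?r)"
  proof (rule Cons.IH[of "pre @ [v]"])
    show "vs = (pre @ [v]) @ suf" using Cons.prems(1) by simp
    show "distinct (out_wires G vs v @ ?r)" using d disj Cons.prems(2) by auto
    have out: "y \<notin> set pre" if "(v, y) \<in> edges G" for y
    proof
      assume "y \<in> set pre"
      then obtain i where i: "i < length pre" "pre ! i = y" by (auto simp: in_set_conv_nth)
      have "vs ! length pre = v" "length pre < length vs" "vs ! i = y" using Cons.prems(1) i by (auto simp: nth_append)
      then show False using top that i unfolding topological_ordering_def by (metis less_asym less_trans)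
    qed
    show "set (out_wires G vs v @ ?r) = {(u, y) \<in> edges G. u \<in> set (pre @ [v]) \<and> y \<notin> set (pre @ [v])}"
      unfolding set_append r out_wires_set[OF top dag, of v] using out irr by auto
  qed
  then show ?case using d i disj Cons.prems(2) by auto
qed

lemma (in strict_symmetric_monoidal) run_trivial:
  assumes "\<And>w. sys w = \<I>" "\<And>v. v \<in> set vs \<Longrightarrow> T v = \<iota> \<I>" "run_ok ins outs vs ws"
  shows "run \<G> sys ins outs T vs ws (\<iota> \<I>) = \<iota> \<I>"
  using assms(2,3)
proof (induction vs arbitrary: ws)
  case (Cons v vs)
  have "gather \<G> sys (ins v) ws = \<iota> \<I>" using Cons.prems assms(1) by (intro gather_trivial) auto
  moreover have "wires_sys \<G> sys ws = \<I>" for ws by (rule wires_sys_trivial) (rule assms(1))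
  ultimately show ?case using Cons by (simp add: Let_def par_ident sys_unit_left ident_left[OF ident_hom])
qed simp

section \<open>Scalars of a theory\<close>

context gpt
begin

text \<open>Naturality with every wire discarded: between trivial wires the permutation is the
  identity.\<close>

lemma discard_perm:
  assumes "distinct ys" "distinct xs" "set ys = set xs"
  shows "discard (wires_sys \<G> sys ys) \<cdot> gather \<G> sys ys xs = discard (wires_sys \<G> sys xs)"
proof -
  have f: "filter (\<lambda>w. w \<notin> set ys) xs = []" using assms(3) by (simp add: filter_empty_conv)
  have "tensor_list (\<lambda>w. discard (sys w)) ys \<cdot> gather \<G> sys ys xs =
      gather \<G> (\<lambda>_. \<I>) ys xs \<cdot> tensor_list (\<lambda>w. discard (sys w)) xs"
    using gather_natural[of ys xs "\<lambda>w. discard (sys w)" sys "\<lambda>_. \<I>"] assms discard(1) unfolding f by simp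
  also have "gather \<G> (\<lambda>_. \<I>) ys xs = \<iota> \<I>" using assms by (intro gather_trivial) auto
  finally show ?thesis
    unfolding discard_tensor_list[symmetric] by (simp add: ident_left[OF discard(1)])
qed

lemma scalar_linear: "linear (scalar \<G>)"
  using unit_functional_linear[of "\<I>"] by (simp add: scalar_def[abs_def])

lemma scalar_one: "scalar \<G> \<one> = 1"
  by (simp add: scalar_def unit_one)

lemma act_scalar: "a \<in> Hom \<I> \<I> \<Longrightarrow> Act a \<one> = scalar \<G> (Act a \<one>) *\<^sub>R \<one>"
proof -
  assume "a \<in> Hom \<I> \<I>"
  then have "Act a \<one> \<in> span {\<one>}"
    using act_state_space[of a "\<I>" "\<I>" \<one>] one_state_space unfolding state_space_def normalized_unit by blast
  then obtain r where "Act a \<one> = r *\<^sub>R \<one>" by (auto simp: span_singleton)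
  then show ?thesis using linear_cmul[OF scalar_linear, of r \<one>] scalar_one by simp
qed

text \<open>Between trivial systems \<open>\<otimes>\<close> coincides with composition, and since
  \<open>\<one>\<close> spans the state space, composition there is multiplication of
  numbers.\<close>

lemma scalar_par:
  assumes "a \<in> Hom \<I> \<I>" "b \<in> Hom \<I> \<I>"
  shows "scalar \<G> (Act (a \<otimes> b) \<one>) = scalar \<G> (Act a \<one>) * scalar \<G> (Act b \<one>)"
proof -
  have "a \<otimes> b = a \<cdot> b"
    using slide_left[OF assms] par_unit_right[OF assms(1)] par_unit_left[OF assms(2)] by simp
  then have "Act (a \<otimes> b) \<one> = Act a (Act b \<one>)" using act_seq[OF assms(2,1) one_state_space] by simp
  also have "\<dots> = scalar \<G> (Act b \<one>) *\<^sub>R Act a \<one>"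
    by (subst act_scalar[OF assms(2)]) (simp add: linear_cmul[OF act_linear[OF assms(1)]])
  finally show ?thesis using linear_cmul[OF scalar_linear] by simp
qed

lemma scalar_nonneg:
  assumes "a \<in> Hom \<I> \<I>" shows "0 \<le> scalar \<G> (Act a \<one>)"
proof -
  have "convex {w. 0 \<le> scalar \<G> w}"
    using convex_linear_vimage[OF scalar_linear, of "{0..}"] by (simp add: vimage_def)
  then have "\<S> \<I> \<subseteq> {w. 0 \<le> scalar \<G> w}"
    unfolding states_def normalized_unit
    by (intro hull_minimal) (simp_all add: scalar_one linear_0[OF scalar_linear])
  moreover have "Act a \<one> \<in> \<S> \<I>" using act_states[OF assms] normalized_states unit_sys_normalized by blast
  ultimately show ?thesis by blast
qed

end

section \<open>Maximal interruption\<close>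

lemma MaxInt_simps:
  "obs (MaxInt G) = Inl ` obs G \<union> Inr ` cut_edges G" "lat (MaxInt G) = Inl ` lat G"
  "alph (MaxInt G) (Inl v) = alph G v" "alph (MaxInt G) (Inr e) = alph G (fst e)"
  by (simp_all add: MaxInt_def)

lemma MaxInt_edges:
  "(a, b) \<in> edges (MaxInt G) \<longleftrightarrow> (\<exists>v y. b = Inl y \<and> (v, y) \<in> edges G \<and>
     a = (if (v, y) \<in> cut_edges G then Inr (v, y) else Inl v))"
  unfolding MaxInt_def cut_edges_def by auto

lemma cut_edges_obs: "(v, y) \<in> cut_edges G \<Longrightarrow> v \<in> obs G"
  by (auto simp: cut_edges_def split_verts_def rip_verts_def)

locale causal =
  fixes G :: "('a, 'x) dag"
  assumes dag: "causal_dag G"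
begin

lemma finite_obs: "finite (obs G)" and finite_lat: "finite (lat G)" and disjoint: "obs G \<inter> lat G = {}"
  and edges_sub: "edges G \<subseteq> (obs G \<union> lat G) \<times> (obs G \<union> lat G)" and acyclic: "acyclic (edges G)"
  and finite_alph: "v \<in> obs G \<Longrightarrow> finite (alph G v)" and alph_nonempty: "v \<in> obs G \<Longrightarrow> alph G v \<noteq> {}"
  using dag unfolding causal_dag_def by auto

lemma finite_edges: "finite (edges G)"
  using edges_sub finite_obs finite_lat by (meson finite_SigmaI finite_UnI finite_subset)

lemma finite_cut: "finite (cut_edges G)"
  using finite_edges by (rule finite_subset[rotated]) (auto simp: cut_edges_def)

sublocale MI: observed_dag "MaxInt G"
proof
  show "finite (obs (MaxInt G))" by (simp add: MaxInt_simps finite_obs finite_cut)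
  show "finite (alph (MaxInt G) v)" if "v \<in> obs (MaxInt G)" for v
    using that by (auto simp: MaxInt_simps intro!: finite_alph cut_edges_obs)
qed

lemma MaxInt_alph_nonempty: "v \<in> obs (MaxInt G) \<Longrightarrow> alph (MaxInt G) v \<noteq> {}"
  using alph_nonempty by (force simp: MaxInt_simps dest: cut_edges_obs)

lemma MaxInt_acyclic: "acyclic (edges (MaxInt G))"
  by (rule acyclic_Inl[OF acyclic]) (auto simp: MaxInt_edges split: if_splits)

lemma MaxInt_edges_sub: "edges (MaxInt G) \<subseteq>
  (obs (MaxInt G) \<union> lat (MaxInt G)) \<times> (obs (MaxInt G) \<union> lat (MaxInt G))"
  using edges_sub by (fastforce simp: MaxInt_edges MaxInt_simps)

text \<open>A vertex with parents and children belongs to \<open>split_verts G\<close>, and cutting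
  all its outgoing edges leaves it childless.\<close>

lemma MaxInt_root_or_leaf:
  "v \<in> obs (MaxInt G) \<Longrightarrow> (\<forall>u. (u, v) \<notin> edges (MaxInt G)) \<or> (\<forall>u. (v, u) \<notin> edges (MaxInt G))"
  by (auto simp: MaxInt_simps MaxInt_edges cut_edges_def split_verts_def parents_def children_def split: if_splits)

end

section \<open>Circuits with interrupted edges\<close>

locale circuit_realization = causal G + gpt \<G>
  for G :: "('a, 'x) dag" and \<G> :: "('s, 'm, 'w::real_vector) gpt_struct" (structure) +
  fixes vs :: "'a list" and sys :: "'a \<times> 'a \<Rightarrow> 's"
    and T :: "'a \<Rightarrow> ('a \<Rightarrow> 'x) \<Rightarrow> 'x \<Rightarrow> 'm" and L :: "'a \<Rightarrow> ('a \<Rightarrow> 'x) \<Rightarrow> 'm"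
  assumes top: "topological_ordering G vs"
    and sys_obs: "(v, y) \<in> edges G \<Longrightarrow> v \<in> obs G \<Longrightarrow> sys (v, y) = \<I>"
    and T_test: "v \<in> obs G \<Longrightarrow> c \<in> vals G (parents G v \<inter> obs G) \<Longrightarrow>
      test \<G> (wires_sys \<G> sys (in_wires G vs v)) (wires_sys \<G> sys (out_wires G vs v)) (alph G v) (T v c)"
    and L_test: "v \<in> lat G \<Longrightarrow> c \<in> vals G (parents G v \<inter> obs G) \<Longrightarrow>
      test \<G> (wires_sys \<G> sys (in_wires G vs v)) (wires_sys \<G> sys (out_wires G vs v)) {()} (\<lambda>_. L v c)"
begin

abbreviation "H \<equiv> MaxInt G"
abbreviation "ins \<equiv> in_wires G vs"
abbreviation "outs \<equiv> out_wires G vs"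

definition parent_vals :: "('a + 'a \<times> 'a \<Rightarrow> 'x) \<Rightarrow> 'a \<Rightarrow> 'a \<Rightarrow> 'x" where
  "parent_vals z v = (\<lambda>u\<in>parents G v \<inter> obs G. if (u, v) \<in> cut_edges G then z (Inr (u, v)) else z (Inl u))"

definition box :: "('a + 'a \<times> 'a \<Rightarrow> 'x) \<Rightarrow> 'a \<Rightarrow> 'm" where
  "box z v = (if v \<in> obs G then T v (parent_vals z v) (z (Inl v)) else L v (parent_vals z v))"

definition dep :: "'a \<Rightarrow> ('a + 'a \<times> 'a) set" where
  "dep v = {a \<in> obs H. a = Inl v \<or> (a, Inl v) \<in> edges H}"

definition valid :: "('a + 'a \<times> 'a \<Rightarrow> 'x) set" where
  "valid = {z. \<forall>a\<in>obs H. z a \<in> alph H a}"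

definition val :: "('a + 'a \<times> 'a \<Rightarrow> 'x) \<Rightarrow> real" where
  "val z = scalar \<G> (Act (run \<G> sys ins outs (box z) vs [] (\<iota> \<I>)) \<one>)"

text \<open>The tail of a wire decides: what a vertex outside \<open>N\<close> sends out is
  discarded together with its box.\<close>

definition reduced_sys :: "'a set \<Rightarrow> 'a \<times> 'a \<Rightarrow> 's" where
  "reduced_sys N w = (if fst w \<in> N then sys w else \<I>)"

definition reduced_box :: "'a set \<Rightarrow> ('a + 'a \<times> 'a \<Rightarrow> 'x) \<Rightarrow> 'a \<Rightarrow> 'm" where
  "reduced_box N z v = (if v \<in> N then box z v else discard (wires_sys \<G> (reduced_sys N) (ins v)))"

definition reduced_val :: "'a set \<Rightarrow> ('a + 'a \<times> 'a \<Rightarrow> 'x) \<Rightarrow> real" where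
  "reduced_val N z = scalar \<G> (Act (run \<G> (reduced_sys N) ins outs (reduced_box N z) vs [] (\<iota> \<I>)) \<one>)"

lemma set_vs: "set vs = obs G \<union> lat G" and distinct_vs: "distinct vs"
  using top by (auto simp: topological_ordering_def)

lemma run_ok_vs: "run_ok ins outs vs []"
  using run_ok_topological[OF top dag, of "[]" vs "[]"] by simp

lemma ins_set: "set (ins v) = {(u, v) |u. (u, v) \<in> edges G}"
  and outs_set: "set (outs v) = {(v, y) |y. (v, y) \<in> edges G}"
  using in_wires_set[OF top dag] out_wires_set[OF top dag] by auto

lemma box_dep: "(\<And>a. a \<in> dep v \<Longrightarrow> z a = z' a) \<Longrightarrow> box z v = box z' v"
proof -
  assume *: "\<And>a. a \<in> dep v \<Longrightarrow> z a = z' a"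
  have "parent_vals z v u = parent_vals z' v u" for u
    unfolding parent_vals_def
    by (auto simp: restrict_def parents_def dep_def MaxInt_simps MaxInt_edges intro!: *)
  moreover have "z (Inl v) = z' (Inl v)" if "v \<in> obs G"
    using that by (intro *) (auto simp: dep_def MaxInt_simps)
  ultimately show ?thesis unfolding box_def by (metis ext)
qed

lemma parent_vals_vals: "z \<in> valid \<Longrightarrow> parent_vals z v \<in> vals G (parents G v \<inter> obs G)"
proof -
  assume z: "z \<in> valid"
  have "z (Inr (u, v)) \<in> alph G u" if "(u, v) \<in> cut_edges G" for u
    using z that unfolding valid_def by (force simp: MaxInt_simps)
  moreover have "z (Inl u) \<in> alph G u" if "u \<in> obs G" for u
    using z that unfolding valid_def by (force simp: MaxInt_simps)
  ultimately show ?thesis unfolding parent_vals_def vals_def by auto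
qed

lemma parent_vals_upd: "parent_vals (z(Inl v := x)) v = parent_vals z v"
proof -
  have "(v, v) \<notin> edges G" using acyclic unfolding acyclic_def by blast
  then show ?thesis unfolding parent_vals_def parents_def by (auto simp: restrict_def fun_eq_iff)
qed

lemma valid_upd: "z \<in> valid \<Longrightarrow> x \<in> alph H (Inl v) \<Longrightarrow> z(Inl v := x) \<in> valid"
  by (auto simp: valid_def)

lemma valid_override: "z \<in> valid \<Longrightarrow> f \<in> PiE D (alph H) \<Longrightarrow> override_on z f D \<in> valid"
  by (auto simp: valid_def override_on_def)

lemma vals_valid: "z \<in> vals H (obs H) \<Longrightarrow> z \<in> valid"
  by (auto simp: valid_def vals_def)

lemma box_test_obs: "z \<in> valid \<Longrightarrow> v \<in> obs G \<Longrightarrow>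
   test \<G> (wires_sys \<G> sys (ins v)) (wires_sys \<G> sys (outs v)) (alph H (Inl v)) (\<lambda>x. box (z(Inl v := x)) v)"
  unfolding box_def parent_vals_upd using T_test[OF _ parent_vals_vals] by (simp add: MaxInt_simps)

lemma box_test_lat: "z \<in> valid \<Longrightarrow> v \<in> lat G \<Longrightarrow>
   test \<G> (wires_sys \<G> sys (ins v)) (wires_sys \<G> sys (outs v)) {()} (\<lambda>_. box z v)"
  unfolding box_def using L_test[OF _ parent_vals_vals] disjoint by auto

lemma box_hom: "z \<in> valid \<Longrightarrow> v \<in> set vs \<Longrightarrow>
   box z v \<in> Hom (wires_sys \<G> sys (ins v)) (wires_sys \<G> sys (outs v))"
proof -
  assume z: "z \<in> valid" and "v \<in> set vs"
  then consider "v \<in> obs G" | "v \<in> lat G" using set_vs by blast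
  then show ?thesis
  proof cases
    case 1
    have "z (Inl v) \<in> alph G v" using z 1 unfolding valid_def by (force simp: MaxInt_simps)
    then show ?thesis using T_test[OF 1 parent_vals_vals[OF z]] 1 by (simp add: test_def box_def)
  next
    case 2
    then show ?thesis using box_test_lat[OF z 2] by (simp add: test_def)
  qed
qed

lemma dep_sub: "dep v \<subseteq> obs H"
  by (auto simp: dep_def)

lemma val_determined: "determined_by val (obs H)"
  unfolding determined_by_def val_def
proof (intro allI impI)
  fix z z' :: "'a + 'a \<times> 'a \<Rightarrow> 'x" assume "\<forall>a\<in>obs H. z a = z' a"
  then have "run \<G> sys ins outs (box z) vs [] (\<iota> \<I>) = run \<G> sys ins outs (box z') vs [] (\<iota> \<I>)"
    using dep_sub by (intro run_cong box_dep) blast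
  then show "scalar \<G> (Act (run \<G> sys ins outs (box z) vs [] (\<iota> \<I>)) \<one>) =
    scalar \<G> (Act (run \<G> sys ins outs (box z') vs [] (\<iota> \<I>)) \<one>)" by simp
qed

lemma val_nonneg: "z \<in> valid \<Longrightarrow> 0 \<le> val z"
  unfolding val_def using run_hom[OF run_ok_vs, of "box z" sys "\<iota> \<I>" \<I>] box_hom ident_hom
  by (intro scalar_nonneg) simp

text \<open>An instance of \<open>run_sum_out\<close>. Closure of \<open>N\<close> under uncut edges
  suffices, because a cut edge carries the trivial system and its value is read from a coordinate
  that is not summed.\<close>

lemma sum_val:
  assumes N: "\<And>u v. (u, v) \<in> edges G - cut_edges G \<Longrightarrow> v \<in> N \<Longrightarrow> u \<in> N" and z: "z \<in> valid"
  shows "(\<Sum>f\<in>PiE (Inl ` (obs G - N)) (alph H). val (override_on z f (Inl ` (obs G - N)))) = reduced_val N z"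
proof -
  let ?D = "Inl ` (set vs \<inter> obs G - N) :: ('a + 'a \<times> 'a) set"
  let ?d = "\<lambda>w. if fst w \<in> N then \<iota> (sys w) else discard (sys w)"
  have rs: "reduced_sys N = (\<lambda>w. if fst w \<in> N then sys w else \<I>)"
    by (simp add: reduced_sys_def fun_eq_iff)
  have rb: "reduced_box N z = (\<lambda>v. if v \<in> N then box z v else discard (wires_sys \<G> (\<lambda>w. if fst w \<in> N then sys w else \<I>) (ins v)))"
    by (simp add: reduced_box_def rs fun_eq_iff)
  have dep_iff: "Inl u \<in> dep v \<longleftrightarrow> u \<in> obs G \<and> (u = v \<or> (u, v) \<in> edges G - cut_edges G)" for u v
    by (auto simp: dep_def MaxInt_simps MaxInt_edges split: if_splits)
  have "(\<Sum>f\<in>PiE ?D (alph H). Act (run \<G> sys ins outs (box (override_on z f ?D)) vs [] (\<iota> \<I>)) \<one>)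
    = Act (run \<G> (\<lambda>w. if fst w \<in> N then sys w else \<I>) ins outs
        ((\<lambda>z v. if v \<in> N then box z v else discard (wires_sys \<G> (\<lambda>w. if fst w \<in> N then sys w else \<I>) (ins v))) z)
        vs [] (tensor_list ?d [] \<cdot> \<iota> \<I>)) \<one>"
  proof (rule run_sum_out[where dep=dep and Z=valid])
    show "run_ok ins outs vs []" by (rule run_ok_vs)
    show "distinct vs" by (rule distinct_vs)
    show "inj_on Inl (set vs)" by simp
    show "sorted_wrt (\<lambda>v v'. Inl v' \<notin> dep v) vs"
      unfolding sorted_wrt_iff_nth_less dep_iff
      using top unfolding topological_ordering_def by (metis DiffD1 distinct_conv_nth less_asym less_trans nat_neq_iff)
    show "z \<in> valid" by (rule z)
    show "z(Inl v := x) \<in> valid" if "z \<in> valid" "x \<in> alph H (Inl v)" for z v x by (rule valid_upd[OF that])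
    show "box z v = box z' v" if "\<And>k. k \<in> dep v \<Longrightarrow> z k = z' k" for z z' v by (rule box_dep[OF that])
    show "Inl v' \<notin> dep v" if "v \<in> N" "v' \<notin> N" for v v'
      unfolding dep_iff using that N by blast
    show "box z v \<in> Hom (wires_sys \<G> sys (ins v)) (wires_sys \<G> sys (outs v))" if "z \<in> valid" "v \<in> set vs" for z v
      by (rule box_hom[OF that])
    show "test \<G> (wires_sys \<G> sys (ins v)) (wires_sys \<G> sys (outs v)) (alph H (Inl v)) (\<lambda>x. box (z(Inl v := x)) v)"
      if "z \<in> valid" "v \<in> obs G" for z v by (rule box_test_obs[OF that])
    show "test \<G> (wires_sys \<G> sys (ins v)) (wires_sys \<G> sys (outs v)) {()} (\<lambda>_. box z v)"
      if "z \<in> valid" "v \<in> set vs" "v \<notin> obs G" for z v using box_test_lat[of z v] that set_vs by blast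
    \<comment> \<open>A wire into \<open>N\<close> with a nontrivial system has a latent tail, so it
      is uncut and starts in \<open>N\<close>.\<close>
    show "fst w \<in> N \<or> sys w = \<I>" if v: "v \<in> N" and w: "w \<in> set (ins v) \<union> set (outs v)" for v w
    proof (rule disjCI)
      assume s: "sys w \<noteq> \<I>"
      show "fst w \<in> N"
      proof (cases "w \<in> set (ins v)")
        case True
        then obtain u where u: "w = (u, v)" "(u, v) \<in> edges G" unfolding ins_set by blast
        then have "u \<notin> obs G" using sys_obs s by blast
        then have "(u, v) \<notin> cut_edges G" using cut_edges_obs[of u v G] by blast
        then show ?thesis using N u v by simp
      next
        case False
        then show ?thesis using w v unfolding outs_set by auto
      qed
    qed
    show "fst w \<notin> N" if "v \<notin> N" "w \<in> set (outs v)" for v w using that unfolding outs_set by auto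
    show "\<iota> \<I> \<in> Hom \<I> (wires_sys \<G> sys [])" by (simp add: ident_hom)
  qed
  moreover have "tensor_list ?d [] \<cdot> \<iota> \<I> = \<iota> \<I>" by (simp add: ident_left[OF ident_hom])
  moreover have "set vs \<inter> obs G - N = obs G - N" using set_vs by auto
  ultimately have "(\<Sum>f\<in>PiE (Inl ` (obs G - N)) (alph H).
      Act (run \<G> sys ins outs (box (override_on z f (Inl ` (obs G - N)))) vs [] (\<iota> \<I>)) \<one>)
    = Act (run \<G> (reduced_sys N) ins outs (reduced_box N z) vs [] (\<iota> \<I>)) \<one>"
    by (simp add: rs rb)
  then show ?thesis
    unfolding val_def reduced_val_def by (simp add: linear_sum[OF scalar_linear, symmetric])
qed

section \<open>Reduced circuits and their factorization\<close>

lemma reduced_val_determined: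
  assumes "\<And>v. v \<in> N \<Longrightarrow> dep v \<subseteq> S"
  shows "determined_by (reduced_val N) S"
  unfolding determined_by_def reduced_val_def
proof (intro allI impI)
  fix z z' :: "'a + 'a \<times> 'a \<Rightarrow> 'x" assume "\<forall>a\<in>S. z a = z' a"
  then have "reduced_box N z v = reduced_box N z' v" for v
    unfolding reduced_box_def using assms box_dep[of v z z'] by (cases "v \<in> N") auto
  then have "reduced_box N z = reduced_box N z'" by (rule ext)
  then show "scalar \<G> (Act (run \<G> (reduced_sys N) ins outs (reduced_box N z) vs [] (\<iota> \<I>)) \<one>) =
    scalar \<G> (Act (run \<G> (reduced_sys N) ins outs (reduced_box N z') vs [] (\<iota> \<I>)) \<one>)" by simp
qed

text \<open>With all boxes and wires discarded the circuit is the identity on \<open>\<I>\<close>.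
  Through \<open>sum_val\<close> this is the normalization of \<open>circuit_kernel\<close>.\<close>

lemma reduced_val_empty: "reduced_val {} z = 1"
proof -
  have "run \<G> (reduced_sys {}) ins outs (reduced_box {} z) vs [] (\<iota> \<I>) = \<iota> \<I>"
  proof (rule run_trivial[OF _ _ run_ok_vs])
    show "reduced_sys {} w = \<I>" for w by (simp add: reduced_sys_def)
    then have "wires_sys \<G> (reduced_sys {}) ws = \<I>" for ws by (rule wires_sys_trivial)
    then show "reduced_box {} z v = \<iota> \<I>" for v by (simp add: reduced_box_def discard_unit)
  qed
  then show ?thesis by (simp add: reduced_val_def act_ident[OF one_state_space] scalar_one)
qed

text \<open>Only latent parents have to stay on the side of their children: wires from observed
  vertices are trivial, and the values that they transmit are parameters of the boxes. A box of one
  side becomes \<open>\<iota> \<I>\<close> on the other, and a box outside both discards the wires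
  of either side there.\<close>

lemma reduced_val_factor:
  assumes disj: "NA \<inter> NB = {}"
    and cA: "\<And>u v. (u, v) \<in> edges G \<Longrightarrow> u \<in> lat G \<Longrightarrow> v \<in> NA \<Longrightarrow> u \<in> NA"
    and cB: "\<And>u v. (u, v) \<in> edges G \<Longrightarrow> u \<in> lat G \<Longrightarrow> v \<in> NB \<Longrightarrow> u \<in> NB"
  shows "\<exists>\<phi> \<gamma>. determined_by \<phi> (\<Union>v\<in>NA. dep v) \<and> determined_by \<gamma> (\<Union>v\<in>NB. dep v) \<and>
    (\<forall>z\<in>valid. reduced_val (NA \<union> NB) z = \<phi> z * \<gamma> z)"
proof -
  let ?N = "NA \<union> NB" let ?sys = "reduced_sys ?N" let ?W = "wires_sys \<G> ?sys"
  \<comment> \<open>A wire with latent tail belongs to the side of its tail. Any other wire is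
    trivial and follows its head, so that all inputs of a box in \<open>NA\<close> satisfy
    \<open>F\<close> and no input of a box in \<open>NB\<close> does.\<close>
  define F where "F = (\<lambda>w::'a \<times> 'a. if fst w \<in> lat G then fst w \<in> NA else snd w \<in> NA)"
  define F' where "F' = (\<lambda>w. \<not> F w)"
  define T1 where "T1 = (\<lambda>z v. if v \<in> NA then box z v else if v \<in> NB then \<iota> \<I> else discard (?W (filter F (ins v))))"
  define T2 where "T2 = (\<lambda>z v. if v \<in> NA then \<iota> \<I> else if v \<in> NB then box z v else discard (?W (filter F' (ins v))))"
  define \<phi> where "\<phi> = (\<lambda>z. scalar \<G> (Act (run \<G> ?sys (\<lambda>v. filter F (ins v)) (\<lambda>v. filter F (outs v)) (T1 z) vs [] (\<iota> \<I>)) \<one>))"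
  define \<gamma> where "\<gamma> = (\<lambda>z. scalar \<G> (Act (run \<G> ?sys (\<lambda>v. filter F' (ins v)) (\<lambda>v. filter F' (outs v)) (T2 z) vs [] (\<iota> \<I>)) \<one>))"
  have d1: "determined_by \<phi> (\<Union>v\<in>NA. dep v)"
    unfolding determined_by_def
  proof (intro allI impI)
    fix z z' :: "'a + 'a \<times> 'a \<Rightarrow> 'x" assume "\<forall>a\<in>(\<Union>v\<in>NA. dep v). z a = z' a"
    then have "T1 z = T1 z'" unfolding T1_def fun_eq_iff by (auto intro!: box_dep)
    then show "\<phi> z = \<phi> z'" by (simp add: \<phi>_def)
  qed
  have d2: "determined_by \<gamma> (\<Union>v\<in>NB. dep v)"
    unfolding determined_by_def
  proof (intro allI impI)
    fix z z' :: "'a + 'a \<times> 'a \<Rightarrow> 'x" assume "\<forall>a\<in>(\<Union>v\<in>NB. dep v). z a = z' a"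
    then have "T2 z = T2 z'" unfolding T2_def fun_eq_iff by (auto intro!: box_dep)
    then show "\<gamma> z = \<gamma> z'" by (simp add: \<gamma>_def)
  qed
  have obs_lat: "u \<in> obs G \<or> u \<in> lat G" "v \<in> obs G \<or> v \<in> lat G" if "(u, v) \<in> edges G" for u v
    using that edges_sub by auto
  have sys_eq: "?sys w = sys w" if vN: "v \<in> ?N" and wv: "w \<in> set (ins v) \<union> set (outs v)" for v w
  proof (cases "fst w \<in> obs G")
    case True
    then have "sys w = \<I>" using wv sys_obs unfolding ins_set outs_set by auto
    then show ?thesis by (simp add: reduced_sys_def)
  next
    case False
    obtain u y where w: "w = (u, y)" "(u, y) \<in> edges G" "u = v \<or> y = v"
      using wv unfolding ins_set outs_set by blast
    then have "u \<in> lat G" using False obs_lat(1)[OF w(2)] by simp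
    then have "fst w \<in> ?N" using w vN cA[OF w(2)] cB[OF w(2)] by auto
    then show ?thesis by (simp add: reduced_sys_def)
  qed
  have hom: "box z v \<in> Hom (?W (ins v)) (?W (outs v))" if "z \<in> valid" "v \<in> set vs" "v \<in> ?N" for z v
  proof -
    have "?W (ins v) = wires_sys \<G> sys (ins v)" "?W (outs v) = wires_sys \<G> sys (outs v)"
      using sys_eq[OF that(3)] by (auto intro!: wires_sys_cong)
    then show ?thesis using box_hom[OF that(1,2)] by simp
  qed
  have out_triv: "?sys w = \<I>" if "v \<notin> ?N" "w \<in> set (outs v)" for v w
    using that unfolding outs_set by (auto simp: reduced_sys_def)
  have obs_triv: "?sys w = \<I>" if "v \<in> obs G" "w \<in> set (outs v)" for v w
    using that sys_obs unfolding outs_set by (auto simp: reduced_sys_def)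
  have insA: "F w" if "v \<in> NA" "w \<in> set (ins v)" for v w
    using that cA unfolding F_def ins_set by auto
  have insB: "\<not> F w" if "v \<in> NB" "w \<in> set (ins v)" for v w
    using that cB disj unfolding F_def ins_set by auto
  have outsA: "v \<in> obs G \<or> (\<forall>w\<in>set (outs v). F w)" if "v \<in> NA" for v
    using that obs_lat unfolding F_def outs_set by auto
  have outsB: "v \<in> obs G \<or> (\<forall>w\<in>set (outs v). \<not> F w)" if "v \<in> NB" for v
    using that obs_lat disj unfolding F_def outs_set by auto
  have Wtriv: "?W (filter P xs) = \<I>" if "\<And>w. w \<in> set xs \<Longrightarrow> P w \<Longrightarrow> ?sys w = \<I>" for P xs
    using that by (intro wires_sys_trivial) auto
  have dis: "distinct (ins v)" "distinct (outs v)" for v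
    using distinct_vs unfolding in_wires_def out_wires_def by (auto simp: distinct_map inj_on_def)
  have sep_outA: "separate ?sys F (outs v) = \<iota> (?W (outs v))"
      "?W (filter F (outs v)) = ?W (outs v)" "?W (filter F' (outs v)) = \<I>" if "v \<in> NA" for v
  proof -
    have "separate ?sys F (outs v) = \<iota> (?W (outs v)) \<and> ?W (filter F (outs v)) = ?W (outs v) \<and> ?W (filter F' (outs v)) = \<I>"
    proof (cases "v \<in> obs G")
      case True
      have "?W (outs v) = \<I>" "?W (filter F (outs v)) = \<I>" "?W (filter F' (outs v)) = \<I>"
        using obs_triv[OF True] by (auto intro!: wires_sys_trivial)
      moreover have "separate ?sys F (outs v) = \<iota> \<I>"
        by (rule separate_trivial[OF dis(2)]) (rule obs_triv[OF True])
      ultimately show ?thesis by simp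
    next
      case False
      then have all: "\<forall>w\<in>set (outs v). F w" using outsA[OF that] by blast
      then have "filter F (outs v) = outs v" "filter F' (outs v) = []" by (auto simp: F'_def filter_empty_conv)
      then show ?thesis using separate_all[of "outs v" F ?sys] all by simp
    qed
    then show "separate ?sys F (outs v) = \<iota> (?W (outs v))"
      "?W (filter F (outs v)) = ?W (outs v)" "?W (filter F' (outs v)) = \<I>" by auto
  qed
  have sep_outB: "separate ?sys F (outs v) = \<iota> (?W (outs v))"
      "?W (filter F' (outs v)) = ?W (outs v)" "?W (filter F (outs v)) = \<I>" if "v \<in> NB" for v
  proof -
    have "separate ?sys F (outs v) = \<iota> (?W (outs v)) \<and> ?W (filter F' (outs v)) = ?W (outs v) \<and> ?W (filter F (outs v)) = \<I>"
    proof (cases "v \<in> obs G")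
      case True
      have "?W (outs v) = \<I>" "?W (filter F (outs v)) = \<I>" "?W (filter F' (outs v)) = \<I>"
        using obs_triv[OF True] by (auto intro!: wires_sys_trivial)
      moreover have "separate ?sys F (outs v) = \<iota> \<I>"
        by (rule separate_trivial[OF dis(2)]) (rule obs_triv[OF True])
      ultimately show ?thesis by simp
    next
      case False
      then have all: "\<forall>w\<in>set (outs v). \<not> F w" using outsB[OF that] by blast
      then have "filter F' (outs v) = outs v" "filter F (outs v) = []" by (auto simp: F'_def filter_empty_conv)
      then show ?thesis using separate_none[of "outs v" F ?sys] all by simp
    qed
    then show "separate ?sys F (outs v) = \<iota> (?W (outs v))"
      "?W (filter F' (outs v)) = ?W (outs v)" "?W (filter F (outs v)) = \<I>" by auto
  qed
  have insA': "filter F (ins v) = ins v" "filter F' (ins v) = []" "separate ?sys F (ins v) = \<iota> (?W (ins v))" if "v \<in> NA" for v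
    using insA[OF that] by (auto simp: F'_def filter_empty_conv filter_id_conv separate_all)
  have insB': "filter F' (ins v) = ins v" "filter F (ins v) = []" "separate ?sys F (ins v) = \<iota> (?W (ins v))" if "v \<in> NB" for v
    using insB[OF that] by (auto simp: F'_def filter_empty_conv filter_id_conv separate_none)
  have outN: "?W (filter P (outs v)) = \<I>" "?W (outs v) = \<I>" if "v \<notin> ?N" for v P
    using out_triv[OF that] by (auto intro: Wtriv wires_sys_trivial)
  have h: "reduced_box ?N z v \<in> Hom (?W (ins v)) (?W (outs v))" if "z \<in> valid" "v \<in> set vs" for z v
    unfolding reduced_box_def using hom[OF that] outN[of v] discard(1) by simp
  have h1: "T1 z v \<in> Hom (?W (filter F (ins v))) (?W (filter F (outs v)))" if zv: "z \<in> valid" "v \<in> set vs" for z v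
  proof -
    consider "v \<in> NA" "v \<notin> NB" | "v \<in> NB" "v \<notin> NA" | "v \<notin> ?N" using disj by blast
    then show ?thesis
    proof cases
      case 1
      then show ?thesis using hom[OF zv]
        by (simp add: T1_def insA'(1,2)[OF 1(1)] sep_outA(2,3)[OF 1(1)])
    next
      case 2
      then show ?thesis using ident_hom[of "\<I>"]
        by (simp add: T1_def insB'(1,2)[OF 2(1)] sep_outB(2,3)[OF 2(1)])
    next
      case 3
      then show ?thesis using discard(1) by (simp add: T1_def outN(1)[OF 3])
    qed
  qed
  have h2: "T2 z v \<in> Hom (?W (filter F' (ins v))) (?W (filter F' (outs v)))" if zv: "z \<in> valid" "v \<in> set vs" for z v
  proof -
    consider "v \<in> NA" "v \<notin> NB" | "v \<in> NB" "v \<notin> NA" | "v \<notin> ?N" using disj by blast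
    then show ?thesis
    proof cases
      case 1
      then show ?thesis using ident_hom[of "\<I>"]
        by (simp add: T2_def insA'(1,2)[OF 1(1)] sep_outA(2,3)[OF 1(1)])
    next
      case 2
      then show ?thesis using hom[OF zv]
        by (simp add: T2_def insB'(1,2)[OF 2(1)] sep_outB(2,3)[OF 2(1)])
    next
      case 3
      then show ?thesis using discard(1) by (simp add: T2_def outN(1)[OF 3])
    qed
  qed
  have comm: "separate ?sys F (outs v) \<cdot> reduced_box ?N z v = (T1 z v \<otimes> T2 z v) \<cdot> separate ?sys F (ins v)"
    if zv: "z \<in> valid" "v \<in> set vs" for z v
  proof -
    consider "v \<in> NA" "v \<notin> NB" | "v \<in> NB" "v \<notin> NA" | "v \<notin> ?N" using disj by blast
    then show ?thesis
    proof cases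
      case 1
      have b: "box z v \<in> Hom (?W (ins v)) (?W (outs v))" using hom[OF zv] 1 by simp
      show ?thesis using 1 sep_outA(1)[OF 1(1)] insA'(3)[OF 1(1)] ident_left[OF b] ident_right[OF b] par_unit_right[OF b]
        by (simp add: reduced_box_def T1_def T2_def)
    next
      case 2
      have b: "box z v \<in> Hom (?W (ins v)) (?W (outs v))" using hom[OF zv] 2 by simp
      show ?thesis using 2 sep_outB(1)[OF 2(1)] insB'(3)[OF 2(1)] ident_left[OF b] ident_right[OF b] par_unit_left[OF b]
        by (simp add: reduced_box_def T1_def T2_def)
    next
      \<comment> \<open>Discarding all inputs is discarding the two classes separately; the
        reordering between them vanishes by \<open>discard_perm\<close>.\<close>
      case 3
      have s: "separate ?sys F (outs v) = \<iota> \<I>" using separate_trivial[OF dis(2)] out_triv[OF 3] by blast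
      have "discard (?W (filter F (ins v))) \<otimes> discard (?W (filter F' (ins v))) = discard (?W (filter F (ins v) @ filter F' (ins v)))"
        by (simp add: discard_par wires_sys_append)
      moreover have "discard (?W (filter F (ins v) @ filter F' (ins v))) \<cdot> separate ?sys F (ins v) = discard (?W (ins v))"
        unfolding separate_def F'_def using dis(1) by (intro discard_perm) auto
      ultimately show ?thesis
        using 3 s by (simp add: reduced_box_def T1_def T2_def ident_left[OF discard(1)])
    qed
  qed
  have "reduced_val ?N z = \<phi> z * \<gamma> z" if z: "z \<in> valid" for z
  proof -
    let ?r1 = "run \<G> ?sys (\<lambda>v. filter F (ins v)) (\<lambda>v. filter F (outs v)) (T1 z) vs [] (\<iota> \<I>)"
    let ?r2 = "run \<G> ?sys (\<lambda>v. filter F' (ins v)) (\<lambda>v. filter F' (outs v)) (T2 z) vs [] (\<iota> \<I>)"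
    have "run \<G> ?sys ins outs (reduced_box ?N z) vs [] (\<iota> \<I>) =
      run \<G> ?sys (\<lambda>v. filter F (ins v)) (\<lambda>v. filter F (outs v)) (T1 z) vs (filter F []) (\<iota> \<I>) \<otimes>
      run \<G> ?sys (\<lambda>v. filter (\<lambda>w. \<not> F w) (ins v)) (\<lambda>v. filter (\<lambda>w. \<not> F w) (outs v)) (T2 z) vs (filter (\<lambda>w. \<not> F w) []) (\<iota> \<I>)"
      using h[OF z] h1[OF z] h2[OF z] comm[OF z] run_ok_vs
      by (intro run_factor) (auto simp: F'_def separate_def ident_hom par_ident sys_unit_left ident_left[OF ident_hom])
    then have "run \<G> ?sys ins outs (reduced_box ?N z) vs [] (\<iota> \<I>) = ?r1 \<otimes> ?r2" by (simp add: F'_def)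
    moreover have "?r1 \<in> Hom \<I> \<I>" "?r2 \<in> Hom \<I> \<I>"
      using run_ok_filter[OF run_ok_vs, of F] run_ok_filter[OF run_ok_vs, of F'] h1[OF z] h2[OF z] ident_hom
      by (auto intro!: run_hom)
    ultimately show ?thesis
      unfolding reduced_val_def \<phi>_def \<gamma>_def by (simp add: scalar_par)
  qed
  then show ?thesis using d1 d2 by blast
qed

end

section \<open>The kernel of the interrupted circuit\<close>

context circuit_realization
begin

abbreviation "S \<equiv> Inr ` cut_edges G :: ('a + 'a \<times> 'a) set"

definition circuit_kernel :: "('a + 'a \<times> 'a \<Rightarrow> 'x) \<Rightarrow> ('a + 'a \<times> 'a \<Rightarrow> 'x) \<Rightarrow> real" where
  "circuit_kernel x y = val (case_sum (\<lambda>v. x (Inl v)) (\<lambda>e. y (Inr e)))"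

lemma obs_minus: "obs H - S = Inl ` obs G"
  by (auto simp: MaxInt_simps)

lemma circuit_kernel_eq:
  assumes "\<And>v. v \<in> obs G \<Longrightarrow> z (Inl v) = x (Inl v)" "\<And>e. e \<in> cut_edges G \<Longrightarrow> z (Inr e) = y (Inr e)"
  shows "circuit_kernel x y = val z"
  unfolding circuit_kernel_def
  by (rule determined_byD[OF val_determined]) (use assms in \<open>auto simp: MaxInt_simps\<close>)

lemma kernel_circuit_kernel: "kernel H (obs H - S) S circuit_kernel"
  unfolding kernel_def obs_minus
proof (intro ballI conjI)
  fix y assume y: "y \<in> vals H S"
  \<comment> \<open>The outcome coordinates of \<open>z\<close> are arbitrary admissible values,
    overridden in every summand.\<close>
  define z where "z = (\<lambda>a. if a \<in> S then y a else (SOME x. x \<in> alph H a))"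
  have z: "z \<in> valid"
    unfolding valid_def z_def using y MaxInt_alph_nonempty by (auto simp: vals_def some_in_eq)
  have eq: "circuit_kernel x y = val (override_on z x (Inl ` obs G))" for x
    by (rule circuit_kernel_eq) (auto simp: z_def override_on_def)
  show "0 \<le> circuit_kernel x y" if "x \<in> vals H (Inl ` obs G)" for x
    unfolding eq using that by (intro val_nonneg valid_override[OF z]) (simp add: vals_def)
  show "(\<Sum>x\<in>vals H (Inl ` obs G). circuit_kernel x y) = 1"
    unfolding eq vals_def using sum_val[of "{}" z] z by (simp add: reduced_val_empty)
qed

lemma uniform_joint_val:
  "z \<in> vals H (obs H) \<Longrightarrow>
   uniform_joint H S circuit_kernel z = val z * (\<Prod>s\<in>S. 1 / real (card (alph H s)))"
  using circuit_kernel_eq[of z "restrict z (Inl ` obs G)" "restrict z S"]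
  unfolding uniform_joint_def obs_minus by simp

text \<open>Summing over the outcomes outside \<open>M\<close> gives \<open>reduced_val\<close>. The
  remaining boxes do not read the new vertices outside \<open>M\<close>, so summing over these only
  counts their joint values; \<open>K\<close> is this count times the uniform weight.\<close>

lemma marginal_val:
  assumes M: "\<And>a b. (a, b) \<in> edges H \<Longrightarrow> b \<in> M \<Longrightarrow> a \<in> M"
  shows "\<exists>K. \<forall>z\<in>vals H (obs H). marginal H (uniform_joint H S circuit_kernel) (obs H \<inter> M) z =
    K * reduced_val {v. Inl v \<in> M} z"
proof -
  let ?P = "uniform_joint H S circuit_kernel" and ?N = "{v. Inl v \<in> M}"
  let ?c = "\<Prod>s\<in>S. 1 / real (card (alph H s))"
  let ?D1 = "S - M" and ?D2 = "Inl ` (obs G - ?N) :: ('a + 'a \<times> 'a) set"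
  have D: "obs H - obs H \<inter> M = ?D1 \<union> ?D2" by (auto simp: MaxInt_simps)
  have "marginal H ?P (obs H \<inter> M) z = real (card (PiE ?D1 (alph H))) * ?c * reduced_val ?N z"
    if z: "z \<in> vals H (obs H)" for z
  proof -
    have det: "determined_by (reduced_val ?N) (obs H \<inter> M)"
      using M by (intro reduced_val_determined) (auto simp: dep_def)
    have "marginal H ?P (obs H \<inter> M) z = (\<Sum>f\<in>PiE (?D1 \<union> ?D2) (alph H). marginal H ?P (obs H) (override_on z f (?D1 \<union> ?D2)))"
      unfolding D[symmetric] by (rule MI.marginal_sum) auto
    also have "\<dots> = (\<Sum>f\<in>PiE (?D1 \<union> ?D2) (alph H). val (override_on z f (?D1 \<union> ?D2)) * ?c)"
    proof (intro sum.cong refl)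
      fix f assume "f \<in> PiE (?D1 \<union> ?D2) (alph H)"
      then have "override_on z f (?D1 \<union> ?D2) \<in> vals H (obs H)"
        by (intro MI.override_vals[OF z]) (auto simp: MaxInt_simps)
      then show "marginal H ?P (obs H) (override_on z f (?D1 \<union> ?D2)) = val (override_on z f (?D1 \<union> ?D2)) * ?c"
        by (simp add: MI.marginal_obs uniform_joint_val)
    qed
    also have "\<dots> = (\<Sum>f\<in>PiE ?D1 (alph H). \<Sum>g\<in>PiE ?D2 (alph H). val (override_on (override_on z f ?D1) g ?D2)) * ?c"
      unfolding sum_distrib_right[symmetric]
      by (subst sum_PiE_Un) (auto intro: finite_cut)
    also have "\<dots> = (\<Sum>f\<in>PiE ?D1 (alph H). reduced_val ?N (override_on z f ?D1)) * ?c"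
    proof (intro arg_cong[where f="\<lambda>x. x * ?c"] sum.cong refl sum_val)
      show "u \<in> ?N" if "(u, v) \<in> edges G - cut_edges G" "v \<in> ?N" for u v
      proof -
        have "(Inl u, Inl v) \<in> edges H" using that(1) by (auto simp: MaxInt_edges)
        then show ?thesis using M that(2) by blast
      qed
      show "override_on z f ?D1 \<in> valid" if "f \<in> PiE ?D1 (alph H)" for f
        by (rule valid_override[OF vals_valid[OF z] that])
    qed
    also have "\<dots> = (\<Sum>f\<in>PiE ?D1 (alph H). reduced_val ?N z) * ?c"
      by (intro arg_cong[where f="\<lambda>x. x * ?c"] sum.cong refl determined_byD[OF det]) (auto simp: override_on_def)
    finally show ?thesis by simp
  qed
  then show ?thesis by blast
qed

lemma circuit_kernel_markov: "circuit_kernel \<in> markov_kernels H S"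
  unfolding markov_kernels_def
proof (intro CollectI conjI kernel_circuit_kernel)
  show "uniform_joint H S circuit_kernel \<in> markov_model H"
  proof (rule MI.markov_modelI)
    show "uniform_joint H S circuit_kernel \<in> distributions H"
      by (rule MI.uniform_joint_distribution[OF _ _ kernel_circuit_kernel])
        (use MaxInt_alph_nonempty in \<open>auto simp: MaxInt_simps(1)\<close>)
    fix N1 N2 Z
    assume disj: "N1 \<inter> N2 = {}" "N1 \<inter> Z = {}" "N2 \<inter> Z = {}" and Z: "Z \<subseteq> obs H"
      and rootZ: "\<And>u v. v \<in> Z \<Longrightarrow> (u, v) \<notin> edges H"
      and c1: "\<And>u v. (u, v) \<in> edges H \<Longrightarrow> v \<in> N1 \<Longrightarrow> u \<in> N1 \<union> Z"
      and c2: "\<And>u v. (u, v) \<in> edges H \<Longrightarrow> v \<in> N2 \<Longrightarrow> u \<in> N2 \<union> Z"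
    let ?M = "N1 \<union> N2 \<union> Z"
    \<comment> \<open>A root in \<open>Z\<close> may be an original vertex with a box of its own, so
      \<open>Z\<close> must be put on one side. Its box has no parents to read and adds nothing
      outside \<open>Z\<close> to the dependencies.\<close>
    let ?NA = "{v. Inl v \<in> N1}" and ?NB = "{v. Inl v \<in> N2 \<union> Z}"
    have un: "?NA \<union> ?NB = {v. Inl v \<in> ?M}" by auto
    have latZ: "Inl u \<notin> Z" if "u \<in> lat G" for u
      using that Z disjoint by (auto simp: MaxInt_simps)
    have latE: "(Inl u, Inl v) \<in> edges H" if "(u, v) \<in> edges G" "u \<in> lat G" for u v
      using that disjoint cut_edges_obs[of u v G] by (auto simp: MaxInt_edges)
    obtain \<phi> \<gamma> where fg: "determined_by \<phi> (\<Union>v\<in>?NA. dep v)" "determined_by \<gamma> (\<Union>v\<in>?NB. dep v)"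
      "\<forall>z\<in>valid. reduced_val (?NA \<union> ?NB) z = \<phi> z * \<gamma> z"
    proof -
      have "\<exists>\<phi> \<gamma>. determined_by \<phi> (\<Union>v\<in>?NA. dep v) \<and> determined_by \<gamma> (\<Union>v\<in>?NB. dep v) \<and>
        (\<forall>z\<in>valid. reduced_val (?NA \<union> ?NB) z = \<phi> z * \<gamma> z)"
      proof (rule reduced_val_factor)
        show "?NA \<inter> ?NB = {}" using disj by blast
        show "u \<in> ?NA" if "(u, v) \<in> edges G" "u \<in> lat G" "v \<in> ?NA" for u v
          using c1[OF latE[OF that(1,2)]] that(3) latZ[OF that(2)] by blast
        show "u \<in> ?NB" if "(u, v) \<in> edges G" "u \<in> lat G" "v \<in> ?NB" for u v
          using c2[OF latE[OF that(1,2)]] rootZ latE[OF that(1,2)] that(3) by blast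
      qed
      then show thesis using that by blast
    qed
    have "a \<in> ?M" if "(a, b) \<in> edges H" "b \<in> ?M" for a b
      using that c1 c2 rootZ by blast
    then obtain K where K: "\<forall>z\<in>vals H (obs H). marginal H (uniform_joint H S circuit_kernel) (obs H \<inter> ?M) z =
       K * reduced_val (?NA \<union> ?NB) z"
      unfolding un using marginal_val[of ?M] by blast
    have "determined_by (\<lambda>z. K * \<phi> z) (obs H \<inter> (N1 \<union> Z))"
    proof -
      have "(\<Union>v\<in>?NA. dep v) \<subseteq> obs H \<inter> (N1 \<union> Z)" using c1 by (auto simp: dep_def)
      from determined_by_mono[OF fg(1) this] show ?thesis unfolding determined_by_def by metis
    qed
    moreover have "determined_by \<gamma> (obs H \<inter> (N2 \<union> Z))"
    proof -
      have "(\<Union>v\<in>?NB. dep v) \<subseteq> obs H \<inter> (N2 \<union> Z)" using c2 rootZ by (auto simp: dep_def)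
      from determined_by_mono[OF fg(2) this] show ?thesis .
    qed
    moreover have "\<forall>x\<in>vals H (obs H). marginal H (uniform_joint H S circuit_kernel) (obs H \<inter> ?M) x = K * \<phi> x * \<gamma> x"
      using K fg(3) vals_valid by simp
    ultimately show "\<exists>\<phi> \<gamma>. determined_by \<phi> (obs H \<inter> (N1 \<union> Z)) \<and> determined_by \<gamma> (obs H \<inter> (N2 \<union> Z)) \<and>
        (\<forall>x\<in>vals H (obs H). marginal H (uniform_joint H S circuit_kernel) (obs H \<inter> (N1 \<union> N2 \<union> Z)) x = \<phi> x * \<gamma> x)"
      by blast
  next
    show "acyclic (edges H)" by (rule MaxInt_acyclic)
    show "edges H \<subseteq> (obs H \<union> lat H) \<times> (obs H \<union> lat H)" by (rule MaxInt_edges_sub)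
    show "(\<forall>u. (u, v) \<notin> edges H) \<or> (\<forall>u. (v, u) \<notin> edges H)" if "v \<in> obs H" for v
      by (rule MaxInt_root_or_leaf[OF that])
  qed
qed

lemma circuit_in_MI:
  "(\<lambda>x. if x \<in> vals G (obs G)
    then scalar \<G> (Act (circuit \<G> G vs sys (vertex_box G T L x)) \<one>) else 0) \<in> MI G"
proof -
  have "int_proj G circuit_kernel x =
    (if x \<in> vals G (obs G) then scalar \<G> (Act (circuit \<G> G vs sys (vertex_box G T L x)) \<one>) else 0)" for x
  proof (cases "x \<in> vals G (obs G)")
    case True
    \<comment> \<open>Giving every \<open>u\<^sub>e\<close> the value of its origin restores the
      uninterrupted circuit; \<open>int_proj\<close> makes this same substitution.\<close>
    define z :: "'a + 'a \<times> 'a \<Rightarrow> 'x" where "z = case_sum x (\<lambda>e. x (fst e))"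
    have "vertex_box G T L x = box z"
    proof
      fix v
      have "restrict x (parents G v \<inter> obs G) = parent_vals z v"
        by (auto simp: parent_vals_def z_def fun_eq_iff restrict_def)
      then show "vertex_box G T L x v = box z v"
        by (simp add: vertex_box_def box_def Let_def z_def)
    qed
    then have "scalar \<G> (Act (circuit \<G> G vs sys (vertex_box G T L x)) \<one>) = val z"
      by (simp add: circuit_def val_def)
    moreover have "int_proj G circuit_kernel x = val z"
      using True circuit_kernel_eq[of z "\<lambda>a\<in>Inl ` obs G. x (projl a)" "\<lambda>a\<in>S. x (fst (projr a))"]
      unfolding int_proj_def by (simp add: z_def)
    ultimately show ?thesis using True by simp
  qed (simp add: int_proj_def)
  then have "int_proj G circuit_kernel = (\<lambda>x. if x \<in> vals G (obs G)
    then scalar \<G> (Act (circuit \<G> G vs sys (vertex_box G T L x)) \<one>) else 0)" by (rule ext)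
  from this[symmetric] show ?thesis unfolding MI_def using circuit_kernel_markov by blast
qed

end

lemma realizable_MI:
  assumes "causal_dag G" "gpt \<G>"
  shows "realizable \<G> G \<subseteq> MI G"
proof
  fix p assume "p \<in> realizable \<G> G"
  then obtain vs sys T L where *: "topological_ordering G vs"
    "\<forall>(v, y)\<in>edges G. v \<in> obs G \<longrightarrow> sys (v, y) = unit_sys \<G>"
    "\<forall>v\<in>obs G. \<forall>c\<in>vals G (parents G v \<inter> obs G).
        test \<G> (wires_sys \<G> sys (in_wires G vs v)) (wires_sys \<G> sys (out_wires G vs v)) (alph G v) (T v c)"
    "\<forall>v\<in>lat G. \<forall>c\<in>vals G (parents G v \<inter> obs G).
        test \<G> (wires_sys \<G> sys (in_wires G vs v)) (wires_sys \<G> sys (out_wires G vs v)) {()} (\<lambda>_. L v c)"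
    "p = (\<lambda>x. if x \<in> vals G (obs G)
      then scalar \<G> (act \<G> (circuit \<G> G vs sys (vertex_box G T L x)) (one_state \<G>)) else 0)"
    unfolding realizable_def by blast
  interpret gpt \<G> by (rule assms(2))
  interpret circuit_realization G \<G> vs sys T L
  proof
    show "causal_dag G" by (rule assms(1))
    show "topological_ordering G vs" by (rule *(1))
    show "sys (v, y) = unit_sys \<G>" if "(v, y) \<in> edges G" "v \<in> obs G" for v y
      using *(2) that by blast
    show "test \<G> (wires_sys \<G> sys (in_wires G vs v)) (wires_sys \<G> sys (out_wires G vs v)) (alph G v) (T v c)"
      if "v \<in> obs G" "c \<in> vals G (parents G v \<inter> obs G)" for v c using *(3) that by blast
    show "test \<G> (wires_sys \<G> sys (in_wires G vs v)) (wires_sys \<G> sys (out_wires G vs v)) {()} (\<lambda>_. L v c)"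
      if "v \<in> lat G" "c \<in> vals G (parents G v \<inter> obs G)" for v c using *(4) that by blast
  qed
  show "p \<in> MI G" unfolding *(5) by (rule circuit_in_MI)
qed

section \<open>From maximal interruption to vertex splitting\<close>

lemma VVSplit_simps:
  "obs (VVSplit G) = Inl ` obs G \<union> Inr ` split_verts G" "lat (VVSplit G) = Inl ` lat G"
  "alph (VVSplit G) (Inl v) = alph G v" "alph (VVSplit G) (Inr v) = alph G v"
  by (simp_all add: VVSplit_def)

lemma VVSplit_edges:
  "(a, b) \<in> edges (VVSplit G) \<longleftrightarrow> (\<exists>v y. b = Inl y \<and> (v, y) \<in> edges G \<and>
     a = (if v \<in> split_verts G then Inr v else Inl v))"
  unfolding VVSplit_def by auto

lemma split_verts_obs: "v \<in> split_verts G \<Longrightarrow> v \<in> obs G"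
  by (simp add: split_verts_def)

context causal
begin

sublocale VS: observed_dag "VVSplit G"
proof
  have "finite (split_verts G)"
    by (rule finite_subset[OF _ finite_obs]) (auto simp: split_verts_def)
  then show "finite (obs (VVSplit G))" by (simp add: VVSplit_simps finite_obs)
  show "finite (alph (VVSplit G) v)" if "v \<in> obs (VVSplit G)" for v
    using that by (auto simp: VVSplit_simps intro!: finite_alph split_verts_obs)
qed

lemma VVSplit_alph_nonempty: "v \<in> obs (VVSplit G) \<Longrightarrow> alph (VVSplit G) v \<noteq> {}"
  using alph_nonempty by (force simp: VVSplit_simps dest: split_verts_obs)

lemma VVSplit_acyclic: "acyclic (edges (VVSplit G))"
proof (rule acyclic_Inl[OF acyclic])
  show "\<exists>y. b = Inl y" if "(a, b) \<in> edges (VVSplit G)" for a b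
    using that unfolding VVSplit_edges by blast
  show "(v, y) \<in> edges G" if "(Inl v, Inl y) \<in> edges (VVSplit G)" for v y
    using that unfolding VVSplit_edges by (auto split: if_splits)
qed

lemma VVSplit_edges_sub: "edges (VVSplit G) \<subseteq>
  (obs (VVSplit G) \<union> lat (VVSplit G)) \<times> (obs (VVSplit G) \<union> lat (VVSplit G))"
  using edges_sub by (fastforce simp: VVSplit_edges VVSplit_simps)

lemma VVSplit_root_or_leaf:
  "v \<in> obs (VVSplit G) \<Longrightarrow> (\<forall>u. (u, v) \<notin> edges (VVSplit G)) \<or> (\<forall>u. (v, u) \<notin> edges (VVSplit G))"
  by (auto simp: VVSplit_simps VVSplit_edges split_verts_def parents_def children_def split: if_splits)

end

section \<open>Copying values from split to interrupted vertices\<close>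

locale interrupted_kernel = causal G for G :: "('a, 'x) dag" +
  fixes q :: "('a + 'a \<times> 'a \<Rightarrow> 'x) \<Rightarrow> ('a + 'a \<times> 'a \<Rightarrow> 'x) \<Rightarrow> real"
  assumes q: "q \<in> markov_kernels (MaxInt G) (Inr ` cut_edges G)"
begin

abbreviation "H \<equiv> MaxInt G"
abbreviation "K \<equiv> VVSplit G"
abbreviation "S \<equiv> Inr ` cut_edges G :: ('a + 'a \<times> 'a) set"
abbreviation "S' \<equiv> Inr ` split_verts G :: ('a + 'a) set"
abbreviation "P \<equiv> uniform_joint H S q"

text \<open>The density of the uniform inputs; dividing \<open>P\<close> by it recovers
  \<open>q\<close>.\<close>

definition weight where "weight = (\<Prod>s\<in>S. 1 / real (card (alph H s)))"

text \<open>The vertex of \<open>VVSplit G\<close> whose value is copied to an observed vertex of \<open>MaxInt G\<close>.\<close>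

definition source :: "'a + 'a \<times> 'a \<Rightarrow> 'a + 'a" where
  "source a = (case a of Inl v \<Rightarrow> Inl v | Inr (v, y) \<Rightarrow> if v \<in> split_verts G then Inr v else Inl v)"

definition copy :: "('a + 'a \<Rightarrow> 'x) \<Rightarrow> 'a + 'a \<times> 'a \<Rightarrow> 'x" where
  "copy z = (\<lambda>a\<in>obs H. z (source a))"

text \<open>Inputs of \<open>q\<close> at edges from split vertices come from \<open>y\<close>.
  Those at edges from an observed root with several children come from its own outcome in
  \<open>x\<close>.\<close>

definition split_kernel :: "('a + 'a \<Rightarrow> 'x) \<Rightarrow> ('a + 'a \<Rightarrow> 'x) \<Rightarrow> real" where
  "split_kernel x y =
     (let w = copy (case_sum (\<lambda>v. x (Inl v)) (\<lambda>v. y (Inr v))) in q (restrict w (Inl ` obs G)) (restrict w S))"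

text \<open>Each vertex in \<open>roots\<close> is a root, and each one in \<open>leaves\<close> a leaf, of both \<open>MaxInt G\<close> and
  \<open>VVSplit G\<close>.\<close>

definition roots :: "'a set" where
  "roots = {v \<in> obs G. v \<notin> split_verts G \<and> children G v \<noteq> {}}"

definition leaves :: "'a set" where
  "leaves = {v \<in> obs G. v \<in> split_verts G \<or> children G v = {}}"

lemma P_markov: "P \<in> markov_model H" and q_kernel: "kernel H (obs H - S) S q"
  using q by (auto simp: markov_kernels_def)

lemma P_dist: "P \<in> distributions H"
  using P_markov by (simp add: markov_model_def)

lemma obs_H_minus: "obs H - S = Inl ` obs G"
  by (auto simp: MaxInt_simps)

lemma obs_K_minus: "obs K - S' = Inl ` obs G"
  by (auto simp: VVSplit_simps)

lemma weight_pos: "weight > 0"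
  unfolding weight_def
proof (rule prod_pos)
  fix s assume "s \<in> S"
  then have "s \<in> obs H" by (simp add: MaxInt_simps)
  then have "card (alph H s) > 0" using MI.finite_alph MaxInt_alph_nonempty by (simp add: card_gt_0_iff)
  then show "1 / real (card (alph H s)) > 0" by simp
qed

lemma P_eq: "w \<in> vals H (obs H) \<Longrightarrow> P w = q (restrict w (Inl ` obs G)) (restrict w S) * weight"
  by (simp add: uniform_joint_def obs_H_minus weight_def)

lemma copy_vals: "(\<And>a. a \<in> obs K \<Longrightarrow> z a \<in> alph K a) \<Longrightarrow> copy z \<in> vals H (obs H)"
proof -
  assume z: "\<And>a. a \<in> obs K \<Longrightarrow> z a \<in> alph K a"
  have 1: "z (Inl v) \<in> alph G v" if "v \<in> obs G" for v
    using z[of "Inl v"] that by (simp add: VVSplit_simps)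
  have 2: "z (Inr v) \<in> alph G v" if "v \<in> split_verts G" for v
    using z[of "Inr v"] that by (simp add: VVSplit_simps)
  have 3: "z (Inl v) \<in> alph G v" if "(v, y) \<in> cut_edges G" for v y
    using 1 cut_edges_obs[OF that] by blast
  show ?thesis unfolding vals_def copy_def
    using 1 2 3 by (auto simp: MaxInt_simps source_def)
qed

lemma vals_alph: "z \<in> vals K (obs K) \<Longrightarrow> a \<in> obs K \<Longrightarrow> z a \<in> alph K a"
  by (auto simp: vals_def)

lemma copy_Inl: "v \<in> obs G \<Longrightarrow> copy z (Inl v) = z (Inl v)"
  by (simp add: copy_def source_def MaxInt_simps)

lemma copy_Inr: "(v, y) \<in> cut_edges G \<Longrightarrow>
   copy z (Inr (v, y)) = (if v \<in> split_verts G then z (Inr v) else z (Inl v))"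
  by (simp add: copy_def source_def MaxInt_simps)

lemma source_obs: "a \<in> obs H \<Longrightarrow> source a \<in> obs K"
  using cut_edges_obs[of _ _ G] by (auto simp: source_def MaxInt_simps VVSplit_simps)

lemma copy_cong: "(\<And>a. a \<in> obs K \<Longrightarrow> z a = z' a) \<Longrightarrow> copy z = copy z'"
  unfolding copy_def using source_obs by (intro restrict_ext) blast

lemma split_kernel_eq:
  assumes "\<And>v. v \<in> obs G \<Longrightarrow> z (Inl v) = x (Inl v)" "\<And>v. v \<in> split_verts G \<Longrightarrow> z (Inr v) = y (Inr v)"
    and "\<And>a. a \<in> obs K \<Longrightarrow> z a \<in> alph K a"
  shows "split_kernel x y = P (copy z) / weight"
proof -
  have "copy (case_sum (\<lambda>v. x (Inl v)) (\<lambda>v. y (Inr v))) = copy z"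
    using assms(1,2) by (intro copy_cong) (auto simp: VVSplit_simps)
  then show ?thesis using P_eq[OF copy_vals[OF assms(3)]] weight_pos by (simp add: split_kernel_def Let_def)
qed

text \<open>A change at \<open>Inl v\<close> also reaches the copies of \<open>v\<close> when
  \<open>v\<close> is not split. By the last condition \<open>h\<close> does not see such copies, so
  both sums run over one and the same coordinate.\<close>

lemma sum_copy:
  assumes "finite D" "determined_by h T"
    and "\<And>v. v \<in> D \<Longrightarrow> v \<in> obs G" "\<And>v y. v \<in> D \<Longrightarrow> (v, y) \<in> cut_edges G \<Longrightarrow> v \<notin> split_verts G \<Longrightarrow> Inr (v, y) \<notin> T"
  shows "(\<Sum>f\<in>PiE (Inl ` D) (alph K). h (copy (override_on z f (Inl ` D)))) =
    (\<Sum>f\<in>PiE (Inl ` D) (alph H). h (override_on (copy z) f (Inl ` D)))"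
  using assms(1,3,4)
proof (induction D arbitrary: z rule: finite_induct)
  case (insert v D)
  have k: "(Inl v :: 'a + 'a) \<notin> Inl ` D" "(Inl v :: 'a + 'a \<times> 'a) \<notin> Inl ` D" using insert.hyps by auto
  have eq: "h (override_on (copy (z(Inl v := x))) f (Inl ` D)) = h (override_on ((copy z)(Inl v := x)) f (Inl ` D))" for x f
  proof (rule determined_byD[OF assms(2)])
    fix a assume a: "a \<in> T"
    show "override_on (copy (z(Inl v := x))) f (Inl ` D) a = override_on ((copy z)(Inl v := x)) f (Inl ` D) a"
      using insert.prems(1)[of v] insert.prems(2)[of v] a
      by (cases a) (auto simp: override_on_def copy_def source_def MaxInt_simps split: if_splits)
  qed
  have "(\<Sum>f\<in>PiE (insert (Inl v) (Inl ` D)) (alph K). h (copy (override_on z f (insert (Inl v) (Inl ` D))))) =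
    (\<Sum>x\<in>alph G v. \<Sum>f\<in>PiE (Inl ` D) (alph K). h (copy (override_on (z(Inl v := x)) f (Inl ` D))))"
    unfolding sum_PiE_insert[OF k(1)] override_on_insert_upd[OF k(1)] by (simp add: VVSplit_simps)
  also have "\<dots> = (\<Sum>x\<in>alph G v. \<Sum>f\<in>PiE (Inl ` D) (alph H). h (override_on (copy (z(Inl v := x))) f (Inl ` D)))"
    using insert.prems by (intro sum.cong refl insert.IH) auto
  also have "\<dots> = (\<Sum>f\<in>PiE (insert (Inl v) (Inl ` D)) (alph H). h (override_on (copy z) f (insert (Inl v) (Inl ` D))))"
    unfolding sum_PiE_insert[OF k(2)] override_on_insert_upd[OF k(2)] eq by (simp add: MaxInt_simps)
  finally show ?case by simp
qed simp

text \<open>A leaf is split, so that its copies follow \<open>Inr v\<close>, or childless, so that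
  it has no copies. Summing it out is therefore ordinary marginalization in
  \<open>MaxInt G\<close>.\<close>

lemma sum_leaves:
  assumes D: "D \<subseteq> leaves" and z: "\<And>a. a \<in> obs K \<Longrightarrow> z a \<in> alph K a"
  shows "(\<Sum>f\<in>PiE (Inl ` D) (alph K). P (copy (override_on z f (Inl ` D)))) =
    marginal H P (obs H - Inl ` D) (copy z)"
proof -
  have sub: "(Inl ` D :: ('a + 'a \<times> 'a) set) \<subseteq> obs H" using D by (auto simp: leaves_def MaxInt_simps)
  have DD: "obs H - (obs H - Inl ` D) = Inl ` D" using sub by auto
  have fin: "finite D" using D finite_obs by (rule_tac finite_subset[of _ "obs G"]) (auto simp: leaves_def)
  have "(\<Sum>f\<in>PiE (Inl ` D) (alph K). P (copy (override_on z f (Inl ` D)))) =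
    (\<Sum>f\<in>PiE (Inl ` D) (alph H). P (override_on (copy z) f (Inl ` D)))"
  proof (rule sum_copy[of D P UNIV])
    show "determined_by P UNIV" unfolding determined_by_def by (metis UNIV_I ext)
  qed (use D fin in \<open>auto simp: leaves_def cut_edges_def children_def\<close>)
  also have "\<dots> = (\<Sum>f\<in>PiE (Inl ` D) (alph H). marginal H P (obs H) (override_on (copy z) f (Inl ` D)))"
    using MI.override_vals[OF copy_vals[OF z] sub] by (intro sum.cong refl MI.marginal_obs[symmetric]) auto
  also have "\<dots> = marginal H P (obs H - Inl ` D) (copy z)"
    using MI.marginal_sum[of "obs H - Inl ` D" "obs H" P "copy z"] unfolding DD by auto
  finally show ?thesis .
qed

section \<open>Independence of parentless vertices and normalization\<close>

lemma root_ancestor: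
  assumes "r \<in> S \<union> Inl ` roots" "(w, r) \<in> (edges H)\<^sup>*"
  shows "w = r"
proof (rule ccontr)
  assume "w \<noteq> r"
  then obtain u where "(u, r) \<in> edges H" using assms(2) by (metis rtranclE)
  then show False using assms(1)
    by (auto simp: MaxInt_edges roots_def split_verts_def parents_def children_def)
qed

text \<open>A parentless vertex is its own only ancestor. If it is above nothing in
  \<open>M\<close>, it shares no ancestor with \<open>M\<close> or with another root.\<close>

lemma marginal_roots:
  assumes M: "M \<subseteq> obs H" and "finite R" "R \<subseteq> S \<union> Inl ` roots"
    "\<And>r a. r \<in> R \<Longrightarrow> a \<in> M \<Longrightarrow> (r, a) \<notin> (edges H)\<^sup>*" and w: "w \<in> vals H (obs H)"
  shows "marginal H P (M \<union> R) w = marginal H P M w * (\<Prod>r\<in>R. marginal H P {r} w)"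
  using assms(2-4)
proof (induction R rule: finite_induct)
  case (insert r R)
  have robs: "S \<union> Inl ` roots \<subseteq> obs H" by (auto simp: MaxInt_simps roots_def)
  have "marginal H P (M \<union> R \<union> {r}) w = marginal H P (M \<union> R) w * marginal H P {r} w"
  proof (rule MI.markov_disjoint_ancestors[OF P_markov _ _ _ w])
    show "M \<union> R \<subseteq> obs H" "{r} \<subseteq> obs H" using M subset_trans[OF insert.prems(1) robs] by simp_all
    fix u a b assume ab: "a \<in> M \<union> R" "b \<in> {r}" "(u, a) \<in> (edges H)\<^sup>*" "(u, b) \<in> (edges H)\<^sup>*"
    then have u: "u = r" using root_ancestor insert.prems(1) by auto
    show False
    proof (cases "a \<in> M")
      case True
      then show False using insert.prems(2) u ab(3) by blast
    next
      case False
      then have "a \<in> R" using ab(1) by blast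
      then have "u = a" using root_ancestor[of a u] ab(3) insert.prems(1) by auto
      then show False using u \<open>a \<in> R\<close> insert.hyps by simp
    qed
  qed
  then show ?case using insert by (simp add: Un_assoc Un_insert_right)
qed simp

text \<open>Summing over the outcomes removes \<open>q\<close> by its normalization and leaves the
  uniform density.\<close>

lemma marginal_S: "w \<in> vals H (obs H) \<Longrightarrow> marginal H P S w = weight"
proof -
  assume w: "w \<in> vals H (obs H)"
  have "marginal H P S w = (\<Sum>f\<in>PiE (Inl ` obs G) (alph H). marginal H P (obs H) (override_on w f (Inl ` obs G)))"
    using MI.marginal_sum[of S "obs H" P w] unfolding obs_H_minus by (auto simp: MaxInt_simps)
  also have "\<dots> = (\<Sum>f\<in>PiE (Inl ` obs G) (alph H). q f (restrict w S) * weight)"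
  proof (intro sum.cong refl)
    fix f assume f: "f \<in> PiE (Inl ` obs G) (alph H)"
    let ?w = "override_on w f (Inl ` obs G)"
    have v: "?w \<in> vals H (obs H)" by (rule MI.override_vals[OF w _ f]) (auto simp: MaxInt_simps)
    have "restrict ?w (Inl ` obs G) = f" "restrict ?w S = restrict w S"
      using f by (auto simp: fun_eq_iff restrict_def PiE_def extensional_def override_on_def)
    then show "marginal H P (obs H) ?w = q f (restrict w S) * weight"
      using P_eq[OF v] MI.marginal_obs[OF v] by simp
  qed
  also have "\<dots> = weight"
  proof -
    have "restrict w S \<in> vals H S" using w by (auto simp: vals_def MaxInt_simps)
    then have "(\<Sum>f\<in>vals H (Inl ` obs G). q f (restrict w S)) = 1"
      using q_kernel unfolding kernel_def obs_H_minus by blast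
    then show ?thesis by (simp add: sum_distrib_right[symmetric] vals_def)
  qed
  finally show ?thesis .
qed

text \<open>Once the leaves are summed out, a marginal on parentless vertices of
  \<open>MaxInt G\<close> remains, in which the inputs are independent of the outcomes at
  \<open>roots\<close>. The inputs contribute the constant \<open>weight\<close> whatever values
  were copied to them, so the sum over \<open>roots\<close> is the total mass of a marginal.\<close>

lemma kernel_split_kernel: "kernel K (obs K - S') S' split_kernel"
  unfolding kernel_def obs_K_minus
proof (intro ballI conjI)
  fix y assume y: "y \<in> vals K S'"
  define z where "z = (\<lambda>a. if a \<in> S' then y a else (SOME x. x \<in> alph K a))"
  have z: "z a \<in> alph K a" if "a \<in> obs K" for a
    unfolding z_def using y VVSplit_alph_nonempty[OF that] by (auto simp: vals_def some_in_eq)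
  have zf: "override_on z f D a \<in> alph K a" if "a \<in> obs K" "f \<in> PiE D (alph K)" for f D a
    using z[OF that(1)] that(2) by (auto simp: override_on_def)
  have eq: "split_kernel x y = P (copy (override_on z x (Inl ` obs G))) / weight" if "x \<in> vals K (Inl ` obs G)" for x
  proof (rule split_kernel_eq)
    show "override_on z x (Inl ` obs G) a \<in> alph K a" if "a \<in> obs K" for a
      by (rule zf[OF that]) (use \<open>x \<in> vals K (Inl ` obs G)\<close> in \<open>simp add: vals_def\<close>)
  qed (auto simp: z_def override_on_def)
  have Pn: "0 \<le> P w" for w using P_dist by (simp add: distributions_def)
  show "0 \<le> split_kernel x y" if "x \<in> vals K (Inl ` obs G)" for x
    using eq[OF that] Pn weight_pos by simp
  let ?R = "Inl ` roots :: ('a + 'a) set" and ?L = "Inl ` leaves :: ('a + 'a) set"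
  let ?RH = "Inl ` roots :: ('a + 'a \<times> 'a) set"
  have fr: "finite roots" unfolding roots_def using finite_obs by simp
  have RL: "Inl ` obs G = ?R \<union> ?L" "?R \<inter> ?L = {}" by (auto simp: roots_def leaves_def)
  have HL: "obs H - Inl ` leaves = S \<union> ?RH" by (auto simp: MaxInt_simps roots_def leaves_def)
  have sub: "?RH \<subseteq> obs H" by (auto simp: MaxInt_simps roots_def)
  have "(\<Sum>x\<in>vals K (Inl ` obs G). split_kernel x y) =
     (\<Sum>x\<in>PiE (?R \<union> ?L) (alph K). P (copy (override_on z x (?R \<union> ?L)))) / weight"
    unfolding sum_divide_distrib RL(1)[symmetric] using eq by (intro sum.cong) (auto simp: vals_def)
  also have "(\<Sum>x\<in>PiE (?R \<union> ?L) (alph K). P (copy (override_on z x (?R \<union> ?L)))) =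
     (\<Sum>f\<in>PiE ?R (alph K). \<Sum>g\<in>PiE ?L (alph K). P (copy (override_on (override_on z f ?R) g ?L)))"
    using fr RL(2) by (intro sum_PiE_Un[where h="\<lambda>z. P (copy z)"]) auto
  also have "\<dots> = (\<Sum>f\<in>PiE ?R (alph K). weight * marginal H P ?RH (copy (override_on z f ?R)))"
  proof (intro sum.cong refl)
    fix f assume f: "f \<in> PiE ?R (alph K)"
    have w: "copy (override_on z f ?R) \<in> vals H (obs H)" using zf[OF _ f] by (rule copy_vals)
    have "marginal H P (S \<union> ?RH) (copy (override_on z f ?R)) =
       marginal H P S (copy (override_on z f ?R)) * marginal H P ?RH (copy (override_on z f ?R))"
    proof (rule MI.markov_disjoint_ancestors[OF P_markov _ sub _ w])
      show "S \<subseteq> obs H" by (auto simp: MaxInt_simps)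
      fix u a b assume "a \<in> S" "b \<in> ?RH" "(u, a) \<in> (edges H)\<^sup>*" "(u, b) \<in> (edges H)\<^sup>*"
      then show False using root_ancestor[of a u] root_ancestor[of b u] by auto
    qed
    then show "(\<Sum>g\<in>PiE ?L (alph K). P (copy (override_on (override_on z f ?R) g ?L))) =
      weight * marginal H P ?RH (copy (override_on z f ?R))"
      using sum_leaves[of leaves "override_on z f ?R"] zf[OF _ f] marginal_S[OF w] unfolding HL by simp
  qed
  also have "\<dots> = weight * (\<Sum>f\<in>PiE ?R (alph K). marginal H P ?RH (copy (override_on z f ?R)))"
    by (simp add: sum_distrib_left)
  also have "(\<Sum>f\<in>PiE ?R (alph K). marginal H P ?RH (copy (override_on z f ?R))) =
    (\<Sum>f\<in>PiE ?RH (alph H). marginal H P ?RH (override_on (copy z) f ?RH))"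
    by (intro sum_copy[OF fr MI.marginal_determined]) (auto simp: roots_def)
  also have "\<dots> = marginal H P {} (copy z)"
    using MI.marginal_sum[OF _ sub, of "{}" P "copy z"] by simp
  also have "\<dots> = 1" by (rule MI.marginal_empty[OF P_dist])
  finally show "(\<Sum>x\<in>vals K (Inl ` obs G). split_kernel x y) = 1" using weight_pos by simp
qed

lemma split_proj_kernel: "split_proj G split_kernel = int_proj G q"
proof
  fix x show "split_proj G split_kernel x = int_proj G q x"
  proof (cases "x \<in> vals G (obs G)")
    case True
    let ?x = "\<lambda>a\<in>(Inl ` obs G :: ('a + 'a) set). x (projl a)" and ?y = "\<lambda>a\<in>S'. x (projr a)"
    let ?w = "copy (case_sum (\<lambda>v. ?x (Inl v)) (\<lambda>v. ?y (Inr v)))"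
    have "restrict ?w (Inl ` obs G) = (\<lambda>a\<in>Inl ` obs G. x (projl a))"
      by (rule restrict_ext) (auto simp: copy_Inl)
    moreover have "restrict ?w S = (\<lambda>a\<in>S. x (fst (projr a)))"
    proof (rule restrict_ext)
      fix a assume "a \<in> S"
      then obtain v y where a: "a = Inr (v, y)" "(v, y) \<in> cut_edges G" by auto
      then have "v \<in> obs G" using cut_edges_obs[of v y G] by blast
      then show "?w a = x (fst (projr a))" using a by (simp add: copy_Inr)
    qed
    ultimately show ?thesis using True by (simp add: split_proj_def int_proj_def split_kernel_def Let_def)
  qed (simp add: split_proj_def int_proj_def)
qed

end

section \<open>The Markov property of the split kernel\<close>

context interrupted_kernel
begin

abbreviation "P' \<equiv> uniform_joint K S' split_kernel"

lemma P'_eq: "\<exists>k. \<forall>z\<in>vals K (obs K). P' z = P (copy z) * k"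
proof -
  let ?k = "(\<Prod>s\<in>S'. 1 / real (card (alph K s))) / weight"
  have "P' z = P (copy z) * ?k" if z: "z \<in> vals K (obs K)" for z
  proof -
    have "split_kernel (restrict z (Inl ` obs G)) (restrict z S') = P (copy z) / weight"
      using vals_alph[OF z] by (intro split_kernel_eq) auto
    then show ?thesis using z by (simp add: uniform_joint_def obs_K_minus)
  qed
  then show ?thesis by blast
qed

lemma determined_copy:
  assumes "determined_by h T" "T \<subseteq> obs H"
  shows "determined_by (\<lambda>z. h (copy z)) (source ` T)"
  unfolding determined_by_def
proof (intro allI impI)
  fix z z' :: "'a + 'a \<Rightarrow> 'x" assume "\<forall>a\<in>source ` T. z a = z' a"
  then show "h (copy z) = h (copy z')"
    using assms(2) by (intro determined_byD[OF assms(1)]) (auto simp: copy_def)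
qed

lemma source_edge: "(v, y) \<in> edges G \<Longrightarrow> (source (Inr (v, y)), Inl y) \<in> edges K"
  by (auto simp: source_def VVSplit_edges)

lemma uncut: "(v, y) \<notin> cut_edges G \<Longrightarrow> (v, y) \<in> edges G \<Longrightarrow> v \<notin> split_verts G \<and> v \<notin> rip_verts G"
  by (auto simp: cut_edges_def)

text \<open>An uncut edge is also an edge of \<open>VVSplit G\<close>, while at a cut edge the
  ascent ends in a new vertex, which is parentless. In that case the head \<open>y\<close> is
  recorded, because a tail in \<open>Z\<close> does not determine the side.\<close>

lemma ancestor_closed:
  fixes X Z :: "('a + 'a) set"
  assumes closed: "\<forall>a b. (a, b) \<in> edges K \<longrightarrow> b \<in> X \<longrightarrow> a \<in> X \<union> Z"
    and rootZ: "\<forall>a b. b \<in> Z \<longrightarrow> (a, b) \<notin> edges K"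
    and "(w, Inl v) \<in> (edges H)\<^sup>*" "Inl v \<in> X \<union> Z"
  shows "(\<exists>u. w = Inl u \<and> Inl u \<in> X \<union> Z) \<or> (\<exists>u y. w = Inr (u, y) \<and> (u, y) \<in> edges G \<and> Inl y \<in> X)"
  using assms(3)
proof (induction rule: converse_rtrancl_induct)
  case base
  then show ?case using assms(4) by blast
next
  case (step w w')
  obtain u y where uy: "w' = Inl y" "(u, y) \<in> edges G" "w = (if (u, y) \<in> cut_edges G then Inr (u, y) else Inl u)"
    using step.hyps(1) unfolding MaxInt_edges by blast
  have e: "(source (Inr (u, y)), Inl y) \<in> edges K" by (rule source_edge[OF uy(2)])
  have "Inl y \<in> X \<union> Z" using step.IH uy(1) by auto
  then have y: "Inl y \<in> X" using rootZ e by blast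
  show ?case
  proof (cases "(u, y) \<in> cut_edges G")
    case True
    then show ?thesis using uy y by auto
  next
    case False
    have "source (Inr (u, y)) \<in> X \<union> Z" using closed e y by blast
    then have "Inl u \<in> X \<union> Z" using uncut[OF False uy(2)] by (simp add: source_def)
    then show ?thesis using uy(3) False by simp
  qed
qed

lemma source_closed:
  fixes X Z :: "('a + 'a) set"
  assumes closed: "\<forall>a b. (a, b) \<in> edges K \<longrightarrow> b \<in> X \<longrightarrow> a \<in> X \<union> Z"
    and rootZ: "\<forall>a b. b \<in> Z \<longrightarrow> (a, b) \<notin> edges K"
    and w: "(w, Inl v) \<in> (edges H)\<^sup>*" "Inl v \<in> X \<union> Z"
  shows "source w \<in> X \<union> Z"
proof -
  consider u where "w = Inl u" "Inl u \<in> X \<union> Z" | u y where "w = Inr (u, y)" "(u, y) \<in> edges G" "Inl y \<in> X"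
    using ancestor_closed[OF closed rootZ w] by blast
  then show ?thesis
  proof cases
    case 1
    then show ?thesis by (simp add: source_def)
  next
    case 2
    then show ?thesis using closed source_edge[OF 2(2)] 2(3) by blast
  qed
qed

text \<open>A root of \<open>VVSplit G\<close> lying in \<open>Z\<close> may have children on both sides; in \<open>MaxInt G\<close> its
  outgoing edges are cut apart, so it connects the two sides no longer.\<close>

lemma no_common_ancestor:
  fixes N1 N2 Z :: "('a + 'a) set"
  assumes disj: "N1 \<inter> N2 = {}" "N1 \<inter> Z = {}" "N2 \<inter> Z = {}" and Z: "Z \<subseteq> obs K"
    and rootZ: "\<forall>a b. b \<in> Z \<longrightarrow> (a, b) \<notin> edges K"
    and c1: "\<forall>a b. (a, b) \<in> edges K \<longrightarrow> b \<in> N1 \<longrightarrow> a \<in> N1 \<union> Z"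
    and c2: "\<forall>a b. (a, b) \<in> edges K \<longrightarrow> b \<in> N2 \<longrightarrow> a \<in> N2 \<union> Z"
    and l: "l1 \<in> leaves" "l2 \<in> leaves" "Inl l1 \<in> N1" "Inl l2 \<in> N2 \<union> Z"
    and w: "(w, Inl l1) \<in> (edges H)\<^sup>*" "(w, Inl l2) \<in> (edges H)\<^sup>*"
  shows False
proof -
  have w1: "(\<exists>u. w = Inl u \<and> Inl u \<in> N1 \<union> Z) \<or> (\<exists>u y. w = Inr (u, y) \<and> (u, y) \<in> edges G \<and> Inl y \<in> N1)"
    by (rule ancestor_closed[OF c1 rootZ w(1)]) (use l in auto)
  have w2: "(\<exists>u. w = Inl u \<and> Inl u \<in> N2 \<union> Z) \<or> (\<exists>u y. w = Inr (u, y) \<and> (u, y) \<in> edges G \<and> Inl y \<in> N2)"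
    by (rule ancestor_closed[OF c2 rootZ w(2)]) (use l in auto)
  show False
  proof (cases w)
    \<comment> \<open>A new vertex has a single child, which cannot lie on both sides.\<close>
    case (Inr e)
    then show False using w1 w2 disj by auto
  next
    case (Inl u)
    then have u: "Inl u \<in> Z" using w1 w2 disj by auto
    then have uG: "u \<in> obs G" using Z by (auto simp: VVSplit_simps)
    have first: "\<exists>y. (u, y) \<in> edges G \<and> (u, y) \<notin> cut_edges G \<and> (Inl y, Inl l) \<in> (edges H)\<^sup>*"
      if wl: "(w, Inl l) \<in> (edges H)\<^sup>*" and lu: "l \<noteq> u" for l
    proof -
      obtain x where x: "(w, x) \<in> edges H" "(x, Inl l) \<in> (edges H)\<^sup>*"
        using wl lu Inl by (auto elim: converse_rtranclE)
      obtain v y where "x = Inl y" "(v, y) \<in> edges G" "w = (if (v, y) \<in> cut_edges G then Inr (v, y) else Inl v)"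
        using x(1) unfolding MaxInt_edges by blast
      then show ?thesis using x(2) Inl by (auto split: if_splits)
    qed
    have "l1 \<noteq> u" using l(3) u disj by auto
    then obtain y1 where y1: "(u, y1) \<in> edges G" "(u, y1) \<notin> cut_edges G" "(Inl y1, Inl l1) \<in> (edges H)\<^sup>*"
      using first[OF w(1)] by blast
    have us: "u \<notin> split_verts G" "u \<notin> rip_verts G" using uncut[OF y1(2,1)] by auto
    have "u \<notin> leaves" using us y1(1) by (auto simp: leaves_def children_def)
    then obtain y2 where y2: "(u, y2) \<in> edges G" "(Inl y2, Inl l2) \<in> (edges H)\<^sup>*"
      using first[OF w(2)] l(2) by blast
    have nz: "Inl y1 \<notin> Z" "Inl y2 \<notin> Z" using source_edge[OF y1(1)] source_edge[OF y2(1)] rootZ by blast+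
    have "(\<exists>v. (Inl y1 :: 'a + 'a \<times> 'a) = Inl v \<and> Inl v \<in> N1 \<union> Z) \<or> (\<exists>v y. (Inl y1 :: 'a + 'a \<times> 'a) = Inr (v, y) \<and> (v, y) \<in> edges G \<and> Inl y \<in> N1)"
      by (rule ancestor_closed[OF c1 rootZ y1(3)]) (use l in auto)
    then have "Inl y1 \<in> N1" using nz by simp
    moreover have "(\<exists>v. (Inl y2 :: 'a + 'a \<times> 'a) = Inl v \<and> Inl v \<in> N2 \<union> Z) \<or> (\<exists>v y. (Inl y2 :: 'a + 'a \<times> 'a) = Inr (v, y) \<and> (v, y) \<in> edges G \<and> Inl y \<in> N2)"
      by (rule ancestor_closed[OF c2 rootZ y2(2)]) (use l in auto)
    then have "Inl y2 \<in> N2" using nz by simp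
    \<comment> \<open>An uncut edge leaves \<open>u\<close>, so \<open>u\<close> is not in
      \<open>rip_verts G\<close> and has only one child; that child would lie in both
      \<open>N1\<close> and \<open>N2\<close>.\<close>
    moreover have "y1 = y2"
    proof -
      have "finite (children G u)"
        using finite_edges by (rule finite_subset[rotated, OF finite_imageI[of _ snd]]) (force simp: children_def)
      moreover have "card (children G u) \<le> Suc 0" using us(2) uG by (simp add: rip_verts_def)
      ultimately show ?thesis using y1(1) y2(1) by (simp add: card_le_Suc0_iff_eq children_def)
    qed
    ultimately show False using disj by blast
  qed
qed

text \<open>Summing out the leaves outside \<open>N1 \<union> N2 \<union> Z\<close> leaves a
  marginal of \<open>P\<close>. It is the product of the marginals on the ancestries of the leaves
  of the two sides and of the single marginals of the roots above none of these leaves. Such a root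
  is sorted by the side of its \<open>source\<close>; those with source outside contribute a
  constant after summation.\<close>

lemma marginal_split:
  fixes N1 N2 Z :: "('a + 'a) set"
  assumes disj: "N1 \<inter> N2 = {}" "N1 \<inter> Z = {}" "N2 \<inter> Z = {}" and Z: "Z \<subseteq> obs K"
    and rootZ: "\<And>a b. b \<in> Z \<Longrightarrow> (a, b) \<notin> edges K"
    and c1: "\<And>a b. (a, b) \<in> edges K \<Longrightarrow> b \<in> N1 \<Longrightarrow> a \<in> N1 \<union> Z"
    and c2: "\<And>a b. (a, b) \<in> edges K \<Longrightarrow> b \<in> N2 \<Longrightarrow> a \<in> N2 \<union> Z"
  shows "\<exists>\<phi> \<gamma>. determined_by \<phi> (obs K \<inter> (N1 \<union> Z)) \<and> determined_by \<gamma> (obs K \<inter> (N2 \<union> Z)) \<and>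
    (\<forall>z\<in>vals K (obs K). marginal K P' (obs K \<inter> (N1 \<union> N2 \<union> Z)) z = \<phi> z * \<gamma> z)"
proof -
  have rootZ': "\<forall>a b. b \<in> Z \<longrightarrow> (a, b) \<notin> edges K" using rootZ by blast
  have c1': "\<forall>a b. (a, b) \<in> edges K \<longrightarrow> b \<in> N1 \<longrightarrow> a \<in> N1 \<union> Z" using c1 by blast
  have c2': "\<forall>a b. (a, b) \<in> edges K \<longrightarrow> b \<in> N2 \<longrightarrow> a \<in> N2 \<union> Z" using c2 by blast
  let ?N = "N1 \<union> N2 \<union> Z"
  define MA where "MA = {a \<in> obs H. \<exists>l\<in>leaves. Inl l \<in> N1 \<and> (a, Inl l) \<in> (edges H)\<^sup>*}"
  \<comment> \<open>A leaf in \<open>Z\<close> has neither parents nor children and is counted on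
    the second side.\<close>
  define MB where "MB = {a \<in> obs H. \<exists>l\<in>leaves. Inl l \<in> N2 \<union> Z \<and> (a, Inl l) \<in> (edges H)\<^sup>*}"
  define R where "R = S \<union> Inl ` roots - (MA \<union> MB)"
  define D1 where "D1 = S' \<union> Inl ` roots - ?N"
  define L where "L = {v \<in> leaves. Inl v \<notin> ?N}"
  define R1 where "R1 = {r \<in> R. source r \<in> N1}"
  define R2 where "R2 = {r \<in> R. source r \<in> N2 \<union> Z}"
  define R3 where "R3 = {r \<in> R. source r \<notin> ?N}"
  let ?m = "\<lambda>r. marginal H P {r}"
  define \<phi> where "\<phi> = (\<lambda>z. marginal H P MA (copy z) * (\<Prod>r\<in>R1. ?m r (copy z)))"
  define \<gamma> where "\<gamma> = (\<lambda>z. marginal H P MB (copy z) * (\<Prod>r\<in>R2. ?m r (copy z)))"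
  define \<delta> where "\<delta> = (\<lambda>z. \<Prod>r\<in>R3. ?m r (copy z))"
  have Robs: "R \<subseteq> obs H" by (auto simp: R_def MaxInt_simps roots_def)
  then have finR: "finite R" using MI.finite_obs by (rule finite_subset)
  have MAobs: "MA \<subseteq> obs H" "MB \<subseteq> obs H" by (auto simp: MA_def MB_def)
  have prod_det: "determined_by (\<lambda>z. \<Prod>r\<in>R'. ?m r (copy z)) (source ` R')" if "R' \<subseteq> R" for R'
  proof (rule determined_copy)
    show "R' \<subseteq> obs H" using that Robs by simp
    show "determined_by (\<lambda>w. \<Prod>r\<in>R'. ?m r w) R'"
      unfolding determined_by_def
    proof (intro allI impI prod.cong refl)
      fix x y :: "'a + 'a \<times> 'a \<Rightarrow> 'x" and r assume "\<forall>v\<in>R'. x v = y v" "r \<in> R'"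
      then show "?m r x = ?m r y" by (intro determined_byD[OF MI.marginal_determined]) simp
    qed
  qed
  have mult_det: "determined_by (\<lambda>z. f z * g z) T" if fg: "determined_by f A" "determined_by g B" "A \<subseteq> T" "B \<subseteq> T"
    for f g :: "('a + 'a \<Rightarrow> 'x) \<Rightarrow> real" and A B T
    unfolding determined_by_def
  proof (intro allI impI)
    fix x y :: "'a + 'a \<Rightarrow> 'x" assume "\<forall>v\<in>T. x v = y v"
    then have "f x = f y" "g x = g y"
      using determined_byD[OF fg(1), of x y] determined_byD[OF fg(2), of x y] fg(3,4) by auto
    then show "f x * g x = f y * g y" by simp
  qed
  have sA: "source ` MA \<subseteq> obs K \<inter> (N1 \<union> Z)"
  proof
    fix b assume "b \<in> source ` MA"
    then obtain a l where "b = source a" "a \<in> obs H" "Inl l \<in> N1" "(a, Inl l) \<in> (edges H)\<^sup>*"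
      unfolding MA_def by blast
    then show "b \<in> obs K \<inter> (N1 \<union> Z)" using source_closed[OF c1' rootZ', of a l] source_obs[of a] by simp
  qed
  have sB: "source ` MB \<subseteq> obs K \<inter> (N2 \<union> Z)"
  proof
    fix b assume "b \<in> source ` MB"
    then obtain a l where "b = source a" "a \<in> obs H" "Inl l \<in> N2 \<union> Z" "(a, Inl l) \<in> (edges H)\<^sup>*"
      unfolding MB_def by blast
    then show "b \<in> obs K \<inter> (N2 \<union> Z)" using source_closed[OF c2' rootZ', of a l] source_obs[of a] by simp
  qed
  have det\<phi>: "determined_by \<phi> (obs K \<inter> (N1 \<union> Z))"
    unfolding \<phi>_def
  proof (rule mult_det[OF determined_copy[OF MI.marginal_determined MAobs(1)] prod_det sA])
    show "R1 \<subseteq> R" "source ` R1 \<subseteq> obs K \<inter> (N1 \<union> Z)" using Robs source_obs unfolding R1_def by blast+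
  qed
  have det\<gamma>: "determined_by \<gamma> (obs K \<inter> (N2 \<union> Z))"
    unfolding \<gamma>_def
  proof (rule mult_det[OF determined_copy[OF MI.marginal_determined MAobs(2)] prod_det sB])
    show "R2 \<subseteq> R" "source ` R2 \<subseteq> obs K \<inter> (N2 \<union> Z)" using Robs source_obs unfolding R2_def by blast+
  qed
  have source_root: "source r \<in> S' \<union> Inl ` roots" if r: "r \<in> S \<union> Inl ` roots" for r
  proof (cases r)
    case (Inl v)
    then show ?thesis using r by (auto simp: source_def)
  next
    case (Inr e)
    then obtain u y where e: "r = Inr (u, y)" "(u, y) \<in> cut_edges G" using r by (cases e) auto
    then have "u \<in> obs G" "y \<in> children G u" using cut_edges_obs[of u y G] by (auto simp: cut_edges_def children_def)
    then have "u \<in> split_verts G \<or> u \<in> roots" unfolding roots_def by blast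
    then show ?thesis unfolding e(1) source_def by auto
  qed
  have det\<delta>: "determined_by \<delta> D1"
  proof -
    have "source ` R3 \<subseteq> D1" using source_root unfolding R3_def R_def D1_def by blast
    moreover have "determined_by \<delta> (source ` R3)" unfolding \<delta>_def by (rule prod_det) (auto simp: R3_def)
    ultimately show ?thesis by (rule determined_by_mono[rotated])
  qed
  have leaf_desc: "b = Inl v" if "v \<in> leaves" "(Inl v, b) \<in> (edges H)\<^sup>*" for v and b :: "'a + 'a \<times> 'a"
    using that(2)
  proof (cases rule: converse_rtranclE)
    case (step x)
    then show ?thesis using that(1)
      by (auto simp: MaxInt_edges leaves_def children_def cut_edges_def split: if_splits)
  qed simp
  \<comment> \<open>A root is in \<open>R\<close> unless it is above a chosen leaf, and chosen
    leaves are their own ancestors. A leaf in \<open>L\<close> is above nothing but itself, so it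
    belongs to none of these sets.\<close>
  have HL: "obs H - Inl ` L = (MA \<union> MB) \<union> R"
  proof (intro equalityI subsetI)
    fix a assume a: "a \<in> obs H - Inl ` L"
    show "a \<in> (MA \<union> MB) \<union> R"
    proof (cases "a \<in> S \<union> Inl ` roots")
      case False
      then obtain v where v: "a = Inl v" "v \<in> leaves"
        using a by (auto simp: MaxInt_simps roots_def leaves_def)
      then have "Inl v \<in> ?N" using a unfolding L_def by auto
      then show ?thesis using a v unfolding MA_def MB_def by auto
    qed (auto simp: R_def)
  next
    fix a assume a: "a \<in> (MA \<union> MB) \<union> R"
    have "a \<notin> Inl ` L"
    proof
      assume "a \<in> Inl ` L"
      then obtain v where v: "a = Inl v" "v \<in> leaves" "Inl v \<notin> ?N" unfolding L_def by auto
      have "a \<notin> S \<union> Inl ` roots" using v by (auto simp: roots_def leaves_def)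
      then have "a \<in> MA \<union> MB" using a unfolding R_def by blast
      then obtain l where "Inl l \<in> ?N" "(Inl v, Inl l) \<in> (edges H)\<^sup>*"
        unfolding MA_def MB_def v(1) by blast
      then show False using leaf_desc[OF v(2)] v(3) by auto
    qed
    then show "a \<in> obs H - Inl ` L" using a MAobs Robs by blast
  qed
  have KD: "obs K - obs K \<inter> ?N = D1 \<union> Inl ` L" "D1 \<inter> Inl ` L = {}"
    unfolding D1_def L_def by (auto simp: VVSplit_simps roots_def leaves_def)
  have D1obs: "D1 \<subseteq> obs K" "finite D1" "Inl ` L \<subseteq> obs K"
  proof -
    show 1: "D1 \<subseteq> obs K" by (auto simp: D1_def VVSplit_simps roots_def)
    then show "finite D1" using VS.finite_obs by (rule finite_subset)
    show "Inl ` L \<subseteq> obs K" by (auto simp: L_def VVSplit_simps leaves_def)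
  qed
  have joint: "marginal H P (obs H - Inl ` L) (copy z) = \<phi> z * \<gamma> z * \<delta> z"
    if z: "\<And>a. a \<in> obs K \<Longrightarrow> z a \<in> alph K a" for z
  proof -
    let ?w = "copy z"
    have w: "?w \<in> vals H (obs H)" by (rule copy_vals[OF z])
    have "marginal H P ((MA \<union> MB) \<union> R) ?w = marginal H P (MA \<union> MB) ?w * (\<Prod>r\<in>R. ?m r ?w)"
    proof (rule marginal_roots[OF _ finR _ _ w])
      show "MA \<union> MB \<subseteq> obs H" using MAobs by blast
      show "R \<subseteq> S \<union> Inl ` roots" by (auto simp: R_def)
      fix r a assume r: "r \<in> R" and a: "a \<in> MA \<union> MB"
      show "(r, a) \<notin> (edges H)\<^sup>*"
      proof
        assume ra: "(r, a) \<in> (edges H)\<^sup>*"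
        have "r \<in> MA \<union> MB"
          using a ra r Robs unfolding MA_def MB_def by (blast intro: rtrancl_trans)
        then show False using r unfolding R_def by blast
      qed
    qed
    also have "marginal H P (MA \<union> MB) ?w = marginal H P MA ?w * marginal H P MB ?w"
    proof (rule MI.markov_disjoint_ancestors[OF P_markov MAobs _ w])
      fix u a b assume ab: "a \<in> MA" "b \<in> MB" "(u, a) \<in> (edges H)\<^sup>*" "(u, b) \<in> (edges H)\<^sup>*"
      obtain l1 where l1: "l1 \<in> leaves" "Inl l1 \<in> N1" "(u, Inl l1) \<in> (edges H)\<^sup>*"
        using ab(1,3) unfolding MA_def by (blast intro: rtrancl_trans)
      obtain l2 where l2: "l2 \<in> leaves" "Inl l2 \<in> N2 \<union> Z" "(u, Inl l2) \<in> (edges H)\<^sup>*"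
        using ab(2,4) unfolding MB_def by (blast intro: rtrancl_trans)
      show False
        by (rule no_common_ancestor[OF disj Z rootZ' c1' c2' l1(1) l2(1) l1(2) l2(2) l1(3) l2(3)])
    qed
    also have "(\<Prod>r\<in>R. ?m r ?w) = (\<Prod>r\<in>R1. ?m r ?w) * (\<Prod>r\<in>R2. ?m r ?w) * (\<Prod>r\<in>R3. ?m r ?w)"
    proof -
      have "R = (R1 \<union> R2) \<union> R3" unfolding R1_def R2_def R3_def by auto
      moreover have "R1 \<inter> R2 = {}" "(R1 \<union> R2) \<inter> R3 = {}" using disj unfolding R1_def R2_def R3_def by auto
      moreover have "finite R1" "finite R2" "finite R3" using finR unfolding R1_def R2_def R3_def by auto
      ultimately show ?thesis by (simp add: prod.union_disjoint)
    qed
    finally show ?thesis unfolding HL \<phi>_def \<gamma>_def \<delta>_def by (simp add: mult_ac)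
  qed
  obtain k where k: "\<And>z. z \<in> vals K (obs K) \<Longrightarrow> P' z = P (copy z) * k" using P'_eq by blast
  \<comment> \<open>\<open>\<delta>\<close> reads only \<open>D1\<close>, all of which is summed
    over, so \<open>C\<close> is constant and can be put into the second factor.\<close>
  define C where "C = (\<lambda>z. \<Sum>f\<in>PiE D1 (alph K). \<delta> (override_on z f D1))"
  have "marginal K P' (obs K \<inter> ?N) z = \<phi> z * (\<gamma> z * (C z * k))" if z: "z \<in> vals K (obs K)" for z
  proof -
    have al: "override_on z f D1 a \<in> alph K a" if "f \<in> PiE D1 (alph K)" "a \<in> obs K" for f a
      using vals_alph[OF z that(2)] that(1) by (auto simp: override_on_def)
    have "marginal K P' (obs K \<inter> ?N) z =
      (\<Sum>f\<in>PiE (D1 \<union> Inl ` L) (alph K). marginal K P' (obs K) (override_on z f (D1 \<union> Inl ` L)))"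
      unfolding KD(1)[symmetric] by (rule VS.marginal_sum) auto
    also have "\<dots> = (\<Sum>f\<in>PiE (D1 \<union> Inl ` L) (alph K). P (copy (override_on z f (D1 \<union> Inl ` L)))) * k"
      unfolding sum_distrib_right
    proof (intro sum.cong refl)
      fix f assume "f \<in> PiE (D1 \<union> Inl ` L) (alph K)"
      then have "override_on z f (D1 \<union> Inl ` L) \<in> vals K (obs K)"
        using D1obs by (intro VS.override_vals[OF z]) auto
      then show "marginal K P' (obs K) (override_on z f (D1 \<union> Inl ` L)) = P (copy (override_on z f (D1 \<union> Inl ` L))) * k"
        by (simp add: VS.marginal_obs k)
    qed
    also have "(\<Sum>f\<in>PiE (D1 \<union> Inl ` L) (alph K). P (copy (override_on z f (D1 \<union> Inl ` L)))) =
      (\<Sum>f\<in>PiE D1 (alph K). \<Sum>g\<in>PiE (Inl ` L) (alph K). P (copy (override_on (override_on z f D1) g (Inl ` L))))"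
      by (rule sum_PiE_Un[OF D1obs(2) KD(2), where h="\<lambda>z. P (copy z)"])
    also have "\<dots> = (\<Sum>f\<in>PiE D1 (alph K). \<phi> z * \<gamma> z * \<delta> (override_on z f D1))"
    proof (intro sum.cong refl)
      fix f assume f: "f \<in> PiE D1 (alph K)"
      have "\<phi> (override_on z f D1) = \<phi> z" "\<gamma> (override_on z f D1) = \<gamma> z"
        by (rule determined_byD[OF det\<phi>] determined_byD[OF det\<gamma>]; auto simp: D1_def override_on_def)+
      then show "(\<Sum>g\<in>PiE (Inl ` L) (alph K). P (copy (override_on (override_on z f D1) g (Inl ` L)))) =
          \<phi> z * \<gamma> z * \<delta> (override_on z f D1)"
        using sum_leaves[of L "override_on z f D1"] joint[of "override_on z f D1"] al[OF f] by (simp add: L_def)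
    qed
    finally show ?thesis by (simp add: sum_distrib_left[symmetric] C_def mult_ac)
  qed
  moreover have "determined_by C {}"
    unfolding determined_by_def C_def
    by (intro allI impI sum.cong refl determined_byD[OF det\<delta>]) (simp add: override_on_def)
  then have "determined_by (\<lambda>z. \<gamma> z * (C z * k)) (obs K \<inter> (N2 \<union> Z))"
    using det\<gamma> unfolding determined_by_def by (metis empty_iff)
  ultimately show ?thesis using det\<phi> by blast
qed

lemma split_kernel_markov: "split_kernel \<in> markov_kernels K S'"
  unfolding markov_kernels_def
proof (intro CollectI conjI kernel_split_kernel)
  show "P' \<in> markov_model K"
  proof (rule VS.markov_modelI)
    show "P' \<in> distributions K"
    proof (rule VS.uniform_joint_distribution[OF _ _ kernel_split_kernel])
      show "S' \<subseteq> obs K" by (auto simp: VVSplit_simps)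
      show "alph K s \<noteq> {}" if "s \<in> S'" for s
        using that by (intro VVSplit_alph_nonempty) (auto simp: VVSplit_simps)
    qed
    show "acyclic (edges K)" by (rule VVSplit_acyclic)
    show "edges K \<subseteq> (obs K \<union> lat K) \<times> (obs K \<union> lat K)" by (rule VVSplit_edges_sub)
    show "(\<forall>u. (u, v) \<notin> edges K) \<or> (\<forall>u. (v, u) \<notin> edges K)" if "v \<in> obs K" for v
      by (rule VVSplit_root_or_leaf[OF that])
    fix N1 N2 Z :: "('a + 'a) set"
    assume disj: "N1 \<inter> N2 = {}" "N1 \<inter> Z = {}" "N2 \<inter> Z = {}" and Z: "Z \<subseteq> obs K"
      and rootZ: "\<And>a b. b \<in> Z \<Longrightarrow> (a, b) \<notin> edges K"
      and c1: "\<And>a b. (a, b) \<in> edges K \<Longrightarrow> b \<in> N1 \<Longrightarrow> a \<in> N1 \<union> Z"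
      and c2: "\<And>a b. (a, b) \<in> edges K \<Longrightarrow> b \<in> N2 \<Longrightarrow> a \<in> N2 \<union> Z"
    show "\<exists>\<phi> \<gamma>. determined_by \<phi> (obs K \<inter> (N1 \<union> Z)) \<and> determined_by \<gamma> (obs K \<inter> (N2 \<union> Z)) \<and>
      (\<forall>z\<in>vals K (obs K). marginal K P' (obs K \<inter> (N1 \<union> N2 \<union> Z)) z = \<phi> z * \<gamma> z)"
      by (rule marginal_split[OF disj Z]) (erule rootZ, erule (1) c1, erule (1) c2)
  qed
qed

end

lemma MI_VVS:
  assumes "causal_dag G" shows "MI G \<subseteq> VVS G"
proof
  fix p assume "p \<in> MI G"
  then obtain q where pq: "p = int_proj G q" "q \<in> markov_kernels (MaxInt G) (Inr ` cut_edges G)"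
    unfolding MI_def by blast
  interpret interrupted_kernel G q by unfold_locales (rule assms, rule pq(2))
  have "p = split_proj G split_kernel" using pq(1) split_proj_kernel by simp
  then show "p \<in> VVS G" unfolding VVS_def using split_kernel_markov by blast
qed

theorem lemma3:
  fixes G :: "('a, 'x) dag"
  assumes "causal_dag G"
  shows "GPT_dists TYPE(('s, 'm, 'w::real_vector) gpt_struct) G \<subseteq> MI G \<and> MI G \<subseteq> VVS G"
  unfolding GPT_dists_def using realizable_MI[OF assms] MI_VVS[OF assms] by blast

end
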